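(* Let $G$ be a residually finite group with profinite completion $\widehat{G}$, and let $\widehat\mu$ be the (normalised) Haar measure on $\widehat{G}^2$. Then \[ \widehat\mu(\operatorname{Comm}(\widehat{G})) = \widehat\mu(\overline{\operatorname{Comm}(G)}) = \operatorname{dc}_{\mathrm{RF}}(G) = \operatorname{dc}_{\mathrm{CCM}}(G). \] Moreover, this number is positive if and only if $G$ is virtually abelian.
   Context: For a group $K$, $\operatorname{Comm}(K)=\{(g,h)\in K^2: gh=hg\}$. For a finite group $K$, $\operatorname{dc}(K)=|\operatorname{Comm}(K)|/|K|^2$. For any group $G$, $\operatorname{dc}_{\mathrm{RF}}(G)=\inf\{\operatorname{dc}(G/N): N\unlhd G,\ [G:N]<\infty\}$. The profinite completion is $\widehat{G}=\varprojlim G/N$ over all finite index normal subgroups $N$ of $G$, with the inverse limit topology (finite quotients discrete); it is a compact Hausdorff totally disconnected group. As $G$ is residually finite, $g\mapsto (gN)_N$ embeds $G$ as a dense subgroup of $\widehat{G}$, and $G$ is identified with its image. $\overline{\operatorname{Comm}(G)}$ is the closure of $\operatorname{Comm}(G)$ in $\widehat{G}^2$. The Haar measure $\widehat\mu$ is the unique left invariant regular Borel probability measure on the compact group $\widehat{G}^2$. A coset correct mean (CCM) on $G$ is a function $\mu\colon \mathcal{P}(G)\to[0,1]$ with (i) $\mu(G)=1$; (ii) $\mu(A\sqcup B)=\mu(A)+\mu(B)$ for disjoint $A,B\subseteq G$; (iii) $\mu(gH)=\frac{1}{[G:H]}$ for all subgroups $H\le G$ and $g\in G$ (read as $0$ if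 $[G:H]=\infty$). For a bounded $f\colon G\to\mathbb{R}$, $\int f\,\mathrm{d}\mu$ is the usual integral (the unique monotone linear functional on bounded functions with $\int\mathbf{1}_A\,\mathrm{d}\mu=\mu(A)$). The product mean on $G^2$ is $\mu^{(2)}(S)=\int\mu(S_g)\,\mathrm{d}\mu(g)$ with $S_g=\{h\in G:(g,h)\in S\}$, and $\operatorname{dc}_\mu(G)=\mu^{(2)}(\operatorname{Comm}(G))$. Every group admits a CCM and $\operatorname{dc}_\mu(G)$ does not depend on the choice of the CCM $\mu$; $\operatorname{dc}_{\mathrm{CCM}}(G)$ denotes this common value. *)

theory Defs
  imports "HOL-Probability.Probability" "HOL-Algebra.Coset"
begin

section \<open>Commuting pairs and finite quotients\<close>

definition Comm :: "('a, 'b) monoid_scheme \<Rightarrow> ('a \<times> 'a) set" where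
  "Comm K = {(g, h) \<in> carrier K \<times> carrier K. g \<otimes>\<^bsub>K\<^esub> h = h \<otimes>\<^bsub>K\<^esub> g}"

text \<open>Only meaningful for finite groups.\<close>
definition dc :: "('a, 'b) monoid_scheme \<Rightarrow> real" where
  "dc K = real (card (Comm K)) / (real (order K))\<^sup>2"

definition finite_index_normals :: "('a, 'b) monoid_scheme \<Rightarrow> 'a set set" where
  "finite_index_normals G = {N. N \<lhd> G \<and> finite (rcosets\<^bsub>G\<^esub> N)}"

definition dc_RF :: "('a, 'b) monoid_scheme \<Rightarrow> real" where
  "dc_RF G = (INF N \<in> finite_index_normals G. dc (G Mod N))"

definition residually_finite :: "('a, 'b) monoid_scheme \<Rightarrow> bool" where
  "residually_finite G \<longleftrightarrow>
     (\<forall>g \<in> carrier G. g \<noteq> \<one>\<^bsub>G\<^esub> \<longrightarrow> (\<exists>N \<in> finite_index_normals G. g \<notin> N))"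

definition virtually_abelian :: "('a, 'b) monoid_scheme \<Rightarrow> bool" where
  "virtually_abelian G \<longleftrightarrow>
     (\<exists>H. subgroup H G \<and> finite (rcosets\<^bsub>G\<^esub> H) \<and> comm_group (G\<lparr>carrier := H\<rparr>))"


section \<open>The profinite completion\<close>

text \<open>For \<open>N \<subseteq> M\<close>, the canonical projection from \<open>G Mod N\<close> to \<open>G Mod M\<close> maps a coset \<open>C\<close> of \<open>N\<close> to
  the coset \<open>M C\<close> of \<open>M\<close>. The elements of the inverse limit are the compatible families.\<close>
definition profinite_completion :: "('a, 'b) monoid_scheme \<Rightarrow> ('a set \<Rightarrow> 'a set) monoid" where
  "profinite_completion G =
     \<lparr>carrier = {x \<in> (\<Pi>\<^sub>E N \<in> finite_index_normals G. carrier (G Mod N)).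
                   \<forall>N \<in> finite_index_normals G. \<forall>M \<in> finite_index_normals G.
                     N \<subseteq> M \<longrightarrow> M <#>\<^bsub>G\<^esub> x N = x M},
      monoid.mult = (\<lambda>x y. \<lambda>N \<in> finite_index_normals G. x N \<otimes>\<^bsub>G Mod N\<^esub> y N),
      one = (\<lambda>N \<in> finite_index_normals G. \<one>\<^bsub>G Mod N\<^esub>)\<rparr>"

definition profinite_topology :: "('a, 'b) monoid_scheme \<Rightarrow> ('a set \<Rightarrow> 'a set) topology" where
  "profinite_topology G =
     subtopology
       (product_topology (\<lambda>N. discrete_topology (carrier (G Mod N))) (finite_index_normals G))
       (carrier (profinite_completion G))"

definition profinite_embedding :: "('a, 'b) monoid_scheme \<Rightarrow> 'a \<Rightarrow> ('a set \<Rightarrow> 'a set)" where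
  "profinite_embedding G g = (\<lambda>N \<in> finite_index_normals G. N #>\<^bsub>G\<^esub> g)"

definition closure_Comm ::
    "('a, 'b) monoid_scheme \<Rightarrow> (('a set \<Rightarrow> 'a set) \<times> ('a set \<Rightarrow> 'a set)) set" where
  "closure_Comm G =
     prod_topology (profinite_topology G) (profinite_topology G) closure_of
       (map_prod (profinite_embedding G) (profinite_embedding G) ` Comm G)"


section \<open>Normalised Haar measure\<close>

text \<open>The Borel sets of an abstract topology are used, since the groups here are carriers rather
  than types. On a compact Hausdorff space the two regularity conditions are equivalent
  for probability measures.\<close>
definition haar_probability ::
    "('a, 'b) monoid_scheme \<Rightarrow> 'a topology \<Rightarrow> 'a measure \<Rightarrow> bool" where
  "haar_probability K T M \<longleftrightarrow>
     space M = topspace T \<and>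
     sets M = sigma_sets (topspace T) {U. openin T U} \<and>
     prob_space M \<and>
     (\<forall>g \<in> carrier K. \<forall>A \<in> sets M. emeasure M (g <#\<^bsub>K\<^esub> A) = emeasure M A) \<and>
     (\<forall>A \<in> sets M. emeasure M A = (INF U \<in> {U. openin T U \<and> A \<subseteq> U}. emeasure M U)) \<and>
     (\<forall>A \<in> sets M. emeasure M A =
        (SUP C \<in> {C. compactin T C \<and> C \<in> sets M \<and> C \<subseteq> A}. emeasure M C))"

definition haar_measure :: "('a, 'b) monoid_scheme \<Rightarrow> 'a topology \<Rightarrow> 'a measure" where
  "haar_measure K T = (THE M. haar_probability K T M)"

definition profinite_haar2 ::
    "('a, 'b) monoid_scheme \<Rightarrow> (('a set \<Rightarrow> 'a set) \<times> ('a set \<Rightarrow> 'a set)) measure" where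
  "profinite_haar2 G =
     haar_measure (profinite_completion G \<times>\<times> profinite_completion G)
       (prod_topology (profinite_topology G) (profinite_topology G))"


section \<open>Coset correct means\<close>

definition coset_correct_mean :: "('a, 'b) monoid_scheme \<Rightarrow> ('a set \<Rightarrow> real) \<Rightarrow> bool" where
  "coset_correct_mean G \<mu> \<longleftrightarrow>
     (\<forall>A. A \<subseteq> carrier G \<longrightarrow> 0 \<le> \<mu> A \<and> \<mu> A \<le> 1) \<and>
     \<mu> (carrier G) = 1 \<and>
     (\<forall>A B. A \<subseteq> carrier G \<longrightarrow> B \<subseteq> carrier G \<longrightarrow> A \<inter> B = {} \<longrightarrow> \<mu> (A \<union> B) = \<mu> A + \<mu> B) \<and>
     (\<forall>H g. subgroup H G \<longrightarrow> g \<in> carrier G \<longrightarrow>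
        \<mu> (g <#\<^bsub>G\<^esub> H) =
          (if finite (rcosets\<^bsub>G\<^esub> H) then 1 / real (card (rcosets\<^bsub>G\<^esub> H)) else 0))"

text \<open>Values of functions outside \<open>carrier G\<close> are irrelevant: monotonicity only compares
  functions on the carrier, so \<open>I\<close> cannot distinguish functions that agree there.\<close>
definition mean_functional ::
    "('a, 'b) monoid_scheme \<Rightarrow> ('a set \<Rightarrow> real) \<Rightarrow> (('a \<Rightarrow> real) \<Rightarrow> real) \<Rightarrow> bool" where
  "mean_functional G \<mu> I \<longleftrightarrow>
     (\<forall>f g. bounded (f ` carrier G) \<longrightarrow> bounded (g ` carrier G) \<longrightarrow>
        I (\<lambda>x. f x + g x) = I f + I g) \<and>
     (\<forall>c f. bounded (f ` carrier G) \<longrightarrow> I (\<lambda>x. c * f x) = c * I f) \<and>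
     (\<forall>f g. bounded (f ` carrier G) \<longrightarrow> bounded (g ` carrier G) \<longrightarrow>
        (\<forall>x \<in> carrier G. f x \<le> g x) \<longrightarrow> I f \<le> I g) \<and>
     (\<forall>A. A \<subseteq> carrier G \<longrightarrow> I (indicat_real A) = \<mu> A)"

text \<open>Only meaningful for \<open>f\<close> bounded on the carrier. The uniqueness of the functional \<open>I\<close> is
  uniqueness of its values at such \<open>f\<close>.\<close>
definition mean_integral ::
    "('a, 'b) monoid_scheme \<Rightarrow> ('a set \<Rightarrow> real) \<Rightarrow> ('a \<Rightarrow> real) \<Rightarrow> real" where
  "mean_integral G \<mu> f = (THE c. \<exists>I. mean_functional G \<mu> I \<and> c = I f)"

definition product_mean ::
    "('a, 'b) monoid_scheme \<Rightarrow> ('a set \<Rightarrow> real) \<Rightarrow> ('a \<times> 'a) set \<Rightarrow> real" where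
  "product_mean G \<mu> S = mean_integral G \<mu> (\<lambda>g. \<mu> {h \<in> carrier G. (g, h) \<in> S})"

definition dc_mean :: "('a, 'b) monoid_scheme \<Rightarrow> ('a set \<Rightarrow> real) \<Rightarrow> real" where
  "dc_mean G \<mu> = product_mean G \<mu> (Comm G)"

text \<open>The common value of \<open>dc_mean G \<mu>\<close> over all coset correct means \<open>\<mu>\<close>.\<close>
definition dc_CCM :: "('a, 'b) monoid_scheme \<Rightarrow> real" where
  "dc_CCM G = (THE d. {dc_mean G \<mu> | \<mu>. coset_correct_mean G \<mu>} = {d})"

end

theory Submission
  imports Defs "HOL-Algebra.Product_Groups"
begin

text \<open>
  With \<open>D\<^sub>\<mu>\<close> the degree of commutativity of a coset correct mean \<open>\<mu>\<close>, the theorem is a closed chain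
  \<open>D\<^sub>\<mu> \<le> measure of closure of Comm G \<le> measure of Comm of the completion \<le> dc_RF \<le> D\<^sub>\<mu>\<close>. The first three
  inequalities only use that both the product mean and the Haar measure give a pair of cosets of \<open>N\<close>
  the weight \<open>1 / [G : N]\<^sup>2\<close>.

  For the last one, if \<open>dc_RF\<close> is positive, then in every quotient \<open>G/N\<close> the elements with at most \<open>n\<close>
  conjugates have density bounded below. Choosing \<open>n\<close> such that passing from \<open>n\<close> to \<open>n\<^sup>4\<close> does not
  double this density, the elements with at most \<open>n\<^sup>2\<close> conjugates form a subgroup of \<open>G/N\<close> which is
  eventually independent of \<open>N\<close>; so \<open>G\<close> has a finite index subgroup with bounded classes and is virtually
  abelian. In a virtually abelian group, the elements with finite classes have only finitely many
  commutators, which a small \<open>N\<close> separates from \<open>\<one>\<close>, while all other elements have classes that are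
  uniformly large modulo \<open>N\<close> and contribute arbitrarily little to \<open>dc (G/N)\<close>.
\<close>

section \<open>Finitely additive means\<close>

text \<open>The integral, \<open>dc_CCM\<close> and the Haar measure are defined by
  \<open>THE\<close>, so each needs existence as well as uniqueness; this shapes the development. A
  coset correct mean comes first, from finite sets that are equidistributed among finitely many
  cosets; B. H. Neumann's theorem on coverings by cosets gives room to avoid cosets of infinite
  index. The Haar measure is then built from that mean: a clopen set of pairs receives the product
  mean of its trace on the square of \<open>G\<close>. A clopen set around the closure of
  \<open>Comm G\<close> has a trace containing \<open>Comm G\<close>, whence the first inequality of
  the chain. The exponent 4 is 3 + 1: without doubling, level n^3 collapses to level n^2, and this
  gives closure under products. A suitable n exists because the infima over N of the densities are
  bounded in n. Independence of N holds because a proper subgroup has a disjoint translate, hence at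
  most half the density. From bounded classes to virtually abelian leads a maximal-class argument:
  it confines certain commutators to a finite set, which residual finiteness separates from
  one.\<close>

text \<open>By Tychonoff, a net of functionals with pointwise bounds has a cluster point \<open>\<phi>\<close>, and \<open>\<phi>\<close> inherits
  every closed condition that holds eventually. This replaces ultrafilter limits.\<close>
lemma product_cluster_point:
  fixes \<Phi> :: "'i \<Rightarrow> 'x \<Rightarrow> real"
  assumes "F \<noteq> bot" and bd: "\<And>i x. \<bar>\<Phi> i x\<bar> \<le> B x"
  obtains \<phi> L where "L \<noteq> bot" "L \<le> filtermap \<Phi> F" "\<And>x. ((\<lambda>\<psi>. \<psi> x) \<longlongrightarrow> \<phi> x) L"
proof -
  let ?K = "\<Pi>\<^sub>E x\<in>UNIV. {- B x..B x}"
  have "compactin (product_topology (\<lambda>x. euclidean) UNIV) ?K"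
    by (simp add: compactin_PiE)
  then have "compact ?K"
    by (simp add: euclidean_product_topology flip: compactin_euclidean_iff)
  moreover have "filtermap \<Phi> F \<noteq> bot"
    using assms(1) by (simp add: filtermap_bot_iff)
  moreover have "eventually (\<lambda>\<psi>. \<psi> \<in> ?K) (filtermap \<Phi> F)"
    unfolding eventually_filtermap
  proof (intro always_eventually allI PiE_I)
    fix i x show "\<Phi> i x \<in> {- B x..B x}" using bd[of i x] by (auto simp: abs_le_iff)
  qed simp
  ultimately obtain \<phi> where \<phi>: "inf (nhds \<phi>) (filtermap \<Phi> F) \<noteq> bot"
    unfolding compact_filter by blast
  let ?L = "inf (nhds \<phi>) (filtermap \<Phi> F)"
  have "((\<lambda>\<psi>. \<psi> x) \<longlongrightarrow> \<phi> x) ?L" for x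
  proof -
    have "((\<lambda>\<psi>. \<psi> x) \<longlongrightarrow> \<phi> x) (nhds \<phi>)"
    proof (rule topological_tendstoI)
      fix S :: "real set" assume "open S" "\<phi> x \<in> S"
      moreover have "open ((\<lambda>\<psi>::'x \<Rightarrow> real. \<psi> x) -` S)"
        using open_vimage[OF \<open>open S\<close> continuous_on_product_coordinates[of x]] by simp
      ultimately show "\<forall>\<^sub>F \<psi> in nhds \<phi>. \<psi> x \<in> S"
        unfolding eventually_nhds by (intro exI[of _ "(\<lambda>\<psi>. \<psi> x) -` S"]) auto
    qed
    then show ?thesis by (rule tendsto_mono[rotated]) simp
  qed
  with \<phi> show ?thesis by (intro that[of ?L \<phi>]) auto
qed

lemma eventually_cluster:
  assumes "L \<le> filtermap \<Phi> F" "eventually (\<lambda>i. P (\<Phi> i)) F"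
  shows "eventually P L"
  using assms by (auto simp: le_filter_def eventually_filtermap)

section \<open>Integration against a finitely additive probability\<close>

locale additive_mean =
  fixes G :: "('a, 'b) monoid_scheme" and \<mu> :: "'a set \<Rightarrow> real"
  assumes mean_nonneg: "A \<subseteq> carrier G \<Longrightarrow> 0 \<le> \<mu> A"
    and mean_carrier: "\<mu> (carrier G) = 1"
    and mean_Un: "\<lbrakk>A \<subseteq> carrier G; B \<subseteq> carrier G; A \<inter> B = {}\<rbrakk> \<Longrightarrow> \<mu> (A \<union> B) = \<mu> A + \<mu> B"
begin

lemma mean_empty [simp]: "\<mu> {} = 0"
  using mean_Un[of "{}" "{}"] by simp

lemma mean_mono: "\<lbrakk>A \<subseteq> B; B \<subseteq> carrier G\<rbrakk> \<Longrightarrow> \<mu> A \<le> \<mu> B"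
  using mean_Un[of A "B - A"] mean_nonneg[of "B - A"]
  by (simp add: Un_absorb1 Diff_subset[THEN order_trans])

lemma mean_le_1: "A \<subseteq> carrier G \<Longrightarrow> \<mu> A \<le> 1"
  using mean_mono[of A "carrier G"] mean_carrier by simp

lemma mean_UN:
  assumes "finite I" "\<And>i. i \<in> I \<Longrightarrow> B i \<subseteq> carrier G" "disjoint_family_on B I"
  shows "\<mu> (\<Union>i\<in>I. B i) = (\<Sum>i\<in>I. \<mu> (B i))"
  using assms
proof (induction I)
  case (insert i I)
  then have "B i \<inter> (\<Union>i\<in>I. B i) = {}"
    by (auto simp: disjoint_family_on_def)
  moreover have "disjoint_family_on B I"
    using insert.prems(2) by (auto simp: disjoint_family_on_def)
  ultimately show ?case
    using insert mean_Un[of "B i" "\<Union>i\<in>I. B i"] by (simp add: UN_least)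
qed simp

text \<open>The sets in \<open>\<A>\<close> split the group into finitely many atoms; one point of
  each nonempty atom carries the mean of that atom as its weight. Such finite weights are the
  approximants from which the integral is obtained.\<close>

lemma finite_mean:
  assumes "finite \<A>" "\<A> \<subseteq> Pow (carrier G)"
  obtains S w where "finite S" "S \<subseteq> carrier G" "\<And>x. x \<in> S \<Longrightarrow> (0::real) \<le> w x" "sum w S = 1"
    "\<And>A. A \<in> \<A> \<Longrightarrow> sum w (S \<inter> A) = \<mu> A"
proof -
  \<comment> \<open>The fibres of \<open>\<sigma>\<close> are the atoms; \<open>T\<close> indexes
    the nonempty ones and \<open>r\<close> picks their representatives.\<close>
  define \<sigma> where "\<sigma> x = {A \<in> \<A>. x \<in> A}" for x
  define T where "T = \<sigma> ` carrier G"
  define r where "r = inv_into (carrier G) \<sigma>"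
  define w where "w x = \<mu> {y \<in> carrier G. \<sigma> y = \<sigma> x}" for x
  have "T \<subseteq> Pow \<A>" by (auto simp: T_def \<sigma>_def)
  then have fin: "finite T" using assms(1) finite_subset by blast
  have r: "r s \<in> carrier G" "\<sigma> (r s) = s" if "s \<in> T" for s
    using that by (auto simp: r_def T_def inv_into_into f_inv_into_f)
  then have inj: "inj_on r T" by (metis inj_onI)
  \<comment> \<open>\<open>carrier G\<close> is adjoined so that the same identity yields the total
    weight \<open>1\<close>.\<close>
  have sums: "sum w (r ` T \<inter> A) = \<mu> A" if "A \<in> insert (carrier G) \<A>" for A
  proof -
    have A: "A \<subseteq> carrier G" using that assms(2) by auto
    have iff: "x \<in> A \<longleftrightarrow> y \<in> A" if "\<sigma> x = \<sigma> y" "x \<in> carrier G" "y \<in> carrier G" for x y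
      using that \<open>A \<in> insert (carrier G) \<A>\<close> by (auto simp: \<sigma>_def)
    let ?T = "{s \<in> T. r s \<in> A}"
    have "A = (\<Union>s\<in>?T. {y \<in> carrier G. \<sigma> y = s})"
    proof safe
      fix x assume "x \<in> A"
      then have "\<sigma> x \<in> T" "x \<in> carrier G" using A by (auto simp: T_def)
      with \<open>x \<in> A\<close> show "x \<in> (\<Union>s\<in>?T. {y \<in> carrier G. \<sigma> y = s})"
        using iff[of x "r (\<sigma> x)"] r[of "\<sigma> x"] by auto
    next
      fix x assume "\<sigma> x \<in> T" "x \<in> carrier G" "r (\<sigma> x) \<in> A"
      then show "x \<in> A" using iff[of x "r (\<sigma> x)"] r[of "\<sigma> x"] by auto
    qed
    moreover have "\<mu> (\<Union>s\<in>?T. {y \<in> carrier G. \<sigma> y = s}) = (\<Sum>s\<in>?T. \<mu> {y \<in> carrier G. \<sigma> y = s})"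
      using fin by (intro mean_UN) (auto simp: disjoint_family_on_def)
    moreover have "\<dots> = (\<Sum>s\<in>?T. w (r s))"
      using r by (intro sum.cong) (auto simp: w_def)
    moreover have "\<dots> = sum w (r ` ?T)"
      using inj by (subst sum.reindex) (auto intro: inj_on_subset)
    moreover have "r ` ?T = r ` T \<inter> A" by auto
    ultimately show ?thesis by simp
  qed
  show thesis
  proof (rule that[of "r ` T" w])
    show "r ` T \<subseteq> carrier G" using r by auto
    with sums[of "carrier G"] show "sum w (r ` T) = 1"
      by (simp add: Int_absorb2 mean_carrier)
    show "0 \<le> w x" for x unfolding w_def by (rule mean_nonneg) auto
  qed (use fin sums in auto)
qed

text \<open>Finite weights integrate by summation. By \<open>finite_mean\<close> the sets
  \<open>W A\<close> have the finite intersection property, so a cluster point of these sums has the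
  right value on every indicator.\<close>

lemma mean_functional_exists: "\<exists>I. mean_functional G \<mu> I"
proof -
  let ?\<Omega> = "carrier G"
  define W where "W A = {(S, w). finite S \<and> S \<subseteq> ?\<Omega> \<and> (\<forall>x\<in>S. (0::real) \<le> w x) \<and> sum w S = 1 \<and> sum w (S \<inter> A) = \<mu> A}"
    for A
  define F where "F = (INF A\<in>Pow ?\<Omega>. principal (W A))"
  have "F \<noteq> bot"
    unfolding F_def
  proof (rule INF_filter_not_bot)
    fix \<A> assume \<A>: "\<A> \<subseteq> Pow ?\<Omega>" "finite \<A>"
    obtain S w where "finite S" "S \<subseteq> carrier G" "\<And>x. x \<in> S \<Longrightarrow> (0::real) \<le> w x" "sum w S = 1"
      "\<And>A. A \<in> \<A> \<Longrightarrow> sum w (S \<inter> A) = \<mu> A"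
      using finite_mean[OF \<A>(2,1)] by blast
    then have "(S, w) \<in> (\<Inter>A\<in>\<A>. W A)" by (auto simp: W_def)
    then show "(INF A\<in>\<A>. principal (W A)) \<noteq> bot"
      using \<A>(2) by (subst INF_principal_finite) (auto simp: principal_eq_bot_iff)
  qed
  have evW: "eventually (\<lambda>i. i \<in> W A) F" if "A \<subseteq> ?\<Omega>" for A
    using that unfolding F_def by (auto intro: eventually_INF1 simp: eventually_principal)
  define bdd where "bdd f \<longleftrightarrow> bounded (f ` ?\<Omega>)" for f :: "'a \<Rightarrow> real"
  \<comment> \<open>The default \<open>0\<close> gives a bound at every index and every function, as
    the compactness argument requires. Linearity and monotonicity then hold at every index; only the
    values on indicators hold merely eventually.\<close>
  define \<Phi> where "\<Phi> i f = (if i \<in> W ?\<Omega> \<and> bdd f then (\<Sum>x\<in>fst i. snd i x * f x) else 0)" for i f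
  have "\<exists>B. \<forall>f i. \<bar>\<Phi> i f\<bar> \<le> B f"
  proof (rule choice, intro allI)
    fix f :: "'a \<Rightarrow> real"
    show "\<exists>b. \<forall>i. \<bar>\<Phi> i f\<bar> \<le> b"
    proof (cases "bdd f")
      case True
      then obtain b where b: "\<And>x. x \<in> ?\<Omega> \<Longrightarrow> \<bar>f x\<bar> \<le> b"
        by (auto simp: bdd_def bounded_iff)
      have "\<bar>\<Phi> i f\<bar> \<le> max b 0" for i
      proof (cases "i \<in> W ?\<Omega>")
        case T: True
        then obtain S w where i: "i = (S, w)" and S: "finite S" "S \<subseteq> ?\<Omega>" "\<And>x. x\<in>S \<Longrightarrow> 0 \<le> w x" "sum w S = 1"
          by (auto simp: W_def)
        have "\<bar>\<Sum>x\<in>S. w x * f x\<bar> \<le> (\<Sum>x\<in>S. \<bar>w x * f x\<bar>)" by (rule sum_abs)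
        also have "\<dots> \<le> (\<Sum>x\<in>S. w x * b)"
          using S b by (intro sum_mono) (auto simp: abs_mult intro!: mult_left_mono)
        also have "\<dots> = b" using S by (simp flip: sum_distrib_right)
        finally show ?thesis using True T i by (simp add: \<Phi>_def)
      qed (simp add: \<Phi>_def)
      then show ?thesis by blast
    qed (auto simp: \<Phi>_def)
  qed
  then obtain B where B: "\<And>i f. \<bar>\<Phi> i f\<bar> \<le> B f" by blast
  obtain \<phi> L where L: "L \<noteq> bot" "L \<le> filtermap \<Phi> F"
    and lim: "\<And>f. ((\<lambda>\<psi>. \<psi> f) \<longlongrightarrow> \<phi> f) L"
    by (rule product_cluster_point[OF \<open>F \<noteq> bot\<close>, of \<Phi> B]) (use B in auto)
  note ev = eventually_cluster[OF L(2)]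
  have "mean_functional G \<mu> \<phi>"
    unfolding mean_functional_def bdd_def[symmetric]
  proof (intro conjI allI impI)
    fix f g :: "'a \<Rightarrow> real" assume *: "bdd f" "bdd g"
    then have "bdd (\<lambda>x. f x + g x)" unfolding bdd_def by (rule bounded_plus_comp)
    with * have "\<Phi> i (\<lambda>x. f x + g x) = \<Phi> i f + \<Phi> i g" for i
      by (simp add: \<Phi>_def distrib_left sum.distrib)
    then have "eventually (\<lambda>\<psi>. \<psi> (\<lambda>x. f x + g x) = \<psi> f + \<psi> g) L" by (intro ev) simp
    then have "((\<lambda>\<psi>. \<psi> f + \<psi> g) \<longlongrightarrow> \<phi> (\<lambda>x. f x + g x)) L"
      by (rule Lim_transform_eventually[OF lim])
    then show "\<phi> (\<lambda>x. f x + g x) = \<phi> f + \<phi> g"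
      using tendsto_unique[OF L(1) _ tendsto_add[OF lim lim]] by blast
  next
    fix f :: "'a \<Rightarrow> real" and c assume *: "bdd f"
    then have "bdd (\<lambda>x. c * f x)" using bounded_scaleR_comp[of f ?\<Omega> c] by (simp add: bdd_def)
    with * have "\<Phi> i (\<lambda>x. c * f x) = c * \<Phi> i f" for i
      by (simp add: \<Phi>_def sum_distrib_left ac_simps)
    then have "eventually (\<lambda>\<psi>. \<psi> (\<lambda>x. c * f x) = c * \<psi> f) L" by (intro ev) simp
    then have "((\<lambda>\<psi>. c * \<psi> f) \<longlongrightarrow> \<phi> (\<lambda>x. c * f x)) L"
      by (rule Lim_transform_eventually[OF lim])
    then show "\<phi> (\<lambda>x. c * f x) = c * \<phi> f"
      using tendsto_unique[OF L(1) _ tendsto_mult_left[OF lim]] by blast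
  next
    fix f g :: "'a \<Rightarrow> real" assume *: "bdd f" "bdd g" "\<forall>x\<in>?\<Omega>. f x \<le> g x"
    have "\<Phi> i f \<le> \<Phi> i g" for i
      using * by (auto simp: \<Phi>_def W_def intro!: sum_mono mult_left_mono)
    then have "eventually (\<lambda>\<psi>. \<psi> f \<le> \<psi> g) L" by (intro ev) simp
    then show "\<phi> f \<le> \<phi> g" by (rule tendsto_le[OF L(1) lim lim])
  next
    fix A assume A: "A \<subseteq> ?\<Omega>"
    have b: "bdd (indicat_real A)"
      unfolding bdd_def by (rule boundedI[of _ 1]) (auto simp: indicator_def)
    have "eventually (\<lambda>i. \<Phi> i (indicat_real A) = \<mu> A) F"
      using evW[OF A] evW[OF order_refl]
    proof eventually_elim
      case (elim i)
      then show ?case using b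
        by (auto simp: \<Phi>_def W_def indicator_def sum.inter_restrict if_distrib cong: if_cong)
    qed
    then have "eventually (\<lambda>\<psi>. \<psi> (indicat_real A) = \<mu> A) L" by (rule ev)
    then have "((\<lambda>\<psi>. \<mu> A) \<longlongrightarrow> \<phi> (indicat_real A)) L"
      by (rule Lim_transform_eventually[OF lim])
    then show "\<phi> (indicat_real A) = \<mu> A"
      using tendsto_unique[OF L(1) _ tendsto_const] by metis
  qed
  then show ?thesis by blast
qed

lemma mean_functionalD:
  assumes "mean_functional G \<mu> I" "bounded (f ` carrier G)"
  shows mean_functional_add: "bounded (g ` carrier G) \<Longrightarrow> I (\<lambda>x. f x + g x) = I f + I g"
    and mean_functional_scale: "I (\<lambda>x. c * f x) = c * I f"
    and mean_functional_mono:
      "\<lbrakk>bounded (g ` carrier G); \<And>x. x \<in> carrier G \<Longrightarrow> f x \<le> g x\<rbrakk> \<Longrightarrow> I f \<le> I g"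
  using assms unfolding mean_functional_def by simp_all

lemma mean_functional_cong:
  assumes "mean_functional G \<mu> I" "bounded (f ` carrier G)" "\<And>x. x \<in> carrier G \<Longrightarrow> f x = g x"
  shows "I f = I g"
proof -
  have "bounded (g ` carrier G)" using assms(2,3) by (metis image_cong)
  with assms show ?thesis
    by (intro antisym mean_functional_mono[OF assms(1)]) simp_all
qed

lemma bounded_simple:
  "finite V \<Longrightarrow> bounded ((\<lambda>x. \<Sum>v\<in>V. c v * indicat_real (A v) x) ` X)"
proof (rule boundedI[of _ "\<Sum>v\<in>V. \<bar>c v\<bar>"])
  assume "finite V"
  fix y assume "y \<in> (\<lambda>x. \<Sum>v\<in>V. c v * indicat_real (A v) x) ` X"
  then obtain x where y: "y = (\<Sum>v\<in>V. c v * indicat_real (A v) x)" by auto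
  have "norm y \<le> (\<Sum>v\<in>V. \<bar>c v * indicat_real (A v) x\<bar>)" unfolding y by (simp add: sum_abs)
  also have "\<dots> \<le> (\<Sum>v\<in>V. \<bar>c v\<bar>)" by (intro sum_mono) (auto simp: indicator_def)
  finally show "norm y \<le> (\<Sum>v\<in>V. \<bar>c v\<bar>)" .
qed

lemma mean_functional_simple:
  assumes I: "mean_functional G \<mu> I" and "finite V" "\<And>v. v \<in> V \<Longrightarrow> A v \<subseteq> carrier G"
  shows "I (\<lambda>x. \<Sum>v\<in>V. c v * indicat_real (A v) x) = (\<Sum>v\<in>V. c v * \<mu> (A v))"
  using assms(2,3)
proof (induction V)
  case empty
  have "bounded ((\<lambda>x::'a. 0::real) ` carrier G)" by (rule boundedI[of _ 0]) auto
  then have "I (\<lambda>x. 0 * 0) = 0 * I (\<lambda>x. 0)"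
    by (rule mean_functional_scale[OF I])
  then show ?case by simp
next
  case (insert v V)
  have b: "bounded (indicat_real (A v) ` carrier G)"
    by (rule boundedI[of _ 1]) (auto simp: indicator_def)
  then have "bounded ((\<lambda>x. c v * indicat_real (A v) x) ` carrier G)"
    using bounded_scaleR_comp[OF b, of "c v"] by simp
  then have "I (\<lambda>x. c v * indicat_real (A v) x + (\<Sum>v\<in>V. c v * indicat_real (A v) x)) =
    I (\<lambda>x. c v * indicat_real (A v) x) + I (\<lambda>x. \<Sum>v\<in>V. c v * indicat_real (A v) x)"
    by (rule mean_functional_add[OF I]) (rule bounded_simple[OF insert.hyps(1)])
  moreover have "I (\<lambda>x. c v * indicat_real (A v) x) = c v * \<mu> (A v)"
    using I mean_functional_scale[OF I b] insert.prems unfolding mean_functional_def by simp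
  moreover have "I (\<lambda>x. \<Sum>v\<in>V. c v * indicat_real (A v) x) = (\<Sum>v\<in>V. c v * \<mu> (A v))"
    by (rule insert.IH) (use insert.prems in auto)
  ultimately show ?case by (simp only: sum.insert[OF insert.hyps])
qed

text \<open>Bounded functions are uniform limits of simple functions, on which any two functionals
  agree by \<open>mean_functional_simple\<close>. Exchanging \<open>I\<close> and \<open>J\<close>
  gives the uniqueness behind \<open>mean_integral\<close>.\<close>

lemma mean_functional_le:
  assumes I: "mean_functional G \<mu> I" and J: "mean_functional G \<mu> J" and f: "bounded (f ` carrier G)"
  shows "I f \<le> J f"
proof (rule field_le_epsilon)
  fix e :: real assume "0 < e"
  then obtain n where n: "1 / real n < e" "n > 0"
    by (metis nat_approx_posE zero_less_Suc)
  obtain b where b: "\<And>x. x \<in> carrier G \<Longrightarrow> \<bar>f x\<bar> \<le> b"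
    using f by (auto simp: bounded_iff)
  \<comment> \<open>Boundedness of \<open>f\<close> leaves finitely many values of \<open>k\<close>,
    so \<open>s = k / n\<close> is simple; it lies below \<open>f\<close> by at most
    \<open>1 / n\<close>.\<close>
  define k where "k x = \<lfloor>real n * f x\<rfloor>" for x
  define V where "V = k ` carrier G"
  have "k x \<in> {\<lfloor>- (real n * b)\<rfloor>..\<lfloor>real n * b\<rfloor>}" if "x \<in> carrier G" for x
  proof -
    have "- b \<le> f x" "f x \<le> b" using b[OF that] by auto
    then have "real n * - b \<le> real n * f x" "real n * f x \<le> real n * b"
      by (intro mult_left_mono; simp)+
    then show ?thesis unfolding k_def by (auto intro: floor_mono)
  qed
  then have "V \<subseteq> {\<lfloor>- (real n * b)\<rfloor>..\<lfloor>real n * b\<rfloor>}" unfolding V_def by blast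
  then have V: "finite V" by (rule finite_subset) simp
  define A where "A v = {x \<in> carrier G. k x = v}" for v
  have A: "A v \<subseteq> carrier G" for v by (auto simp: A_def)
  define s where "s x = (\<Sum>v\<in>V. (of_int v / real n) * indicat_real (A v) x)" for x
  have s: "s x = of_int (k x) / real n" if "x \<in> carrier G" for x
  proof -
    have "s x = (\<Sum>v\<in>V. if v = k x then of_int v / real n else 0)"
      unfolding s_def using that by (intro sum.cong) (auto simp: A_def)
    then show ?thesis using V that by (simp add: V_def)
  qed
  have sb: "bounded (s ` carrier G)"
    unfolding s_def by (rule bounded_simple[OF V])
  have IJ: "I s = J s"
    using mean_functional_simple[OF I V A] mean_functional_simple[OF J V A]
    unfolding s_def by (simp only:)
  \<comment> \<open>The constant \<open>1 / n\<close> is written through an indicator because that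
    is where the value of \<open>I\<close> is prescribed.\<close>
  define u where "u x = (1 / real n) * indicat_real (carrier G) x" for x
  have ub: "bounded (u ` carrier G)"
    by (rule boundedI[of _ "1 / real n"]) (auto simp: u_def indicator_def)
  have "I u = 1 / real n"
    using mean_functional_simple[OF I, of "{()}" "\<lambda>_. carrier G" "\<lambda>_. 1 / real n"]
    unfolding u_def by (simp add: mean_carrier)
  moreover have "I f \<le> I (\<lambda>x. s x + u x)"
  proof -
    have "f x \<le> s x + u x" if "x \<in> carrier G" for x
    proof -
      have "real n * f x \<le> of_int (k x) + 1" unfolding k_def by linarith
      then show ?thesis using n that by (simp add: s u_def field_simps)
    qed
    moreover have "bounded ((\<lambda>x. s x + u x) ` carrier G)" using sb ub by (rule bounded_plus_comp)
    ultimately show ?thesis by (intro mean_functional_mono[OF I f])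
  qed
  moreover have "I (\<lambda>x. s x + u x) = I s + I u"
    by (rule mean_functional_add[OF I sb ub])
  moreover have "J s \<le> J f"
  proof -
    have "s x \<le> f x" if "x \<in> carrier G" for x
      using n that by (simp add: s k_def divide_le_eq mult.commute)
    then show ?thesis by (intro mean_functional_mono[OF J sb f])
  qed
  ultimately show "I f \<le> J f + e" using IJ n by linarith
qed

lemma mean_integral_eq:
  assumes "mean_functional G \<mu> I" "bounded (f ` carrier G)"
  shows "mean_integral G \<mu> f = I f"
  unfolding mean_integral_def
proof (rule the_equality)
  show "\<exists>J. mean_functional G \<mu> J \<and> I f = J f" using assms by blast
  fix c assume "\<exists>J. mean_functional G \<mu> J \<and> c = J f"
  then obtain J where "mean_functional G \<mu> J" "c = J f" by blast
  then show "c = I f" using assms by (intro antisym) (auto intro: mean_functional_le)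
qed

end

section \<open>Finite index normal subgroups and coset correct means\<close>

text \<open>\<open>g\<close> factors through \<open>f\<close> on \<open>A\<close>. This compares
  numbers of cosets and sizes of conjugacy classes without writing down the map between
  them.\<close>

lemma image_factor_subset:
  assumes "\<And>x y. \<lbrakk>x \<in> A; y \<in> A; f x = f y\<rbrakk> \<Longrightarrow> g x = g y"
  shows "g ` A \<subseteq> (\<lambda>z. g (inv_into A f z)) ` f ` A"
proof
  fix z assume "z \<in> g ` A"
  then obtain x where x: "x \<in> A" "z = g x" by blast
  then have "z = g (inv_into A f (f x))"
    using assms[of x "inv_into A f (f x)"] by (simp add: inv_into_into f_inv_into_f)
  with x(1) show "z \<in> (\<lambda>z. g (inv_into A f z)) ` f ` A" by blast
qed

lemma finite_image_factor:
  assumes "finite (f ` A)" "\<And>x y. \<lbrakk>x \<in> A; y \<in> A; f x = f y\<rbrakk> \<Longrightarrow> g x = g y"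
  shows "finite (g ` A)"
  by (rule finite_surj[OF assms(1) image_factor_subset]) (rule assms(2))

lemma card_image_factor:
  assumes "finite (f ` A)" "\<And>x y. \<lbrakk>x \<in> A; y \<in> A; f x = f y\<rbrakk> \<Longrightarrow> g x = g y"
  shows "card (g ` A) \<le> card (f ` A)"
  by (rule surj_card_le[OF assms(1) image_factor_subset]) (rule assms(2))

context group begin

lemma rcosets_eq_image: "rcosets H = (\<lambda>g. H #> g) ` carrier G"
  by (auto simp: RCOSETS_def)

lemma rcos_eq_iff:
  assumes "subgroup N G" "g \<in> carrier G" "h \<in> carrier G"
  shows "N #> g = N #> h \<longleftrightarrow> g \<otimes> inv h \<in> N"
  using assms by (metis rcos_self repr_independence subgroup.rcos_module is_group)

lemma rcos_eq_iff_normal: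
  assumes "N \<lhd> G" "g \<in> carrier G" "h \<in> carrier G"
  shows "N #> g = N #> h \<longleftrightarrow> inv g \<otimes> h \<in> N"
proof -
  have N: "subgroup N G" using assms(1) by (rule normal_imp_subgroup)
  have "N #> g = N #> h \<longleftrightarrow> h \<otimes> inv g \<in> N"
    using rcos_eq_iff[OF N assms(3,2)] by auto
  also have "\<dots> \<longleftrightarrow> inv g \<otimes> h \<in> N"
  proof
    assume "h \<otimes> inv g \<in> N"
    from normal.inv_op_closed1[OF assms(1,2) this] show "inv g \<otimes> h \<in> N"
      using assms(2,3) by (simp add: m_assoc)
  next
    assume "inv g \<otimes> h \<in> N"
    from normal.inv_op_closed2[OF assms(1,2) this] show "h \<otimes> inv g \<in> N"
      using assms(2,3) by (simp add: m_assoc[symmetric])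
  qed
  finally show ?thesis .
qed

lemma rcos_eq_mono:
  assumes "subgroup N G" "subgroup M G" "N \<subseteq> M" "g \<in> carrier G" "h \<in> carrier G" "N #> g = N #> h"
  shows "M #> g = M #> h"
  using assms rcos_eq_iff by blast

lemma rcos_Int:
  assumes "subgroup N G" "subgroup M G" "g \<in> carrier G"
  shows "(N \<inter> M) #> g = (N #> g) \<inter> (M #> g)"
proof -
  have "n = m" if "n \<in> N" "m \<in> M" "n \<otimes> g = m \<otimes> g" for n m
    using that assms subgroup.mem_carrier right_cancel by metis
  then show ?thesis by (force simp: r_coset_def)
qed

lemma finite_rcosets_Int:
  assumes "subgroup N G" "subgroup M G" "finite (rcosets N)" "finite (rcosets M)"
  shows "finite (rcosets (N \<inter> M))"
proof (rule finite_subset)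
  show "rcosets (N \<inter> M) \<subseteq> (\<lambda>(A, B). A \<inter> B) ` ((rcosets N) \<times> (rcosets M))"
    using rcos_Int[OF assms(1,2)] by (fastforce simp: RCOSETS_def)
qed (use assms in auto)

lemma finite_rcosets_mono:
  assumes "subgroup N G" "subgroup M G" "N \<subseteq> M" "finite (rcosets N)"
  shows "finite (rcosets M)"
  using assms(4) rcos_eq_mono[OF assms(1-3)] unfolding rcosets_eq_image by (rule finite_image_factor)

lemma finite_index_normalsD:
  assumes "N \<in> finite_index_normals G"
  shows "N \<lhd> G" "subgroup N G" "finite (rcosets N)" "N \<subseteq> carrier G" "\<one> \<in> N" "card (rcosets N) > 0"
proof -
  show "N \<lhd> G" "finite (rcosets N)" using assms by (auto simp: finite_index_normals_def)
  then show N: "subgroup N G" by (auto intro: normal_imp_subgroup)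
  then show "N \<subseteq> carrier G" "\<one> \<in> N" by (auto simp: subgroup.subset subgroup.one_closed)
  show "card (rcosets N) > 0"
    using \<open>finite (rcosets N)\<close> subgroup.subgroup_in_rcosets[OF N is_group] card_gt_0_iff by blast
qed

lemma carrier_finite_index_normal: "carrier G \<in> finite_index_normals G"
proof -
  have "carrier G \<lhd> G"
    by (rule normalI[OF subgroup_self]) (simp add: coset_join2 coset_join3 subgroup_self)
  moreover have "rcosets (carrier G) \<subseteq> {carrier G}"
    using coset_join2[OF _ subgroup_self] by (auto simp: RCOSETS_def)
  then have "finite (rcosets (carrier G))" by (rule finite_subset) simp
  ultimately show ?thesis by (simp add: finite_index_normals_def)
qed

lemma finite_index_normals_Int:
  assumes "N \<in> finite_index_normals G" "M \<in> finite_index_normals G"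
  shows "N \<inter> M \<in> finite_index_normals G"
  using finite_index_normalsD(1-3)[OF assms(1)] finite_index_normalsD(1-3)[OF assms(2)]
  by (simp add: finite_index_normals_def normal_subgroup_intersect finite_rcosets_Int)

text \<open>Directedness: finitely many requirements on a quotient can be met by a single one.
  \<open>carrier G\<close> serves the empty family.\<close>

lemma finite_index_normals_INT:
  assumes "finite I" "\<And>i. i \<in> I \<Longrightarrow> N i \<in> finite_index_normals G"
  shows "\<exists>M \<in> finite_index_normals G. \<forall>i\<in>I. M \<subseteq> N i"
  using assms
proof (induction I)
  case empty then show ?case using carrier_finite_index_normal by auto
next
  case (insert i I)
  then obtain M where M: "M \<in> finite_index_normals G" "\<forall>i\<in>I. M \<subseteq> N i" by auto
  then show ?case using insert.prems
    by (intro bexI[of _ "N i \<inter> M"]) (auto intro: finite_index_normals_Int)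
qed

lemma residually_finite_separate:
  assumes "residually_finite G" "finite E" "E \<subseteq> carrier G"
  obtains N where "N \<in> finite_index_normals G" "N \<inter> E \<subseteq> {\<one>}"
proof -
  have "\<forall>x\<in>E - {\<one>}. \<exists>N\<in>finite_index_normals G. x \<notin> N"
    using assms(1,3) by (auto simp: residually_finite_def)
  then obtain N where N: "\<And>x. x \<in> E - {\<one>} \<Longrightarrow> N x \<in> finite_index_normals G \<and> x \<notin> N x"
    by metis
  then obtain M where "M \<in> finite_index_normals G" "\<forall>x\<in>E - {\<one>}. M \<subseteq> N x"
    using finite_index_normals_INT[of "E - {\<one>}" N] assms(2) by auto
  then show thesis using N by (intro that[of M]) blast+
qed

text \<open>Two elements share a coset of \<open>N\<close> only if their quotient lies in
  \<open>N\<close>, so it suffices to keep the finitely many quotients other than one out of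
  \<open>N\<close>.\<close>

lemma residually_finite_inj_on:
  assumes "residually_finite G" "finite E" "E \<subseteq> carrier G"
  obtains N where "N \<in> finite_index_normals G" "inj_on (\<lambda>x. N #> x) E"
proof -
  obtain N where N: "N \<in> finite_index_normals G" "N \<inter> (\<lambda>(x, y). x \<otimes> inv y) ` (E \<times> E) \<subseteq> {\<one>}"
    by (rule residually_finite_separate[OF assms(1), of "(\<lambda>(x, y). x \<otimes> inv y) ` (E \<times> E)"])
      (use assms in auto)
  have "x = y" if "x \<in> E" "y \<in> E" "N #> x = N #> y" for x y
  proof -
    have "x \<otimes> inv y \<in> N"
      using that assms(3) rcos_eq_iff finite_index_normalsD(2)[OF N(1)] by blast
    then have "x \<otimes> inv y = \<one>" using N(2) that by force
    then show ?thesis using that assms(3)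
      by (metis inv_closed inv_equality inv_inv subsetD)
  qed
  then show thesis using N(1) by (intro that) (auto simp: inj_on_def)
qed

lemma carrier_FactGroup_rcosets: "carrier (G Mod N) = rcosets N"
  by (auto simp: FactGroup_def)

lemma Comm_FactGroup_iff:
  assumes "N \<lhd> G" "g \<in> carrier G" "h \<in> carrier G"
  shows "(N #> g, N #> h) \<in> Comm (G Mod N) \<longleftrightarrow> N #> (g \<otimes> h) = N #> (h \<otimes> g)"
  using assms by (auto simp: Comm_def FactGroup_def normal.rcos_sum rcosetsI normal_imp_subgroup subgroup.subset)

lemma Comm_FactGroup_subset: "Comm (G Mod N) \<subseteq> (rcosets N) \<times> (rcosets N)"
  by (auto simp: Comm_def carrier_FactGroup_rcosets)

definition rcos_preimage :: "'a set \<Rightarrow> ('a set \<times> 'a set) set \<Rightarrow> ('a \<times> 'a) set" where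
  "rcos_preimage N T = {(g, h) \<in> carrier G \<times> carrier G. (N #> g, N #> h) \<in> T}"

lemma Comm_subset_rcos_preimage:
  "N \<lhd> G \<Longrightarrow> Comm G \<subseteq> rcos_preimage N (Comm (G Mod N))"
proof safe
  fix g h assume "N \<lhd> G" "(g, h) \<in> Comm G"
  then have "g \<in> carrier G" "h \<in> carrier G" "g \<otimes> h = h \<otimes> g" by (auto simp: Comm_def)
  with \<open>N \<lhd> G\<close> show "(g, h) \<in> rcos_preimage N (Comm (G Mod N))"
    by (simp add: rcos_preimage_def Comm_FactGroup_iff)
qed

lemma dc_FactGroup: "dc (G Mod N) = real (card (Comm (G Mod N))) / (real (card (rcosets N)))\<^sup>2"
  by (simp add: dc_def order_def carrier_FactGroup_rcosets)

end

section \<open>Coset correct means and counting in finite quotients\<close>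

locale coset_correct = group G + additive_mean G \<mu> for G (structure) and \<mu> +
  assumes mean_coset: "\<lbrakk>subgroup H G; g \<in> carrier G\<rbrakk> \<Longrightarrow>
    \<mu> (g <# H) = (if finite (rcosets H) then 1 / real (card (rcosets H)) else 0)"
begin

lemma mean_rcos:
  assumes "N \<in> finite_index_normals G" "C \<in> rcosets N"
  shows "\<mu> C = 1 / real (card (rcosets N))"
proof -
  obtain g where g: "g \<in> carrier G" "C = N #> g" using assms(2) by (auto simp: RCOSETS_def)
  then have "C = g <# N"
    using finite_index_normalsD(1)[OF assms(1)] by (simp add: normal.coset_eq)
  then show ?thesis
    using mean_coset[OF finite_index_normalsD(2)[OF assms(1)] g(1)] finite_index_normalsD(3)[OF assms(1)]
    by simp
qed

lemma mean_rcos_preimage: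
  assumes N: "N \<in> finite_index_normals G" and T: "T \<subseteq> rcosets N"
  shows "\<mu> {g \<in> carrier G. N #> g \<in> T} = real (card T) / real (card (rcosets N))"
proof -
  note N' = finite_index_normalsD[OF N]
  have "{g \<in> carrier G. N #> g \<in> T} = (\<Union>C\<in>T. C)"
  proof safe
    fix g assume "g \<in> carrier G" "N #> g \<in> T"
    then show "g \<in> (\<Union>C\<in>T. C)" using rcos_self[OF _ N'(2)] by blast
  next
    fix g C assume gC: "g \<in> C" "C \<in> T"
    then have C: "C \<in> rcosets N" using T by blast
    then show "g \<in> carrier G" using gC subgroup.rcosets_carrier[OF N'(2) is_group] by blast
    obtain c where c: "c \<in> carrier G" "C = N #> c" using C by (auto simp: RCOSETS_def)
    show "N #> g \<in> T" using repr_independence[of g N c] gC c N'(2) by simp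
  qed
  moreover have "\<mu> (\<Union>C\<in>T. C) = (\<Sum>C\<in>T. \<mu> C)"
  proof (rule mean_UN)
    show "finite T" using T N'(3) finite_subset by blast
    show "C \<subseteq> carrier G" if "C \<in> T" for C
      using that T subgroup.rcosets_carrier[OF N'(2) is_group] by blast
    show "disjoint_family_on (\<lambda>C. C) T"
      using T rcos_disjoint[OF N'(2)] by (auto simp: disjoint_family_on_def pairwise_def disjnt_def)
  qed
  moreover have "(\<Sum>C\<in>T. \<mu> C) = (\<Sum>C\<in>T. 1 / real (card (rcosets N)))"
    using T mean_rcos[OF N] by (intro sum.cong) auto
  ultimately show ?thesis by simp
qed

lemma bounded_mean: "bounded ((\<lambda>g. \<mu> {h \<in> carrier G. (g, h) \<in> S}) ` carrier G)"
  using mean_nonneg[of "{h \<in> carrier G. (_, h) \<in> S}"] mean_le_1[of "{h \<in> carrier G. (_, h) \<in> S}"]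
  by (intro boundedI[of _ 1]) auto

lemma product_mean_mono:
  assumes "S \<inter> carrier G \<times> carrier G \<subseteq> S'"
  shows "product_mean G \<mu> S \<le> product_mean G \<mu> S'"
proof -
  obtain I where I: "mean_functional G \<mu> I" using mean_functional_exists by blast
  show ?thesis
    unfolding product_mean_def mean_integral_eq[OF I bounded_mean]
    using assms by (intro mean_functional_mono[OF I] bounded_mean mean_mono) auto
qed

lemma product_mean_Un:
  assumes "S \<inter> S' = {}"
  shows "product_mean G \<mu> (S \<union> S') = product_mean G \<mu> S + product_mean G \<mu> S'"
proof -
  obtain I where I: "mean_functional G \<mu> I" using mean_functional_exists by blast
  have "\<mu> {h \<in> carrier G. (g, h) \<in> S \<union> S'} = \<mu> {h \<in> carrier G. (g, h) \<in> S} + \<mu> {h \<in> carrier G. (g, h) \<in> S'}" for g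
  proof -
    have "{h \<in> carrier G. (g, h) \<in> S \<union> S'} = {h \<in> carrier G. (g, h) \<in> S} \<union> {h \<in> carrier G. (g, h) \<in> S'}"
      by auto
    then show ?thesis using assms by (simp only:) (intro mean_Un; auto)
  qed
  then show ?thesis
    unfolding product_mean_def mean_integral_eq[OF I bounded_mean]
    by (simp only: mean_functional_add[OF I bounded_mean bounded_mean])
qed

text \<open>The section over \<open>g\<close> depends only on the coset of \<open>g\<close>, so the
  integrand is a simple function and the double integral becomes a count. The value is the same for
  every coset correct mean, which links means, finite quotients and the Haar measure.\<close>

lemma product_mean_rcos_preimage:
  assumes N: "N \<in> finite_index_normals G" and T: "T \<subseteq> (rcosets N) \<times> (rcosets N)"
  shows "product_mean G \<mu> (rcos_preimage N T) = real (card T) / (real (card (rcosets N)))\<^sup>2"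
proof -
  note N' = finite_index_normalsD[OF N]
  let ?n = "real (card (rcosets N))"
  obtain I where I: "mean_functional G \<mu> I" using mean_functional_exists by blast
  define A where "A C = {g \<in> carrier G. N #> g = C}" for C
  define c where "c C = real (card {D. (C, D) \<in> T}) / ?n" for C
  have sec: "\<mu> {h \<in> carrier G. (g, h) \<in> rcos_preimage N T} = (\<Sum>C\<in>rcosets N. c C * indicat_real (A C) g)"
    if g: "g \<in> carrier G" for g
  proof -
    have "{h \<in> carrier G. (g, h) \<in> rcos_preimage N T} = {h \<in> carrier G. N #> h \<in> {D. (N #> g, D) \<in> T}}"
      using g by (auto simp: rcos_preimage_def)
    also have "\<mu> \<dots> = c (N #> g)"
      unfolding c_def using T by (intro mean_rcos_preimage[OF N]) auto
    also have "\<dots> = (\<Sum>C\<in>rcosets N. if C = N #> g then c C else 0)"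
      using g N' rcosetsI by (simp add: N'(3))
    also have "\<dots> = (\<Sum>C\<in>rcosets N. c C * indicat_real (A C) g)"
      using g by (intro sum.cong) (auto simp: A_def)
    finally show ?thesis .
  qed
  have A: "\<mu> (A C) = 1 / ?n" if "C \<in> rcosets N" for C
    using mean_rcos_preimage[OF N, of "{C}"] that by (simp add: A_def)
  have "product_mean G \<mu> (rcos_preimage N T) = I (\<lambda>g. \<Sum>C\<in>rcosets N. c C * indicat_real (A C) g)"
    unfolding product_mean_def mean_integral_eq[OF I bounded_mean]
    by (rule mean_functional_cong[OF I bounded_mean sec])
  also have "\<dots> = (\<Sum>C\<in>rcosets N. c C * \<mu> (A C))"
    by (rule mean_functional_simple[OF I N'(3)]) (auto simp: A_def)
  also have "\<dots> = (\<Sum>C\<in>rcosets N. real (card {D. (C, D) \<in> T})) / ?n\<^sup>2"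
    using A by (simp add: c_def power2_eq_square sum_divide_distrib)
  also have "(\<Sum>C\<in>rcosets N. real (card {D. (C, D) \<in> T})) = real (card T)"
  proof -
    have "T = Sigma (rcosets N) (\<lambda>C. {D. (C, D) \<in> T})" using T by auto
    then have "card T = card (Sigma (rcosets N) (\<lambda>C. {D. (C, D) \<in> T}))" by simp
    also have "\<dots> = (\<Sum>C\<in>rcosets N. card {D. (C, D) \<in> T})"
      using N'(3) T by (intro card_SigmaI) (auto intro: finite_subset[of _ "rcosets N"])
    finally show ?thesis by simp
  qed
  finally show ?thesis .
qed

text \<open>Commuting pairs still commute modulo \<open>N\<close>, and the preimage of
  \<open>Comm (G Mod N)\<close> has product mean \<open>dc (G Mod N)\<close>.\<close>

lemma dc_mean_le_dc_FactGroup: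
  assumes "N \<in> finite_index_normals G"
  shows "dc_mean G \<mu> \<le> dc (G Mod N)"
  using product_mean_mono[of "Comm G"] Comm_subset_rcos_preimage finite_index_normalsD(1)[OF assms]
    product_mean_rcos_preimage[OF assms Comm_FactGroup_subset]
  unfolding dc_mean_def dc_FactGroup by (metis inf.coboundedI1)

lemma dc_mean_nonneg: "0 \<le> dc_mean G \<mu>"
  \<comment> \<open>Additivity for two empty sets gives the empty set the product mean
    \<open>0\<close>.\<close>
  using product_mean_Un[of "{}" "{}"] product_mean_mono[of "{}" "Comm G"] unfolding dc_mean_def by simp

end

lemma coset_correct_iff:
  assumes "group G"
  shows "coset_correct_mean G \<mu> \<longleftrightarrow> coset_correct G \<mu>"
proof
  assume "coset_correct G \<mu>"
  then interpret coset_correct G \<mu> .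
  show "coset_correct_mean G \<mu>"
    unfolding coset_correct_mean_def using mean_nonneg mean_le_1 mean_carrier mean_Un mean_coset by blast
next
  assume "coset_correct_mean G \<mu>"
  then show "coset_correct G \<mu>"
    using assms unfolding coset_correct_mean_def coset_correct_def additive_mean_def coset_correct_axioms_def
    by blast
qed

section \<open>Existence of coset correct means\<close>

context group begin

lemma mult_inv_cancel:
  assumes "x \<in> carrier G" "y \<in> carrier G"
  shows "x \<otimes> (inv x \<otimes> y) = y" "inv x \<otimes> (x \<otimes> y) = y"
  using assms by (simp_all flip: m_assoc)

lemma lcos_iff:
  assumes "subgroup H G" "g \<in> carrier G" "x \<in> carrier G"
  shows "x \<in> g <# H \<longleftrightarrow> inv g \<otimes> x \<in> H"
proof
  assume "x \<in> g <# H"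
  then obtain h where "h \<in> H" "x = g \<otimes> h" by (auto simp: l_coset_def)
  then show "inv g \<otimes> x \<in> H" using assms subgroup.mem_carrier by (fastforce simp: m_assoc[symmetric])
next
  assume "inv g \<otimes> x \<in> H"
  moreover have "x = g \<otimes> (inv g \<otimes> x)" using assms by (simp add: m_assoc[symmetric])
  ultimately show "x \<in> g <# H" unfolding l_coset_def by blast
qed

text \<open>\<open>N\<close> is the normal core, the kernel of right multiplication on the cosets of
  \<open>H\<close>. Its index is finite because only finitely many maps on \<open>rcosets H\<close>
  occur.\<close>

lemma exists_finite_index_normal_subset:
  assumes H: "subgroup H G" "finite (rcosets H)"
  shows "\<exists>N \<in> finite_index_normals G. N \<subseteq> H"
proof -
  define N where "N = {x \<in> carrier G. \<forall>g \<in> carrier G. g \<otimes> x \<otimes> inv g \<in> H}"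
  have sub: "subgroup N G"
  proof (rule subgroupI)
    show "N \<noteq> {}" using subgroup.one_closed[OF H(1)] by (auto simp: N_def intro!: exI[of _ \<one>])
    fix a assume a: "a \<in> N"
    have "g \<otimes> inv a \<otimes> inv g = inv (g \<otimes> a \<otimes> inv g)" if "g \<in> carrier G" for g
      using that a by (simp add: N_def inv_mult_group m_assoc)
    then show "inv a \<in> N" using a subgroup.m_inv_closed[OF H(1)] by (auto simp: N_def)
    fix b assume b: "b \<in> N"
    have "g \<otimes> (a \<otimes> b) \<otimes> inv g = (g \<otimes> a \<otimes> inv g) \<otimes> (g \<otimes> b \<otimes> inv g)" if "g \<in> carrier G" for g
      using that a b by (simp add: N_def m_assoc mult_inv_cancel)
    then show "a \<otimes> b \<in> N" using a b subgroup.m_closed[OF H(1)] by (auto simp: N_def)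
  qed (auto simp: N_def)
  have "N \<lhd> G"
    unfolding normal_inv_iff
  proof (intro conjI ballI sub)
    fix x n assume x: "x \<in> carrier G" and n: "n \<in> N"
    have "g \<otimes> (x \<otimes> n \<otimes> inv x) \<otimes> inv g = (g \<otimes> x) \<otimes> n \<otimes> inv (g \<otimes> x)" if "g \<in> carrier G" for g
      using that x n by (simp add: N_def m_assoc inv_mult_group)
    then show "x \<otimes> n \<otimes> inv x \<in> N" using x n by (auto simp: N_def)
  qed
  moreover have "finite (rcosets N)"
    unfolding rcosets_eq_image[of N]
  proof (rule finite_image_factor)
    have "(\<lambda>x. \<lambda>C\<in>rcosets H. C #> x) ` carrier G \<subseteq> (\<Pi>\<^sub>E C\<in>rcosets H. rcosets H)"
      using coset_mult_assoc[OF subgroup.subset[OF H(1)]] by (fastforce simp: RCOSETS_def)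
    then show "finite ((\<lambda>x. \<lambda>C\<in>rcosets H. C #> x) ` carrier G)"
      by (rule finite_subset) (use H(2) in \<open>auto intro: finite_PiE\<close>)
    fix x y assume xy: "x \<in> carrier G" "y \<in> carrier G"
      and eq: "(\<lambda>C\<in>rcosets H. C #> x) = (\<lambda>C\<in>rcosets H. C #> y)"
    have "g \<otimes> (x \<otimes> inv y) \<otimes> inv g \<in> H" if g: "g \<in> carrier G" for g
    proof -
      have "H #> g \<in> rcosets H" using g by (auto simp: RCOSETS_def)
      then have "H #> g #> x = H #> g #> y" using fun_cong[OF eq, of "H #> g"] by simp
      then have "H #> (g \<otimes> x) = H #> (g \<otimes> y)"
        using coset_mult_assoc[OF subgroup.subset[OF H(1)]] g xy by simp
      then show ?thesis using rcos_eq_iff[OF H(1)] g xy by (simp add: inv_mult_group m_assoc)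
    qed
    then show "N #> x = N #> y" using xy by (simp add: rcos_eq_iff[OF sub]) (simp add: N_def)
  qed
  moreover have "N \<subseteq> H" by (auto simp: N_def dest: bspec[OF _ one_closed])
  ultimately show ?thesis by (auto simp: finite_index_normals_def)
qed

text \<open>If not all cosets of \<open>H\<close> occur in the covering, then a missing one is covered by cosets of the
  other subgroups, and so are its translates, which eliminates \<open>H\<close>.\<close>
lemma neumann_covering:
  assumes "finite \<H>" "\<And>H. H \<in> \<H> \<Longrightarrow> subgroup H G"
    and "finite F" "F \<subseteq> carrier G \<times> \<H>" "carrier G \<subseteq> (\<Union>(g, H)\<in>F. g <# H)"
  shows "\<exists>H\<in>\<H>. finite (rcosets H)"
  using assms
proof (induction \<H> arbitrary: F)
  case empty
  then show ?case using one_closed by auto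
next
  case (insert H \<H>)
  note H = insert.prems(1)[of H, simplified]
  define A where "A = {g. (g, H) \<in> F}"
  define F' where "F' = {(g, K) \<in> F. K \<in> \<H>}"
  have "A \<subseteq> fst ` F" by (force simp: A_def)
  then have "finite A" by (rule finite_subset) (simp add: insert.prems(2))
  moreover have "A \<subseteq> carrier G" using insert.prems(3) by (auto simp: A_def)
  ultimately have A: "finite A" "A \<subseteq> carrier G" .
  show ?case
  proof (cases "carrier G \<subseteq> (\<Union>g\<in>A. g <# H)")
    case True
    \<comment> \<open>Inversion turns left cosets into right cosets, so a covering by left cosets
      bounds the number of right cosets.\<close>
    have "rcosets H \<subseteq> (\<lambda>g. H #> inv g) ` A"
    proof
      fix C assume "C \<in> rcosets H"
      then obtain x where x: "x \<in> carrier G" "C = H #> x" by (auto simp: RCOSETS_def)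
      then obtain g where g: "g \<in> A" "inv x \<in> g <# H" using True by blast
      then have "inv g \<otimes> inv x \<in> H" using lcos_iff[OF H] A x by blast
      then have "H #> x = H #> inv g"
        using rcos_eq_iff[OF H, of "inv g" x] A x g by auto
      then show "C \<in> (\<lambda>g. H #> inv g) ` A" using x g by blast
    qed
    then show ?thesis using A(1) finite_surj by blast
  next
    case False
    then obtain x where x: "x \<in> carrier G" "\<And>g. g \<in> A \<Longrightarrow> x \<notin> g <# H" by blast
    \<comment> \<open>No coset of \<open>H\<close> in \<open>F\<close> contains \<open>x\<close>,
      hence none meets \<open>x <# H\<close>; the other members of \<open>F\<close> cover
      it.\<close>
    have cov: "\<exists>(k, K) \<in> F'. x \<otimes> h \<in> k <# K" if h: "h \<in> H" for h
    proof -
      have hG: "h \<in> carrier G" using H h by (rule subgroup.mem_carrier)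
      then have "x \<otimes> h \<in> (\<Union>(g, H)\<in>F. g <# H)"
        by (intro subsetD[OF insert.prems(4)] m_closed x(1))
      then obtain k K where kK: "(k, K) \<in> F" "x \<otimes> h \<in> k <# K" by blast
      have "K \<noteq> H"
      proof
        assume "K = H"
        then have k: "k \<in> A" "k \<in> carrier G" using kK A by (auto simp: A_def)
        have "inv k \<otimes> (x \<otimes> h) \<in> H" using kK \<open>K = H\<close> lcos_iff[OF H k(2)] x hG by auto
        then have "inv k \<otimes> (x \<otimes> h) \<otimes> inv h \<in> H" using h H subgroup.m_closed subgroup.m_inv_closed by metis
        then have "inv k \<otimes> x \<in> H" using k x hG by (simp add: m_assoc)
        then show False using x k lcos_iff[OF H] by blast
      qed
      then show ?thesis using kK insert.prems(3) by (auto simp: F'_def)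
    qed
    \<comment> \<open>The coset of \<open>g\<close> is \<open>x <# H\<close> translated by
      \<open>g \<otimes> inv x\<close>, so the translated covering of \<open>x <# H\<close> replaces
      it.\<close>
    define F'' where "F'' = F' \<union> (\<lambda>(g, k, K). (g \<otimes> inv x \<otimes> k, K)) ` (A \<times> F')"
    have F': "finite F'" "F' \<subseteq> carrier G \<times> \<H>"
      using insert.prems(2,3) by (auto simp: F'_def intro: finite_subset[of _ F])
    have "\<exists>K\<in>\<H>. finite (rcosets K)"
    proof (rule insert.IH)
      show "finite F''" using F' A by (simp add: F''_def)
      show "F'' \<subseteq> carrier G \<times> \<H>" using F' A x by (fastforce simp: F''_def)
      show "carrier G \<subseteq> (\<Union>(g, H)\<in>F''. g <# H)"
      proof
        fix y assume y: "y \<in> carrier G"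
        then have "y \<in> (\<Union>(g, H)\<in>F. g <# H)" by (rule subsetD[OF insert.prems(4)])
        then obtain g K where gK: "(g, K) \<in> F" "y \<in> g <# K" by blast
        show "y \<in> (\<Union>(g, H)\<in>F''. g <# H)"
        proof (cases "K = H")
          case False
          then have "(g, K) \<in> F''" using gK insert.prems(3) by (auto simp: F''_def F'_def)
          then show ?thesis using gK by blast
        next
          case True
          then have g: "g \<in> A" "g \<in> carrier G" using gK A by (auto simp: A_def)
          obtain h where h: "h \<in> H" "y = g \<otimes> h" using gK True by (auto simp: l_coset_def)
          then have hG: "h \<in> carrier G" using subgroup.mem_carrier[OF H] by simp
          obtain k K where kK: "(k, K) \<in> F'" "x \<otimes> h \<in> k <# K" using cov[OF h(1)] by blast
          then obtain l where l: "l \<in> K" "x \<otimes> h = k \<otimes> l" by (auto simp: l_coset_def)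
          have K: "k \<in> carrier G" "subgroup K G" using kK F' insert.prems(1) by auto
          then have lG: "l \<in> carrier G" using subgroup.mem_carrier[OF K(2) l(1)] by simp
          have "y = g \<otimes> inv x \<otimes> (x \<otimes> h)"
            using h g hG x by (simp add: m_assoc mult_inv_cancel)
          also have "\<dots> = g \<otimes> inv x \<otimes> k \<otimes> l" using l g x K lG by (simp add: m_assoc)
          finally have "y \<in> (g \<otimes> inv x \<otimes> k) <# K" using l(1) by (auto simp: l_coset_def)
          moreover have "(g \<otimes> inv x \<otimes> k, K) \<in> F''" using g kK by (force simp: F''_def)
          ultimately show ?thesis by blast
        qed
      qed
    qed (use insert.prems(1) in auto)
    then show ?thesis by blast
  qed
qed

text \<open>Left translations carry \<open>C\<close> onto each of the finitely many cosets of
  \<open>N\<close>. A covering of \<open>C\<close> would therefore spread to the whole group, which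
  \<open>neumann_covering\<close> excludes.\<close>

lemma rcos_not_covered:
  assumes N: "N \<in> finite_index_normals G" "C \<in> rcosets N"
    and "finite F" "\<And>g H. (g, H) \<in> F \<Longrightarrow> g \<in> carrier G \<and> subgroup H G \<and> infinite (rcosets H)"
  shows "\<not> C \<subseteq> (\<Union>(g, H)\<in>F. g <# H)"
proof
  assume cov: "C \<subseteq> (\<Union>(g, H)\<in>F. g <# H)"
  note N' = finite_index_normalsD[OF N(1)]
  obtain c where c: "c \<in> carrier G" "C = N #> c" using N(2) by (auto simp: RCOSETS_def)
  define r where "r D = (SOME g. g \<in> carrier G \<and> D = N #> g)" for D
  have r: "r (N #> g) \<in> carrier G" "N #> g = N #> r (N #> g)" if "g \<in> carrier G" for g
    using someI[of "\<lambda>h. h \<in> carrier G \<and> N #> g = N #> h" g] that by (auto simp: r_def)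
  \<comment> \<open>Left multiplication by \<open>r D \<otimes> inv c\<close> takes \<open>C\<close>
    to \<open>D\<close>.\<close>
  define F' where "F' = (\<lambda>(D, g, H). (r D \<otimes> inv c \<otimes> g, H)) ` ((rcosets N) \<times> F)"
  have "\<exists>H\<in>snd ` F. finite (rcosets H)"
  proof (rule neumann_covering)
    show "finite F'" using N' assms(3) by (simp add: F'_def)
    show "F' \<subseteq> carrier G \<times> snd ` F"
    proof
      fix z assume "z \<in> F'"
      then obtain D g H where z: "z = (r D \<otimes> inv c \<otimes> g, H)" "D \<in> rcosets N" "(g, H) \<in> F"
        by (auto simp: F'_def)
      then have "r D \<in> carrier G" using r(1) by (auto simp: RCOSETS_def)
      then show "z \<in> carrier G \<times> snd ` F" using z c assms(4)[OF z(3)] by force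
    qed
    show "carrier G \<subseteq> (\<Union>(g, H)\<in>F'. g <# H)"
    proof
      fix y assume y: "y \<in> carrier G"
      let ?r = "r (N #> y)"
      note ry = r[OF y]
      have "c \<otimes> inv ?r \<otimes> y \<in> C"
      proof -
        have "inv ?r \<otimes> y \<in> N" using ry y rcos_eq_iff_normal[OF N'(1), of ?r y] by simp
        then have "c \<otimes> (inv ?r \<otimes> y) \<otimes> inv c \<in> N" using normal.inv_op_closed2[OF N'(1) c(1)] by simp
        then have "c \<otimes> inv ?r \<otimes> y \<otimes> inv c \<in> N" using c ry y by (simp add: m_assoc)
        then have "N #> (c \<otimes> inv ?r \<otimes> y) = C"
          using c ry y rcos_eq_iff[OF N'(2), of "c \<otimes> inv ?r \<otimes> y" c] by simp
        then show ?thesis using rcos_self[OF _ N'(2), of "c \<otimes> inv ?r \<otimes> y"] c ry y by simp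
      qed
      then obtain g H where gH: "(g, H) \<in> F" "c \<otimes> inv ?r \<otimes> y \<in> g <# H" using cov by blast
      then obtain l where l: "l \<in> H" "c \<otimes> inv ?r \<otimes> y = g \<otimes> l" by (auto simp: l_coset_def)
      have "g \<in> carrier G" "subgroup H G" using assms(4)[OF gH(1)] by auto
      with l have g: "g \<in> carrier G" "l \<in> carrier G" by (auto intro: subgroup.mem_carrier)
      have "y = ?r \<otimes> inv c \<otimes> (c \<otimes> inv ?r \<otimes> y)"
        using c ry(1) y by (simp add: m_assoc mult_inv_cancel)
      also have "\<dots> = ?r \<otimes> inv c \<otimes> g \<otimes> l" using l g c ry(1) by (simp add: m_assoc)
      finally have "y \<in> (?r \<otimes> inv c \<otimes> g) <# H" using l(1) by (auto simp: l_coset_def)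
      moreover have "(?r \<otimes> inv c \<otimes> g, H) \<in> F'" using gH(1) y by (force simp: F'_def RCOSETS_def)
      ultimately show "y \<in> (\<Union>(g, H)\<in>F'. g <# H)" by blast
    qed
  qed (use assms in auto)
  then show False using assms(4) by auto
qed

text \<open>Modulo \<open>N\<close>, left and right cosets of \<open>H\<close> are translates of the
  image of \<open>H\<close> and have equally many elements; the images of the right cosets partition
  \<open>rcosets N\<close>.\<close>

lemma card_rcos_image_lcos:
  assumes N: "N \<in> finite_index_normals G" and H: "subgroup H G" "N \<subseteq> H" and g: "g \<in> carrier G"
  shows "card ((\<lambda>x. N #> x) ` (g <# H)) * card (rcosets H) = card (rcosets N)"
proof -
  note N' = finite_index_normalsD[OF N]
  interpret Q: group "G Mod N" by (rule normal.factorgroup_is_group[OF N'(1)])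
  have HG: "H \<subseteq> carrier G" using H(1) by (rule subgroup.subset)
  have finH: "finite (rcosets H)" by (rule finite_rcosets_mono[OF N'(2) H N'(3)])
  let ?\<pi> = "\<lambda>x. N #> x"
  have \<pi>: "?\<pi> x \<in> carrier (G Mod N)" if "x \<in> carrier G" for x
    using that by (simp add: carrier_FactGroup_rcosets rcosetsI N'(4))
  have mult: "?\<pi> (x \<otimes> y) = ?\<pi> x \<otimes>\<^bsub>G Mod N\<^esub> ?\<pi> y" if "x \<in> carrier G" "y \<in> carrier G" for x y
    using that by (simp add: normal.rcos_sum[OF N'(1)])
  have lcancel: "C = D"
    if "B \<in> carrier (G Mod N)" "C \<in> carrier (G Mod N)" "D \<in> carrier (G Mod N)"
      "B \<otimes>\<^bsub>G Mod N\<^esub> C = B \<otimes>\<^bsub>G Mod N\<^esub> D" for B C D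
    using that by (simp del: mult_FactGroup)
  have \<pi>H: "C \<in> carrier (G Mod N)" if "C \<in> ?\<pi> ` H" for C using that \<pi> HG by blast
  have "?\<pi> ` (g <# H) = (\<lambda>C. ?\<pi> g \<otimes>\<^bsub>G Mod N\<^esub> C) ` ?\<pi> ` H"
    unfolding l_coset_def using HG g
    by (auto simp: mult image_iff subset_iff simp del: mult_FactGroup)
  then have l: "card (?\<pi> ` (g <# H)) = card (?\<pi> ` H)"
    by (simp only:) (rule card_image, rule inj_onI, rule lcancel[OF \<pi>[OF g] \<pi>H \<pi>H])
  have r: "card (?\<pi> ` (H #> x)) = card (?\<pi> ` H)" if x: "x \<in> carrier G" for x
  proof -
    have "?\<pi> ` (H #> x) = (\<lambda>C. C \<otimes>\<^bsub>G Mod N\<^esub> ?\<pi> x) ` ?\<pi> ` H"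
      unfolding r_coset_def[of G H] using HG x
      by (auto simp: mult image_iff subset_iff simp del: mult_FactGroup)
    then show ?thesis
      by (simp only:) (rule card_image, rule inj_on_subset[OF Q.inj_on_multc[OF \<pi>[OF x]]],
          rule subsetI, rule \<pi>H)
  qed
  have "rcosets N = (\<Union>D\<in>rcosets H. ?\<pi> ` D)"
  proof -
    have "carrier G = \<Union>(rcosets H)" using rcosets_part_G[OF H(1)] by simp
    then show ?thesis unfolding rcosets_eq_image[of N] by blast
  qed
  moreover have "card (\<Union>D\<in>rcosets H. ?\<pi> ` D) = (\<Sum>D\<in>rcosets H. card (?\<pi> ` D))"
  proof (rule card_UN_disjoint)
    show "\<forall>D\<in>rcosets H. finite (?\<pi> ` D)"
      using N'(3) \<open>rcosets N = _\<close> by (metis UN_upper finite_subset)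
    show "\<forall>D\<in>rcosets H. \<forall>E\<in>rcosets H. D \<noteq> E \<longrightarrow> ?\<pi> ` D \<inter> ?\<pi> ` E = {}"
    proof (intro ballI impI equals0I)
      fix D E C assume DE: "D \<in> rcosets H" "E \<in> rcosets H" "D \<noteq> E" and "C \<in> ?\<pi> ` D \<inter> ?\<pi> ` E"
      then obtain x y where xy: "x \<in> D" "y \<in> E" "?\<pi> x = ?\<pi> y" by blast
      then have G: "x \<in> carrier G" "y \<in> carrier G"
        using DE subgroup.rcosets_carrier[OF H(1) is_group] by blast+
      then have "H #> x = H #> y" using rcos_eq_mono[OF N'(2) H] xy by blast
      moreover have "D = H #> x" "E = H #> y"
        using DE(1,2) xy repr_independence[OF _ _ H(1)] by (auto simp: RCOSETS_def)
      ultimately show False using DE by simp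
    qed
  qed (rule finH)
  moreover have "(\<Sum>D\<in>rcosets H. card (?\<pi> ` D)) = (\<Sum>D\<in>rcosets H. card (?\<pi> ` H))"
    using r by (intro sum.cong) (auto simp: RCOSETS_def)
  ultimately show ?thesis using l by simp
qed

text \<open>Take one point from each coset of a normal \<open>N\<close> inside all listed subgroups
  of finite index: their cosets are unions of cosets of \<open>N\<close> and get their exact share.
  \<open>rcos_not_covered\<close> leaves room to pick these points off the listed cosets of infinite
  index.\<close>

lemma finite_equidistributed_set:
  assumes "finite J" "\<And>g H. (g, H) \<in> J \<Longrightarrow> g \<in> carrier G \<and> subgroup H G"
  obtains P where "finite P" "P \<noteq> {}" "P \<subseteq> carrier G"
    "\<And>g H. (g, H) \<in> J \<Longrightarrow> finite (rcosets H) \<Longrightarrow> card (P \<inter> (g <# H)) * card (rcosets H) = card P"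
    "\<And>g H. (g, H) \<in> J \<Longrightarrow> infinite (rcosets H) \<Longrightarrow> P \<inter> (g <# H) = {}"
proof -
  define F where "F = {(g, H) \<in> J. infinite (rcosets H)}"
  define \<H> where "\<H> = {H \<in> snd ` J. finite (rcosets H)}"
  have "finite \<H>" "finite F"
    using assms(1) by (auto simp: \<H>_def F_def intro: finite_subset[of _ J])
  have "\<forall>H\<in>\<H>. \<exists>N \<in> finite_index_normals G. N \<subseteq> H"
    using assms(2) exists_finite_index_normal_subset by (auto simp: \<H>_def)
  then obtain c where c: "\<And>H. H \<in> \<H> \<Longrightarrow> c H \<in> finite_index_normals G \<and> c H \<subseteq> H" by metis
  then obtain N where N: "N \<in> finite_index_normals G" "\<And>H. H \<in> \<H> \<Longrightarrow> N \<subseteq> H"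
    using finite_index_normals_INT[OF \<open>finite \<H>\<close>, of c] by blast
  note N' = finite_index_normalsD[OF N(1)]
  have "\<forall>C\<in>rcosets N. \<exists>x\<in>C. x \<notin> (\<Union>(g, H)\<in>F. g <# H)"
    using rcos_not_covered[OF N(1) _ \<open>finite F\<close>] assms(2) by (fastforce simp: F_def)
  then obtain p where p: "\<And>C. C \<in> rcosets N \<Longrightarrow> p C \<in> C \<and> p C \<notin> (\<Union>(g, H)\<in>F. g <# H)" by metis
  have pG: "p C \<in> carrier G" if "C \<in> rcosets N" for C
    using p[OF that] that subgroup.rcosets_carrier[OF N'(2) is_group] by blast
  have \<pi>p: "N #> p C = C" if "C \<in> rcosets N" for C
    using that p[OF that] repr_independence[OF _ _ N'(2)] by (auto simp: RCOSETS_def)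
  then have inj: "inj_on p (rcosets N)" by (metis inj_onI)
  show thesis
  proof (rule that[of "p ` (rcosets N)"])
    show "finite (p ` (rcosets N))" using N' by simp
    show "p ` (rcosets N) \<noteq> {}" using N'(6) by auto
    show "p ` (rcosets N) \<subseteq> carrier G" using pG by blast
  next
    fix g H assume "(g, H) \<in> J" "infinite (rcosets H)"
    then show "p ` (rcosets N) \<inter> (g <# H) = {}" using p by (fastforce simp: F_def)
  next
    fix g H assume gH: "(g, H) \<in> J" "finite (rcosets H)"
    then have H: "subgroup H G" "N \<subseteq> H" "g \<in> carrier G" using assms(2) N(2) by (force simp: \<H>_def)+
    have "p ` (rcosets N) \<inter> (g <# H) = p ` (\<lambda>x. N #> x) ` (g <# H)"
    proof safe
      fix C assume "C \<in> rcosets N" "p C \<in> g <# H"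
      then show "p C \<in> p ` (\<lambda>x. N #> x) ` (g <# H)" using \<pi>p by force
    next
      fix x assume x: "x \<in> g <# H"
      then have xG: "x \<in> carrier G" using l_coset_carrier[OF x] H subgroup.subset by blast
      then have C: "N #> x \<in> rcosets N" by (simp add: rcosetsI N'(4))
      then show "p (N #> x) \<in> p ` (rcosets N)" by blast
      have "N #> x = N #> p (N #> x)" using \<pi>p[OF C] by simp
      then have *: "inv x \<otimes> p (N #> x) \<in> H" using rcos_eq_iff_normal[OF N'(1) xG pG[OF C]] H(2) by blast
      have "inv g \<otimes> x \<in> H" using x lcos_iff[OF H(1,3) xG] by simp
      then have "(inv g \<otimes> x) \<otimes> (inv x \<otimes> p (N #> x)) \<in> H" using * subgroup.m_closed[OF H(1)] by blast
      then have "inv g \<otimes> p (N #> x) \<in> H"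
        using H(3) xG pG[OF C] by (simp add: m_assoc mult_inv_cancel)
      then show "p (N #> x) \<in> g <# H" using lcos_iff[OF H(1,3) pG[OF C]] by simp
    qed
    moreover have "(\<lambda>x. N #> x) ` (g <# H) \<subseteq> rcosets N"
      using l_coset_subset_G[OF subgroup.subset[OF H(1)] H(3)] rcosetsI[OF N'(4)] by blast
    ultimately have "card (p ` (rcosets N) \<inter> (g <# H)) = card ((\<lambda>x. N #> x) ` (g <# H))"
      using inj by (simp add: card_image inj_on_subset)
    then show "card (p ` (rcosets N) \<inter> (g <# H)) * card (rcosets H) = card (p ` (rcosets N))"
      using card_rcos_image_lcos[OF N(1) H] inj by (simp add: card_image)
  qed
qed

text \<open>Normalised counting on a finite set is additive, and each coset condition holds on a
  whole set \<open>Q j\<close>. \<open>finite_equidistributed_set\<close> makes finitely many of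
  these compatible, so a cluster point satisfies all of them.\<close>

lemma coset_correct_mean_exists: "\<exists>\<mu>. coset_correct G \<mu>"
proof -
  let ?J = "{(g, H). g \<in> carrier G \<and> subgroup H G}"
  define P0 where "P0 = {P. finite P \<and> P \<noteq> {} \<and> P \<subseteq> carrier G}"
  define Q where "Q = (\<lambda>(g, H). {P \<in> P0. if finite (rcosets H)
    then card (P \<inter> (g <# H)) * card (rcosets H) = card P else P \<inter> (g <# H) = {}})"
  define F where "F = (INF j\<in>?J. principal (Q j))"
  have "F \<noteq> bot"
    unfolding F_def
  proof (rule INF_filter_not_bot)
    fix J assume J: "J \<subseteq> ?J" "finite J"
    obtain P where P: "finite P" "P \<noteq> {}" "P \<subseteq> carrier G"
      "\<And>g H. (g, H) \<in> J \<Longrightarrow> finite (rcosets H) \<Longrightarrow> card (P \<inter> (g <# H)) * card (rcosets H) = card P"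
      "\<And>g H. (g, H) \<in> J \<Longrightarrow> infinite (rcosets H) \<Longrightarrow> P \<inter> (g <# H) = {}"
      using finite_equidistributed_set[OF J(2)] J(1) by blast
    then have "\<forall>j\<in>J. P \<in> Q j" unfolding Q_def P0_def by (simp add: split_beta)
    then have "\<exists>P. P \<in> (\<Inter>j\<in>J. Q j)" by blast
    then show "(INF j\<in>J. principal (Q j)) \<noteq> bot"
      using J(2) by (subst INF_principal_finite) (auto simp: principal_eq_bot_iff)
  qed
  have evQ: "eventually (\<lambda>P. P \<in> Q (g, H)) F" if "g \<in> carrier G" "subgroup H G" for g H
    using that unfolding F_def by (intro eventually_INF1[of "(g, H)"]) (auto simp: eventually_principal)
  have evP: "eventually (\<lambda>P. P \<in> P0) F"
    using evQ[OF one_closed subgroup_self] by (rule eventually_mono) (auto simp: Q_def)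
  define \<Phi> where "\<Phi> P A = real (card (P \<inter> A)) / real (card P)" for P A :: "'a set"
  \<comment> \<open>An infinite \<open>P\<close> has \<open>card P = 0\<close>, and division by zero
    gives \<open>0\<close>, so the bound holds for every \<open>P\<close>.\<close>
  have "\<bar>\<Phi> P A\<bar> \<le> 1" for P A
    by (cases "finite P") (auto simp: \<Phi>_def divide_le_eq intro: card_mono)
  then obtain \<mu> L where L: "L \<noteq> bot" "L \<le> filtermap \<Phi> F"
    and lim: "\<And>A. ((\<lambda>\<psi>. \<psi> A) \<longlongrightarrow> \<mu> A) L"
    using product_cluster_point[OF \<open>F \<noteq> bot\<close>, of \<Phi> "\<lambda>_. 1"] by blast
  note ev = eventually_cluster[OF L(2)]
  have const: "\<mu> A = c" if "eventually (\<lambda>P. \<Phi> P A = c) F" for A c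
  proof -
    have "((\<lambda>\<psi>. c) \<longlongrightarrow> \<mu> A) L" by (rule Lim_transform_eventually[OF lim ev[OF that]])
    then show ?thesis using tendsto_unique[OF L(1) _ tendsto_const] by metis
  qed
  have "coset_correct G \<mu>"
  proof
    fix A show "0 \<le> \<mu> A"
      by (rule tendsto_lowerbound[OF lim _ L(1)], rule ev) (simp add: \<Phi>_def)
  next
    show "\<mu> (carrier G) = 1"
      by (rule const, rule eventually_mono[OF evP]) (auto simp: \<Phi>_def P0_def Int_absorb2)
  next
    fix A B :: "'a set" assume AB: "A \<inter> B = {}"
    have "eventually (\<lambda>\<psi>. \<psi> (A \<union> B) = \<psi> A + \<psi> B) L"
    proof (rule ev, rule eventually_mono[OF evP])
      fix P assume "P \<in> P0"
      then have "card (P \<inter> (A \<union> B)) = card (P \<inter> A) + card (P \<inter> B)"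
        using AB by (subst card_Un_disjoint[symmetric]) (auto simp: P0_def Int_Un_distrib)
      then show "\<Phi> P (A \<union> B) = \<Phi> P A + \<Phi> P B" by (simp add: \<Phi>_def add_divide_distrib)
    qed
    then have "((\<lambda>\<psi>. \<psi> A + \<psi> B) \<longlongrightarrow> \<mu> (A \<union> B)) L"
      by (rule Lim_transform_eventually[OF lim])
    then show "\<mu> (A \<union> B) = \<mu> A + \<mu> B"
      using tendsto_unique[OF L(1) _ tendsto_add[OF lim lim]] by blast
  next
    fix H g assume H: "subgroup H G" "g \<in> carrier G"
    have "card (rcosets H) \<noteq> 0" if "finite (rcosets H)"
      using that subgroup.subgroup_in_rcosets[OF H(1) is_group] by auto
    then show "\<mu> (g <# H) = (if finite (rcosets H) then 1 / real (card (rcosets H)) else 0)"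
    proof (intro const eventually_mono[OF evQ[OF H(2,1)]])
      fix P assume P: "P \<in> Q (g, H)"
      show "\<Phi> P (g <# H) = (if finite (rcosets H) then 1 / real (card (rcosets H)) else 0)"
      proof (cases "finite (rcosets H)")
        case True
        with P have "real (card P) = real (card (P \<inter> (g <# H))) * real (card (rcosets H))" "card P \<noteq> 0"
          by (auto simp: Q_def P0_def simp flip: of_nat_mult)
        then show ?thesis using True by (auto simp: \<Phi>_def)
      qed (use P in \<open>auto simp: \<Phi>_def Q_def\<close>)
    qed
  qed
  then show ?thesis by blast
qed

end

section \<open>Positive degree of commutativity implies virtual abelianness\<close>

text \<open>With this side of conjugation the class of \<open>g\<close> corresponds to the right
  cosets of its centraliser, the cosets that \<open>rcosets\<close> counts.\<close>

definition conj_class :: "('a, 'b) monoid_scheme \<Rightarrow> 'a \<Rightarrow> 'a set" where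
  "conj_class G g = (\<lambda>t. inv\<^bsub>G\<^esub> t \<otimes>\<^bsub>G\<^esub> g \<otimes>\<^bsub>G\<^esub> t) ` carrier G"

definition commuting_set :: "('a, 'b) monoid_scheme \<Rightarrow> 'a \<Rightarrow> 'a set" where
  "commuting_set G g = {h \<in> carrier G. g \<otimes>\<^bsub>G\<^esub> h = h \<otimes>\<^bsub>G\<^esub> g}"

text \<open>Finiteness is demanded separately because \<open>card\<close> is \<open>0\<close> on an
  infinite class.\<close>

definition small_classes :: "('a, 'b) monoid_scheme \<Rightarrow> nat \<Rightarrow> 'a set" where
  "small_classes G n = {g \<in> carrier G. finite (conj_class G g) \<and> card (conj_class G g) \<le> n}"

section \<open>Conjugacy classes and centralisers\<close>

context group begin

lemma conj_eq_iff:
  assumes "g \<in> carrier G" "t \<in> carrier G" "s \<in> carrier G"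
  shows "inv t \<otimes> g \<otimes> t = inv s \<otimes> g \<otimes> s \<longleftrightarrow> t \<otimes> inv s \<in> commuting_set G g"
proof -
  have "inv t \<otimes> g \<otimes> t = inv s \<otimes> g \<otimes> s \<longleftrightarrow> t \<otimes> (inv t \<otimes> g \<otimes> t) \<otimes> inv s = t \<otimes> (inv s \<otimes> g \<otimes> s) \<otimes> inv s"
    using assms by simp
  also have "\<dots> \<longleftrightarrow> g \<otimes> (t \<otimes> inv s) = (t \<otimes> inv s) \<otimes> g"
    using assms by (simp add: m_assoc mult_inv_cancel)
  finally show ?thesis using assms by (simp add: commuting_set_def)
qed

lemma subgroup_commuting_set:
  assumes "g \<in> carrier G"
  shows "subgroup (commuting_set G g) G"
proof (rule subgroupI)
  show "commuting_set G g \<noteq> {}" using assms by (auto simp: commuting_set_def intro!: exI[of _ \<one>])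
  fix a assume a: "a \<in> commuting_set G g"
  then have aG: "a \<in> carrier G" by (simp add: commuting_set_def)
  from a have "inv a \<otimes> (g \<otimes> a) \<otimes> inv a = inv a \<otimes> (a \<otimes> g) \<otimes> inv a" by (simp add: commuting_set_def)
  then show "inv a \<in> commuting_set G g"
    using aG assms by (simp add: commuting_set_def m_assoc mult_inv_cancel)
  fix b assume b: "b \<in> commuting_set G g"
  have eqs: "g \<otimes> a = a \<otimes> g" "g \<otimes> b = b \<otimes> g" and bG: "b \<in> carrier G"
    using a b by (auto simp: commuting_set_def)
  have "g \<otimes> (a \<otimes> b) = a \<otimes> (g \<otimes> b)" using eqs(1) aG bG assms by (simp flip: m_assoc)
  then show "a \<otimes> b \<in> commuting_set G g" using eqs(2) aG bG assms by (simp add: commuting_set_def m_assoc)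
qed (auto simp: commuting_set_def)

lemma rcos_commuting_set_eq_iff:
  assumes "g \<in> carrier G" "t \<in> carrier G" "s \<in> carrier G"
  shows "commuting_set G g #> t = commuting_set G g #> s \<longleftrightarrow> inv t \<otimes> g \<otimes> t = inv s \<otimes> g \<otimes> s"
  using rcos_eq_iff[OF subgroup_commuting_set] conj_eq_iff assms by simp

text \<open>Orbit-stabiliser: cosets of the centraliser and conjugates of \<open>g\<close> determine
  each other, which transfers finiteness in both directions.\<close>

lemma rcosets_commuting_set:
  assumes g: "g \<in> carrier G"
  shows "finite (rcosets (commuting_set G g)) \<longleftrightarrow> finite (conj_class G g)"
    and "finite (conj_class G g) \<Longrightarrow> card (rcosets (commuting_set G g)) = card (conj_class G g)"
proof -
  note eq = rcos_commuting_set_eq_iff[OF g]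
  let ?f = "\<lambda>t. commuting_set G g #> t" and ?c = "\<lambda>t. inv t \<otimes> g \<otimes> t"
  show fin: "finite (rcosets (commuting_set G g)) \<longleftrightarrow> finite (conj_class G g)"
    unfolding rcosets_eq_image conj_class_def
    using finite_image_factor[of ?f "carrier G" ?c] finite_image_factor[of ?c "carrier G" ?f] eq by blast
  assume "finite (conj_class G g)"
  with fin show "card (rcosets (commuting_set G g)) = card (conj_class G g)"
    unfolding rcosets_eq_image conj_class_def
    using card_image_factor[of ?f "carrier G" ?c] card_image_factor[of ?c "carrier G" ?f] eq
    by (intro antisym) simp_all
qed

lemma conj_class_closed: "g \<in> carrier G \<Longrightarrow> conj_class G g \<subseteq> carrier G"
  by (auto simp: conj_class_def)

lemma conj_class_mult:
  assumes "g \<in> carrier G" "h \<in> carrier G"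
  shows "conj_class G (g \<otimes> h) \<subseteq> (\<lambda>(a, b). a \<otimes> b) ` (conj_class G g \<times> conj_class G h)"
proof
  fix x assume "x \<in> conj_class G (g \<otimes> h)"
  then obtain t where t: "t \<in> carrier G" "x = inv t \<otimes> (g \<otimes> h) \<otimes> t" by (auto simp: conj_class_def)
  then have "x = (inv t \<otimes> g \<otimes> t) \<otimes> (inv t \<otimes> h \<otimes> t)"
    using assms by (simp add: m_assoc mult_inv_cancel)
  with t(1) show "x \<in> (\<lambda>(a, b). a \<otimes> b) ` (conj_class G g \<times> conj_class G h)"
    by (force simp: conj_class_def)
qed

lemma conj_class_inv:
  assumes "g \<in> carrier G"
  shows "conj_class G (inv g) = m_inv G ` conj_class G g"
  using assms by (auto simp: conj_class_def image_image inv_mult_group m_assoc intro!: image_cong)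

lemma conj_class_one: "conj_class G \<one> = {\<one>}"
  using one_closed by (auto simp: conj_class_def image_iff intro: bexI[of _ \<one>])

lemma small_classes_mult:
  assumes "g \<in> small_classes G m" "h \<in> small_classes G n"
  shows "g \<otimes> h \<in> small_classes G (m * n)"
proof -
  have gh: "g \<in> carrier G" "h \<in> carrier G" "finite (conj_class G g)" "finite (conj_class G h)"
    "card (conj_class G g) \<le> m" "card (conj_class G h) \<le> n"
    using assms by (auto simp: small_classes_def)
  then have fin: "finite (conj_class G g \<times> conj_class G h)" by simp
  then have "finite (conj_class G (g \<otimes> h))"
    using finite_subset[OF conj_class_mult[OF gh(1,2)]] by simp
  moreover have "card (conj_class G (g \<otimes> h)) \<le> card (conj_class G g \<times> conj_class G h)"
    by (rule surj_card_le[OF fin conj_class_mult[OF gh(1,2)]])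
  then have "card (conj_class G (g \<otimes> h)) \<le> m * n"
    using mult_le_mono[OF gh(5,6)] by (simp add: card_cartesian_product)
  ultimately show ?thesis using gh by (simp add: small_classes_def)
qed

lemma small_classes_inv: "g \<in> small_classes G n \<Longrightarrow> inv g \<in> small_classes G n"
  by (auto simp: small_classes_def conj_class_inv intro: card_image_le[THEN order_trans])

lemma small_classes_mono: "m \<le> n \<Longrightarrow> small_classes G m \<subseteq> small_classes G n"
  by (auto simp: small_classes_def)

lemma one_small_classes: "n \<ge> 1 \<Longrightarrow> \<one> \<in> small_classes G n"
  by (simp add: small_classes_def conj_class_one)

text \<open>If \<open>y\<close> has at most \<open>n\<^sup>3\<close> conjugates and \<open>Y\<close> is the set of elements with at most \<open>n\<close> conjugates, then
  \<open>y Y\<close> and \<open>Y\<close> cannot be disjoint, so that \<open>y \<in> Y Y\<close>.\<close>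
lemma subgroup_small_classes:
  assumes fin: "finite (carrier G)" and n: "n \<ge> 1"
    and card: "card (small_classes G (n ^ 4)) < 2 * card (small_classes G n)"
  shows "subgroup (small_classes G (n\<^sup>2)) G"
proof -
  let ?Y = "small_classes G"
  have YG: "?Y k \<subseteq> carrier G" for k by (auto simp: small_classes_def)
  then have finY: "finite (?Y k)" for k using fin finite_subset by blast
  have fact: "\<exists>b\<in>?Y n. \<exists>a\<in>?Y n. y = b \<otimes> a" if y: "y \<in> ?Y (n ^ 3)" for y
  proof -
    have yG: "y \<in> carrier G" using y YG by blast
    have "(\<lambda>x. y \<otimes> x) ` ?Y n \<inter> ?Y n \<noteq> {}"
    proof
      assume disj: "(\<lambda>x. y \<otimes> x) ` ?Y n \<inter> ?Y n = {}"
      \<comment> \<open>The origin of the exponent 4: were the translate disjoint from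
        \<open>small_classes G n\<close>, both would fit into level \<open>n ^ 4\<close> and double
        the count.\<close>
      have "n ^ 3 * n = n ^ 4" by (simp add: eval_nat_numeral)
      then have "(\<lambda>x. y \<otimes> x) ` ?Y n \<subseteq> ?Y (n ^ 4)"
        using small_classes_mult[OF y, of _ n] by auto
      moreover have "?Y n \<subseteq> ?Y (n ^ 4)"
        using self_le_power[OF n] by (intro small_classes_mono) simp
      ultimately have "card ((\<lambda>x. y \<otimes> x) ` ?Y n \<union> ?Y n) \<le> card (?Y (n ^ 4))"
        by (intro card_mono finY) simp
      moreover have "card ((\<lambda>x. y \<otimes> x) ` ?Y n) = card (?Y n)"
        using YG yG by (intro card_image inj_onI) (simp add: subset_iff)
      ultimately show False using card disj finY by (simp add: card_Un_disjoint)
    qed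
    then obtain a where a: "a \<in> ?Y n" "y \<otimes> a \<in> ?Y n" by blast
    have "y = (y \<otimes> a) \<otimes> inv a" using a YG yG by (simp add: m_assoc subset_iff)
    with a small_classes_inv show ?thesis by blast
  qed
  have "n\<^sup>2 * n = n ^ 3" "n * n = n\<^sup>2" by (simp_all add: eval_nat_numeral)
  note mult = small_classes_mult[of _ "n\<^sup>2" _ n, unfolded this] small_classes_mult[of _ n _ n, unfolded this]
  \<comment> \<open>Two factors with at most \<open>n\<close> conjugates each give a product at
    level \<open>n\<^sup>2\<close>, so the levels \<open>n\<^sup>2\<close> and \<open>n ^ 3\<close>
    coincide.\<close>
  have sub: "?Y (n ^ 3) \<subseteq> ?Y (n\<^sup>2)" using fact mult(2) by blast
  have sup: "?Y (n\<^sup>2) \<subseteq> ?Y (n ^ 3)" using n by (intro small_classes_mono power_increasing) auto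
  show ?thesis
  proof (rule subgroupI)
    show "?Y (n\<^sup>2) \<noteq> {}" using one_small_classes[of "n\<^sup>2"] n by auto
    fix y assume y: "y \<in> ?Y (n\<^sup>2)"
    then show "inv y \<in> ?Y (n\<^sup>2)" by (rule small_classes_inv)
    fix z assume "z \<in> ?Y (n\<^sup>2)"
    \<comment> \<open>The two factors of \<open>z\<close> are multiplied on one at a time: each
      multiplication reaches level \<open>n ^ 3\<close>, which \<open>sub\<close> brings back to
      \<open>n\<^sup>2\<close>.\<close>
    then obtain b a where ba: "b \<in> ?Y n" "a \<in> ?Y n" "z = b \<otimes> a" using fact sup by blast
    then have "y \<otimes> b \<in> ?Y (n\<^sup>2)" using mult(1)[OF y] sub by blast
    then have "(y \<otimes> b) \<otimes> a \<in> ?Y (n\<^sup>2)" using mult(1) ba sub by blast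
    then show "y \<otimes> z \<in> ?Y (n\<^sup>2)" using ba y YG by (simp add: m_assoc subset_iff)
  qed (rule YG)
qed

lemma card_Comm:
  assumes "finite (carrier G)"
  shows "card (Comm G) = (\<Sum>g\<in>carrier G. card (commuting_set G g))"
proof -
  have "Comm G = Sigma (carrier G) (commuting_set G)"
    by (auto simp: Comm_def commuting_set_def)
  then show ?thesis using assms
    by (simp add: card_SigmaI commuting_set_def)
qed

lemma card_commuting_set:
  assumes "finite (carrier G)" "g \<in> carrier G"
  shows "card (conj_class G g) * card (commuting_set G g) = card (carrier G)"
  using lagrange[OF subgroup_commuting_set[OF assms(2)]] rcosets_commuting_set(2)[OF assms(2)] assms
  by (simp add: order_def conj_class_def)

text \<open>An element outside \<open>small_classes G n\<close> has a centraliser of density at most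
  \<open>1 / n\<close>; the others are charged with density \<open>1\<close>.\<close>

lemma dc_le_small_classes:
  assumes fin: "finite (carrier G)" and n: "n > 0"
  shows "dc G \<le> card (small_classes G n) / card (carrier G) + 1 / n"
proof -
  let ?c = "real (card (carrier G))"
  have c: "?c > 0" using fin one_closed by (auto simp: card_gt_0_iff)
  have Y: "small_classes G n \<subseteq> carrier G" by (auto simp: small_classes_def)
  have "real (card (commuting_set G g)) \<le> (if g \<in> small_classes G n then ?c else 0) + ?c / n"
    if g: "g \<in> carrier G" for g
  proof (cases "g \<in> small_classes G n")
    case True
    have "card (commuting_set G g) \<le> card (carrier G)"
      using fin by (intro card_mono) (auto simp: commuting_set_def)
    then show ?thesis using True n by (simp add: add_increasing2)
  next
    case False
    then have "n \<le> card (conj_class G g)" using g fin by (auto simp: small_classes_def conj_class_def)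
    then have "n * card (commuting_set G g) \<le> card (carrier G)"
      using card_commuting_set[OF fin g] by (metis mult_le_mono1)
    then have "real n * real (card (commuting_set G g)) \<le> ?c" by (metis of_nat_le_iff of_nat_mult)
    then show ?thesis using False n by (simp add: field_simps)
  qed
  then have "real (card (Comm G)) \<le> (\<Sum>g\<in>carrier G. (if g \<in> small_classes G n then ?c else 0) + ?c / n)"
    unfolding card_Comm[OF fin] of_nat_sum by (rule sum_mono)
  also have "\<dots> = card (small_classes G n) * ?c + ?c * ?c / n"
    using fin Y by (simp add: sum.distrib sum.If_cases Int_absorb1)
  finally show ?thesis
    using c n unfolding dc_def order_def by (simp add: field_simps power2_eq_square)
qed


text \<open>Indexing the class by \<open>carrier G\<close> makes classes modulo different subgroups
  images of the same set, hence comparable.\<close>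

lemma conj_class_FactGroup:
  assumes "N \<lhd> G" "g \<in> carrier G"
  shows "conj_class (G Mod N) (N #> g) = (\<lambda>t. N #> (inv t \<otimes> g \<otimes> t)) ` carrier G"
proof -
  interpret Q: group "G Mod N" using assms(1) by (rule normal.factorgroup_is_group)
  interpret h: group_hom G "G Mod N" "\<lambda>x. N #> x"
    by unfold_locales (rule normal.r_coset_hom_Mod[OF assms(1)])
  show ?thesis
    using assms(2) unfolding conj_class_def carrier_FactGroup image_image
    by (intro image_cong refl) (simp add: h.hom_mult h.hom_inv del: mult_FactGroup)
qed

lemma subgroup_rcos_vimage:
  assumes N: "N \<lhd> G" and K: "subgroup K (G Mod N)"
  shows "subgroup {g \<in> carrier G. N #> g \<in> K} G" "N \<subseteq> {g \<in> carrier G. N #> g \<in> K}"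
proof -
  interpret Q: group "G Mod N" using N by (rule normal.factorgroup_is_group)
  interpret h: group_hom G "G Mod N" "\<lambda>x. N #> x"
    by unfold_locales (rule normal.r_coset_hom_Mod[OF N])
  have "N \<in> K" using subgroup.one_closed[OF K] by simp
  show "N \<subseteq> {g \<in> carrier G. N #> g \<in> K}"
  proof
    fix x assume "x \<in> N"
    moreover have "subgroup N G" using N by (rule normal_imp_subgroup)
    ultimately show "x \<in> {g \<in> carrier G. N #> g \<in> K}"
      using \<open>N \<in> K\<close> by (auto simp: coset_join2 subgroup.mem_carrier)
  qed
  then show "subgroup {g \<in> carrier G. N #> g \<in> K} G"
    using subgroup.one_closed[OF normal_imp_subgroup[OF N]] subgroup.m_closed[OF K] subgroup.m_inv_closed[OF K]
    by (intro subgroupI) (auto simp: h.hom_mult h.hom_inv simp del: mult_FactGroup)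
qed

lemma dc_RF_le: "N \<in> finite_index_normals G \<Longrightarrow> dc_RF G \<le> dc (G Mod N)"
  unfolding dc_RF_def by (rule cINF_lower) (auto intro!: bdd_belowI2[of _ 0] simp: dc_def)

text \<open>If \<open>h\<close> has a largest \<open>H\<close>-class, multiplying \<open>h\<close>
  by a suitable \<open>c\<close> only translates this class, so the commutators of \<open>c\<close>
  with \<open>H\<close> lie in a finite set \<open>F\<close>. Inside a finite index subgroup that
  avoids the nontrivial elements of \<open>F\<close> they vanish.\<close>

lemma virtually_abelian_of_bounded_classes:
  assumes rf: "residually_finite G" and H: "subgroup H G" "finite (rcosets H)"
    and bd: "H \<subseteq> small_classes G m"
  shows "virtually_abelian G"
proof -
  have HG: "H \<subseteq> carrier G" using H(1) by (rule subgroup.subset)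
  define cl where "cl h = (\<lambda>t. inv t \<otimes> h \<otimes> t) ` H" for h
  have cl_sub: "cl h \<subseteq> conj_class G h" for h using HG by (auto simp: cl_def conj_class_def)
  have cl: "finite (cl h)" "card (cl h) \<le> m" if "h \<in> H" for h
  proof -
    have *: "finite (conj_class G h)" "card (conj_class G h) \<le> m"
      using bd that by (auto simp: small_classes_def)
    show "finite (cl h)" "card (cl h) \<le> m"
      using finite_subset[OF cl_sub *(1)] card_mono[OF *(1) cl_sub] *(2) by simp_all
  qed
  have "\<exists>h. h \<in> H \<and> (\<forall>y. y \<in> H \<longrightarrow> card (cl y) \<le> card (cl h))"
    by (rule Lattices_Big.ex_has_greatest_nat[of _ \<one> _ "Suc m"])
      (use cl subgroup.one_closed[OF H(1)] in \<open>auto simp: less_Suc_eq_le\<close>)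
  then obtain h where h: "h \<in> H" "\<And>y. y \<in> H \<Longrightarrow> card (cl y) \<le> card (cl h)" by blast
  \<comment> \<open>Finitely many conjugators already produce the whole \<open>H\<close>-class of
    \<open>h\<close>; an element \<open>c\<close> that commutes with all of them can be pulled out
    of these conjugates of \<open>c \<otimes> h\<close>.\<close>
  obtain R where R: "R \<subseteq> H" "finite R" "cl h = (\<lambda>t. inv t \<otimes> h \<otimes> t) ` R"
    using finite_subset_image[OF cl(1)[OF h(1)], of "\<lambda>t. inv t \<otimes> h \<otimes> t" H]
    by (auto simp: cl_def)
  have "finite (rcosets (commuting_set G r))" if "r \<in> R" for r
    using that R(1) HG bd rcosets_commuting_set(1)[of r] by (auto simp: small_classes_def)
  then have "\<forall>r\<in>R. \<exists>N \<in> finite_index_normals G. N \<subseteq> commuting_set G r"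
    using R(1) HG by (intro ballI exists_finite_index_normal_subset subgroup_commuting_set) auto
  then obtain c where "\<And>r. r \<in> R \<Longrightarrow> c r \<in> finite_index_normals G \<and> c r \<subseteq> commuting_set G r" by metis
  then obtain C where C: "C \<in> finite_index_normals G" "\<And>r. r \<in> R \<Longrightarrow> C \<subseteq> commuting_set G r"
    using finite_index_normals_INT[OF R(2), of c] by blast
  define F where "F = (\<lambda>(a, b). a \<otimes> inv b) ` (cl h \<times> cl h)"
  have clG: "cl y \<subseteq> carrier G" if "y \<in> H" for y
    using cl_sub[of y] conj_class_closed[of y] that HG by blast
  have "finite F" "F \<subseteq> carrier G" using cl(1)[OF h(1)] clG[OF h(1)] by (auto simp: F_def)
  then obtain N where N: "N \<in> finite_index_normals G" "N \<inter> F \<subseteq> {\<one>}"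
    using residually_finite_separate[OF rf] by blast
  have comm: "inv c \<otimes> (inv y \<otimes> c \<otimes> y) \<in> F" if c: "c \<in> C" "c \<in> H" and y: "y \<in> H" for c y
  proof -
    have G: "c \<in> carrier G" "y \<in> carrier G" "h \<in> carrier G" using c y h(1) HG by auto
    have ch: "c \<otimes> h \<in> H" using c h(1) subgroup.m_closed[OF H(1)] by blast
    have r: "inv r \<otimes> (c \<otimes> h) \<otimes> r = c \<otimes> (inv r \<otimes> h \<otimes> r)" if "r \<in> R" for r
    proof -
      have rG: "r \<in> carrier G" using that R(1) HG by blast
      have "inv r \<in> commuting_set G c"
      proof (rule subgroup.m_inv_closed[OF subgroup_commuting_set[OF G(1)]])
        show "r \<in> commuting_set G c" using C(2)[OF that] c(1) rG by (auto simp: commuting_set_def)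
      qed
      then have "inv r \<otimes> c = c \<otimes> inv r" by (simp add: commuting_set_def)
      then show ?thesis using G rG by (metis inv_closed m_assoc m_closed)
    qed
    have "(\<lambda>a. c \<otimes> a) ` cl h \<subseteq> cl (c \<otimes> h)"
    proof
      fix z assume "z \<in> (\<lambda>a. c \<otimes> a) ` cl h"
      then obtain r where "r \<in> R" "z = c \<otimes> (inv r \<otimes> h \<otimes> r)" unfolding R(3) by blast
      with r R(1) show "z \<in> cl (c \<otimes> h)" by (force simp: cl_def)
    qed
    moreover have "card ((\<lambda>a. c \<otimes> a) ` cl h) = card (cl h)"
      using clG[OF h(1)] G by (intro card_image inj_onI) (simp add: subset_iff)
    \<comment> \<open>By the choice of \<open>h\<close>, \<open>cl (c \<otimes> h)\<close> has no
      more elements than \<open>cl h\<close>, so the inclusion is an equality.\<close>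
    ultimately have eq: "(\<lambda>a. c \<otimes> a) ` cl h = cl (c \<otimes> h)"
      using card_subset_eq[OF cl(1)[OF ch]] h(2)[OF ch] card_mono[OF cl(1)[OF ch]]
      by (metis le_antisym)
    have "inv y \<otimes> (c \<otimes> h) \<otimes> y \<in> cl (c \<otimes> h)" using y by (auto simp: cl_def)
    then obtain a where a: "a \<in> cl h" "inv y \<otimes> (c \<otimes> h) \<otimes> y = c \<otimes> a" unfolding eq[symmetric] by blast
    let ?b = "inv y \<otimes> h \<otimes> y"
    have b: "?b \<in> cl h" using y by (auto simp: cl_def)
    have aG: "a \<in> carrier G" using a(1) clG[OF h(1)] by blast
    \<comment> \<open>Conjugation by \<open>y\<close> is multiplicative; cancelling expresses the
      commutator of \<open>c\<close> and \<open>y\<close> by two elements of the finite set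
      \<open>cl h\<close>.\<close>
    have "(inv y \<otimes> c \<otimes> y) \<otimes> ?b = c \<otimes> a"
      using a(2) G by (simp add: m_assoc mult_inv_cancel)
    then have "inv y \<otimes> c \<otimes> y = c \<otimes> a \<otimes> inv ?b"
      using G aG by (metis inv_closed inv_solve_right m_closed)
    then have "inv c \<otimes> (inv y \<otimes> c \<otimes> y) = a \<otimes> inv ?b"
      using G aG by (simp add: m_assoc mult_inv_cancel)
    then show ?thesis using a(1) b by (force simp: F_def)
  qed
  \<comment> \<open>A commutator of two elements of \<open>?A\<close> lies in both \<open>F\<close>
    and \<open>N\<close>, hence is trivial.\<close>
  let ?A = "H \<inter> (C \<inter> N)"
  note CN = finite_index_normalsD[OF finite_index_normals_Int[OF C(1) N(1)]]
  have A: "subgroup ?A G" using H(1) CN(2) by (rule subgroups_Inter_pair)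
  have "finite (rcosets ?A)" using finite_rcosets_Int[OF H(1) CN(2) H(2) CN(3)] .
  moreover have "comm_group (G\<lparr>carrier := ?A\<rparr>)"
  proof (rule group.group_comm_groupI)
    show "group (G\<lparr>carrier := ?A\<rparr>)" using A by (rule subgroup.subgroup_is_group) (rule is_group)
    fix x y assume "x \<in> carrier (G\<lparr>carrier := ?A\<rparr>)" "y \<in> carrier (G\<lparr>carrier := ?A\<rparr>)"
    then have xy: "x \<in> H" "x \<in> C" "x \<in> N" "y \<in> H" "y \<in> N" by auto
    then have G: "x \<in> carrier G" "y \<in> carrier G" using HG by auto
    note Nsub = finite_index_normalsD(2)[OF N(1)]
    have "inv x \<otimes> (inv y \<otimes> x \<otimes> y) \<in> N"
      using xy subgroup.m_closed[OF Nsub] subgroup.m_inv_closed[OF Nsub] by simp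
    then have "inv x \<otimes> (inv y \<otimes> x \<otimes> y) = \<one>" using comm[of x y] xy N(2) by blast
    then have "inv y \<otimes> x \<otimes> y = x"
      using G by (metis inv_closed inv_equality inv_inv m_closed inv_comm)
    then have "y \<otimes> (inv y \<otimes> x \<otimes> y) = y \<otimes> x" by simp
    then show "x \<otimes>\<^bsub>G\<lparr>carrier := ?A\<rparr>\<^esub> y = y \<otimes>\<^bsub>G\<lparr>carrier := ?A\<rparr>\<^esub> x"
      using G by (simp add: m_assoc mult_inv_cancel)
  qed
  ultimately show ?thesis unfolding virtually_abelian_def using A by blast
qed

end

section \<open>Density of elements with small classes in the finite quotients\<close>

context coset_correct
begin

text \<open>Pulling back to \<open>G\<close> lets the small elements of different quotients be
  compared by inclusion and measured by one mean.\<close>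

definition small_preimage :: "nat \<Rightarrow> 'a set \<Rightarrow> 'a set" where
  "small_preimage n N = {g \<in> carrier G. N #> g \<in> small_classes (G Mod N) n}"

lemma mean_small_preimage:
  assumes "N \<in> finite_index_normals G"
  shows "\<mu> (small_preimage n N) = card (small_classes (G Mod N) n) / card (rcosets N)"
  unfolding small_preimage_def
  by (rule mean_rcos_preimage[OF assms]) (auto simp: small_classes_def carrier_FactGroup_rcosets)

text \<open>Conjugates that agree modulo \<open>N\<close> agree modulo the larger \<open>M\<close>,
  so classes can only shrink in the coarser quotient.\<close>

lemma small_preimage_antimono:
  assumes N: "N \<in> finite_index_normals G" and M: "M \<in> finite_index_normals G" and "N \<subseteq> M"
  shows "small_preimage n N \<subseteq> small_preimage n M"
proof
  note N' = finite_index_normalsD[OF N] and M' = finite_index_normalsD[OF M]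
  fix g assume "g \<in> small_preimage n N"
  then have g: "g \<in> carrier G" and *: "finite (conj_class (G Mod N) (N #> g))"
    "card (conj_class (G Mod N) (N #> g)) \<le> n"
    by (auto simp: small_preimage_def small_classes_def)
  have eq: "M #> (inv t \<otimes> g \<otimes> t) = M #> (inv s \<otimes> g \<otimes> s)"
    if "t \<in> carrier G" "s \<in> carrier G" "N #> (inv t \<otimes> g \<otimes> t) = N #> (inv s \<otimes> g \<otimes> s)" for s t
    using that rcos_eq_mono[OF N'(2) M'(2) \<open>N \<subseteq> M\<close>] g by simp
  have "finite (conj_class (G Mod M) (M #> g))" "card (conj_class (G Mod M) (M #> g)) \<le> n"
    using * eq finite_image_factor[of "\<lambda>t. N #> (inv t \<otimes> g \<otimes> t)" "carrier G" "\<lambda>t. M #> (inv t \<otimes> g \<otimes> t)"]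
      card_image_factor[of "\<lambda>t. N #> (inv t \<otimes> g \<otimes> t)" "carrier G" "\<lambda>t. M #> (inv t \<otimes> g \<otimes> t)"]
    unfolding conj_class_FactGroup[OF N'(1) g] conj_class_FactGroup[OF M'(1) g]
    by (blast, meson order_trans)
  then show "g \<in> small_preimage n M"
    using g by (auto simp: small_preimage_def small_classes_def carrier_FactGroup_rcosets rcosetsI M'(4))
qed

text \<open>Otherwise \<open>n + 1\<close> conjugates of \<open>g\<close> would stay distinct modulo
  some \<open>N\<close>, hence also modulo \<open>N \<inter> N0\<close>, where \<open>small\<close>
  applies.\<close>

lemma small_classes_of_small_preimage:
  assumes rf: "residually_finite G" and N0: "N0 \<in> finite_index_normals G" and g: "g \<in> carrier G"
    and small: "\<And>N. \<lbrakk>N \<in> finite_index_normals G; N \<subseteq> N0\<rbrakk> \<Longrightarrow> g \<in> small_preimage n N"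
  shows "g \<in> small_classes G n"
proof (rule ccontr)
  assume "g \<notin> small_classes G n"
  then have "infinite (conj_class G g) \<or> Suc n \<le> card (conj_class G g)"
    using g by (auto simp: small_classes_def)
  then obtain E where E: "E \<subseteq> conj_class G g" "finite E" "card E = Suc n"
    by (meson infinite_arbitrarily_large obtain_subset_with_card_n)
  then have EG: "E \<subseteq> carrier G" using conj_class_closed[OF g] by blast
  obtain N where N: "N \<in> finite_index_normals G" "inj_on (\<lambda>x. N #> x) E"
    using residually_finite_inj_on[OF rf E(2) EG] by blast
  define M where "M = N \<inter> N0"
  have M: "M \<in> finite_index_normals G" unfolding M_def by (rule finite_index_normals_Int[OF N(1) N0])
  have inj: "inj_on (\<lambda>x. M #> x) E"
  proof (rule inj_onI)
    fix x y assume xy: "x \<in> E" "y \<in> E" "M #> x = M #> y"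
    then have "N #> x = N #> y"
      using rcos_eq_mono[OF finite_index_normalsD(2)[OF M] finite_index_normalsD(2)[OF N(1)], of x y] EG
      by (auto simp: M_def)
    then show "x = y" using N(2) xy by (auto dest: inj_onD)
  qed
  have "(\<lambda>x. M #> x) ` E \<subseteq> conj_class (G Mod M) (M #> g)"
    using E(1) unfolding conj_class_FactGroup[OF finite_index_normalsD(1)[OF M] g]
    by (auto simp: conj_class_def)
  moreover have "g \<in> small_preimage n M" using small[OF M] by (simp add: M_def)
  then have "finite (conj_class (G Mod M) (M #> g))" "card (conj_class (G Mod M) (M #> g)) \<le> n"
    by (auto simp: small_preimage_def small_classes_def)
  ultimately have "card ((\<lambda>x. M #> x) ` E) \<le> n" by (metis card_mono order_trans)
  then show False using E(3) inj by (simp add: card_image)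
qed

lemma dc_RF_pos_imp_virtually_abelian:
  assumes rf: "residually_finite G" and pos: "0 < dc_RF G"
  shows "virtually_abelian G"
proof -
  let ?\<N> = "finite_index_normals G"
  \<comment> \<open>By \<open>mean_small_preimage\<close>, \<open>a n N\<close> is the proportion of
    elements of \<open>G Mod N\<close> with at most \<open>n\<close> conjugates.\<close>
  define a where "a n N = \<mu> (small_preimage n N)" for n N
  define \<delta> where "\<delta> n = (INF N\<in>?\<N>. a n N)" for n
  have ne: "?\<N> \<noteq> {}" using carrier_finite_index_normal by blast
  have pG: "small_preimage n N \<subseteq> carrier G" for n N by (auto simp: small_preimage_def)
  have a: "0 \<le> a n N" "a n N \<le> 1" for n N
    using mean_nonneg[OF pG] mean_le_1[OF pG] by (auto simp: a_def)
  have bdd: "bdd_below (a n ` ?\<N>)" for n using a(1) by (intro bdd_belowI2[of _ 0])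
  have \<delta>_le: "\<delta> n \<le> a n N" if "N \<in> ?\<N>" for n N
    unfolding \<delta>_def by (rule cINF_lower[OF bdd that])
  have bdd': "bdd_above (range (\<lambda>n. \<delta> (Suc n)))"
    using \<delta>_le[OF carrier_finite_index_normal] a(2) by (intro bdd_aboveI2[of _ _ 1]) (rule order_trans)
  have amono: "a m N \<le> a n N" if "m \<le> n" "N \<in> ?\<N>" for m n N
    using group.small_classes_mono[OF normal.factorgroup_is_group[OF finite_index_normalsD(1)[OF that(2)]] that(1)]
    unfolding a_def by (intro mean_mono pG) (auto simp: small_preimage_def)
  have \<delta>_ge: "dc_RF G - 1 / n \<le> \<delta> n" if "n > 0" for n
    unfolding \<delta>_def
  proof (rule cINF_greatest[OF ne])
    fix N assume N: "N \<in> ?\<N>"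
    note N' = finite_index_normalsD[OF N]
    interpret Q: group "G Mod N" using N'(1) by (rule normal.factorgroup_is_group)
    show "dc_RF G - 1 / n \<le> a n N"
      using dc_RF_le[OF N] Q.dc_le_small_classes[OF _ that] N'(3)
      by (simp add: a_def mean_small_preimage[OF N] carrier_FactGroup_rcosets)
  qed
  \<comment> \<open>\<open>Suc\<close> restricts the supremum to positive levels, where
    \<open>\<delta>_ge\<close> is available. A level with \<open>\<delta> n > D / 2\<close> cannot
    double on the way to \<open>n ^ 4\<close>, since \<open>\<delta> (n ^ 4)\<close> is at most
    \<open>D\<close>.\<close>
  define D where "D = (SUP n. \<delta> (Suc n))"
  have le_D: "\<delta> (Suc n) \<le> D" for n unfolding D_def by (rule cSUP_upper[OF _ bdd']) simp
  obtain m where "1 / real (Suc m) < dc_RF G" using pos nat_approx_posE by blast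
  then have "0 < D" using \<delta>_ge[of "Suc m"] le_D[of m] by simp
  then have "D / 2 < (SUP n. \<delta> (Suc n))" unfolding D_def by simp
  then obtain k where k: "D / 2 < \<delta> (Suc k)" unfolding less_cSUP_iff[OF UNIV_not_empty bdd'] by blast
  define n where "n = Suc k"
  have n: "n \<ge> 1" by (simp add: n_def)
  have "\<delta> (n ^ 4) \<le> D" using le_D[of "n ^ 4 - 1"] n by simp
  then have "(INF N\<in>?\<N>. a (n ^ 4) N) < 2 * \<delta> n" using k by (simp add: n_def flip: \<delta>_def)
  \<comment> \<open>By antitonicity, the bound at this one \<open>N0\<close> gives the non-doubling
    condition in every quotient below it.\<close>
  then obtain N0 where N0: "N0 \<in> ?\<N>" "a (n ^ 4) N0 < 2 * \<delta> n"
    unfolding cINF_less_iff[OF ne bdd] by blast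
  let ?H = "small_preimage (n\<^sup>2)"
  have sub: "subgroup (?H N) G \<and> N \<subseteq> ?H N" if N: "N \<in> ?\<N>" "N \<subseteq> N0" for N
  proof -
    note N' = finite_index_normalsD[OF N(1)]
    interpret Q: group "G Mod N" using N'(1) by (rule normal.factorgroup_is_group)
    have "a (n ^ 4) N \<le> a (n ^ 4) N0"
      unfolding a_def by (intro mean_mono small_preimage_antimono N N0 pG)
    then have "a (n ^ 4) N < 2 * a n N" using N0(2) \<delta>_le[OF N(1), of n] by simp
    then have "real (card (small_classes (G Mod N) (n ^ 4))) < 2 * real (card (small_classes (G Mod N) n))"
      using N'(6) by (simp add: a_def mean_small_preimage[OF N(1)] divide_less_cancel)
    then have "subgroup (small_classes (G Mod N) (n\<^sup>2)) (G Mod N)"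
      using N'(3) n by (intro Q.subgroup_small_classes) (simp_all add: carrier_FactGroup_rcosets)
    then show ?thesis
      using subgroup_rcos_vimage[OF N'(1)] unfolding small_preimage_def by blast
  qed
  \<comment> \<open>If \<open>?H N\<close> were a proper subgroup of \<open>?H N0\<close>, then
    \<open>?H N0\<close> would contain a disjoint translate of it as well, and twice its density
    would be at most \<open>a (n ^ 4) N0\<close>, which is less than
    \<open>2 * \<delta> n\<close>.\<close>
  have "?H N0 \<subseteq> ?H N" if N: "N \<in> ?\<N>" "N \<subseteq> N0" for N
  proof (rule ccontr)
    assume "\<not> ?H N0 \<subseteq> ?H N"
    then obtain x where x: "x \<in> ?H N0" "x \<notin> ?H N" by blast
    have xG: "x \<in> carrier G" using x(1) pG by blast
    note sN = sub[OF N, THEN conjunct1] and s0 = sub[OF N0(1) order_refl, THEN conjunct1]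
    have HN: "?H N \<subseteq> ?H N0" by (rule small_preimage_antimono[OF N(1) N0(1) N(2)])
    have "(x <# ?H N) \<inter> ?H N = {}"
    proof (rule equals0I)
      fix y assume "y \<in> (x <# ?H N) \<inter> ?H N"
      then have y: "y \<in> ?H N" "inv x \<otimes> y \<in> ?H N" "y \<in> carrier G"
        using lcos_iff[OF sN xG] pG by auto
      have "x = y \<otimes> inv (inv x \<otimes> y)" using xG y(3) by (simp add: inv_mult_group mult_inv_cancel)
      then have "x \<in> ?H N" using subgroup.m_closed[OF sN y(1) subgroup.m_inv_closed[OF sN y(2)]] by simp
      with x(2) show False ..
    qed
    then have "\<mu> ((x <# ?H N) \<union> ?H N) = \<mu> (x <# ?H N) + \<mu> (?H N)"
      by (intro mean_Un l_coset_subset_G pG xG)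
    also have "\<mu> (x <# ?H N) = \<mu> (?H N)"
      using mean_coset[OF sN xG] mean_coset[OF sN one_closed] by (simp add: lcos_mult_one[OF pG])
    finally have "2 * a (n\<^sup>2) N = \<mu> ((x <# ?H N) \<union> ?H N)" by (simp add: a_def)
    also have "\<dots> \<le> a (n\<^sup>2) N0"
    proof -
      have "x <# ?H N \<subseteq> ?H N0" using HN x(1) subgroup.m_closed[OF s0] by (auto simp: l_coset_def)
      then show ?thesis using HN unfolding a_def by (intro mean_mono pG) simp
    qed
    also have "\<dots> \<le> a (n ^ 4) N0" using n by (intro amono N0 power_increasing) auto
    also have "\<dots> < 2 * \<delta> n" by (rule N0)
    also have "\<dots> \<le> 2 * a n N" using \<delta>_le[OF N(1)] by simp
    also have "\<dots> \<le> 2 * a (n\<^sup>2) N" using amono[OF self_le_power[OF n] N(1), of 2] by simp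
    finally show False by simp
  qed
  then have "g \<in> small_classes G (n\<^sup>2)" if "g \<in> ?H N0" for g
    using that subsetD[OF pG that] by (intro small_classes_of_small_preimage[OF rf N0(1)]) auto
  then have "?H N0 \<subseteq> small_classes G (n\<^sup>2)" by blast
  moreover have "finite (rcosets (?H N0))"
    using sub[OF N0(1) order_refl] finite_index_normalsD(2,3)[OF N0(1)]
    by (blast intro: finite_rcosets_mono[of N0 "?H N0"])
  ultimately show ?thesis
    by (intro virtually_abelian_of_bounded_classes[OF rf sub[OF N0(1) order_refl, THEN conjunct1]])
qed

end

section \<open>Degree of commutativity of virtually abelian groups\<close>

context group begin

lemma virtually_abelian_normal:
  assumes "virtually_abelian G"
  obtains A where "A \<in> finite_index_normals G" "\<And>a b. \<lbrakk>a \<in> A; b \<in> A\<rbrakk> \<Longrightarrow> a \<otimes> b = b \<otimes> a"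
proof -
  obtain H where H: "subgroup H G" "finite (rcosets H)" "comm_group (G\<lparr>carrier := H\<rparr>)"
    using assms unfolding virtually_abelian_def by blast
  then obtain A where A: "A \<in> finite_index_normals G" "A \<subseteq> H"
    using exists_finite_index_normal_subset by blast
  interpret H: comm_group "G\<lparr>carrier := H\<rparr>" by (rule H(3))
  show thesis using A H.m_comm by (intro that[of A]) auto
qed

lemma rcos_representatives:
  assumes "A \<in> finite_index_normals G"
  obtains R where "finite R" "R \<subseteq> carrier G"
    "\<And>g. g \<in> carrier G \<Longrightarrow> \<exists>r\<in>R. \<exists>a\<in>A. g = a \<otimes> r"
proof -
  note A = finite_index_normalsD[OF assms]
  obtain R where R: "R \<subseteq> carrier G" "finite R" "rcosets A = (\<lambda>g. A #> g) ` R"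
    using finite_subset_image[OF A(3), of "\<lambda>g. A #> g" "carrier G"] rcosets_eq_image[of A] by auto
  have "\<exists>r\<in>R. \<exists>a\<in>A. g = a \<otimes> r" if g: "g \<in> carrier G" for g
  proof -
    have "A #> g \<in> rcosets A" using g by (rule rcosetsI[OF A(4)])
    then obtain r where "r \<in> R" "A #> g = A #> r" unfolding R(3) by blast
    then have "g \<in> A #> r" "r \<in> R" using rcos_self[OF g A(2)] by auto
    then show ?thesis by (auto simp: r_coset_def)
  qed
  with R that show thesis by blast
qed

lemma finite_conj_class_closed:
  assumes "g \<in> carrier G" "h \<in> carrier G" "finite (conj_class G g)" "finite (conj_class G h)"
  shows "finite (conj_class G (g \<otimes> h))"
  using assms by (intro finite_subset[OF conj_class_mult]) auto

text \<open>\<open>F\<close> is the FC-centre. Some finite index \<open>K\<close> inside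
  \<open>A\<close> commutes with all of \<open>F\<close>, since it centralises \<open>A\<close> and
  the finitely many coset representatives lying in \<open>F\<close>. A commutator of elements of
  \<open>F\<close> thus depends only on their cosets modulo \<open>K\<close>.\<close>

lemma finite_commutators:
  assumes A: "A \<in> finite_index_normals G" and comm: "\<And>a b. \<lbrakk>a \<in> A; b \<in> A\<rbrakk> \<Longrightarrow> a \<otimes> b = b \<otimes> a"
  defines "F \<equiv> {g \<in> carrier G. finite (conj_class G g)}"
  shows "A \<subseteq> F" and "finite ((\<lambda>(g, h). (g \<otimes> h) \<otimes> inv (h \<otimes> g)) ` (F \<times> F))"
proof -
  note A' = finite_index_normalsD[OF A]
  show AF: "A \<subseteq> F"
  proof
    fix a assume a: "a \<in> A"
    then have aG: "a \<in> carrier G" using A'(4) by blast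
    have "A \<subseteq> commuting_set G a" using comm a A'(4) by (auto simp: commuting_set_def)
    then have "finite (rcosets (commuting_set G a))"
      by (rule finite_rcosets_mono[OF A'(2) subgroup_commuting_set[OF aG] _ A'(3)])
    then show "a \<in> F" using rcosets_commuting_set(1)[OF aG] aG by (simp add: F_def)
  qed
  obtain R where R: "finite R" "R \<subseteq> carrier G"
    "\<And>g. g \<in> carrier G \<Longrightarrow> \<exists>r\<in>R. \<exists>a\<in>A. g = a \<otimes> r"
    using rcos_representatives[OF A] by blast
  have "\<forall>r\<in>R \<inter> F. \<exists>N \<in> finite_index_normals G. N \<subseteq> commuting_set G r"
    using rcosets_commuting_set(1)
    by (intro ballI exists_finite_index_normal_subset subgroup_commuting_set) (auto simp: F_def)
  then obtain c where c: "\<And>r. r \<in> R \<inter> F \<Longrightarrow> c r \<in> finite_index_normals G \<and> c r \<subseteq> commuting_set G r"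
    by metis
  have "finite (R \<inter> F)" using R(1) by simp
  then obtain K0 where K0: "K0 \<in> finite_index_normals G" "\<And>r. r \<in> R \<inter> F \<Longrightarrow> K0 \<subseteq> commuting_set G r"
    using finite_index_normals_INT[of "R \<inter> F" c] c by blast
  define K where "K = K0 \<inter> A"
  have K: "K \<in> finite_index_normals G" unfolding K_def by (rule finite_index_normals_Int[OF K0(1) A])
  note K' = finite_index_normalsD[OF K]
  have central: "k \<otimes> g = g \<otimes> k" if k: "k \<in> K" and g: "g \<in> F" for k g
  proof -
    have gG: "g \<in> carrier G" using g by (simp add: F_def)
    obtain r a where ra: "r \<in> R" "a \<in> A" "g = a \<otimes> r" using R(3)[OF gG] by blast
    have G: "k \<in> carrier G" "a \<in> carrier G" "r \<in> carrier G" using k ra R(2) K'(4) A'(4) by auto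
    \<comment> \<open>The representative of a coset of \<open>A\<close> that meets \<open>F\<close>
      lies in \<open>F\<close>, because \<open>A\<close> does; so \<open>K0\<close> centralises
      it.\<close>
    have "inv a \<in> F" using AF subgroup.m_inv_closed[OF A'(2) ra(2)] by blast
    moreover have "r = inv a \<otimes> g" using ra G by (simp add: mult_inv_cancel)
    ultimately have "r \<in> F" using finite_conj_class_closed[of "inv a" g] g gG G by (simp add: F_def)
    then have "r \<otimes> k = k \<otimes> r" using K0(2) k ra(1) by (auto simp: K_def commuting_set_def)
    moreover have "a \<otimes> k = k \<otimes> a" using comm ra(2) k by (simp add: K_def)
    ultimately show ?thesis using ra(3) G by (metis m_assoc)
  qed
  have FG: "F \<subseteq> carrier G" by (auto simp: F_def)
  show "finite ((\<lambda>(g, h). (g \<otimes> h) \<otimes> inv (h \<otimes> g)) ` (F \<times> F))"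
  proof (rule finite_image_factor)
    have "(\<lambda>(g, h). (K #> g, K #> h)) ` (F \<times> F) \<subseteq> (rcosets K) \<times> (rcosets K)"
      using FG rcosetsI[OF K'(4)] by auto
    then show "finite ((\<lambda>(g, h). (K #> g, K #> h)) ` (F \<times> F))"
      by (rule finite_subset) (use K'(3) in simp)
    fix x y assume x: "x \<in> F \<times> F" and y: "y \<in> F \<times> F"
      and eq: "(\<lambda>(g, h). (K #> g, K #> h)) x = (\<lambda>(g, h). (K #> g, K #> h)) y"
    obtain g h where gh: "x = (g, h)" "g \<in> F" "h \<in> F" using x by blast
    obtain g' h' where gh': "y = (g', h')" "g' \<in> F" "h' \<in> F" using y by blast
    have *: "\<exists>k\<in>K. u = k \<otimes> v" if "K #> u = K #> v" "u \<in> F" for u v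
      using that rcos_self[OF _ K'(2), of u] FG by (auto simp: r_coset_def)
    obtain k l where k: "k \<in> K" "g = k \<otimes> g'" and l: "l \<in> K" "h = l \<otimes> h'"
      using *[of g g'] *[of h h'] eq gh gh' by auto
    have G: "g' \<in> carrier G" "h' \<in> carrier G" "k \<in> carrier G" "l \<in> carrier G"
      using gh' FG k l K'(4) by auto
    have kh: "k \<otimes> h' = h' \<otimes> k" "l \<otimes> g' = g' \<otimes> l" "k \<otimes> l = l \<otimes> k"
      using central k l gh' comm by (auto simp: K_def)
    \<comment> \<open>Both products pick up the same factor \<open>z\<close>, which commutes with
      \<open>F\<close> and cancels from the commutator.\<close>
    define p q z where "p = g' \<otimes> h'" and "q = h' \<otimes> g'" and "z = k \<otimes> l"
    have pqz: "p \<in> carrier G" "q \<in> carrier G" "z \<in> carrier G" using G by (auto simp: p_def q_def z_def)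
    have "z \<in> K" using k l subgroup.m_closed[OF K'(2)] by (simp add: z_def)
    moreover have "p \<in> F" "q \<in> F" using gh' finite_conj_class_closed by (auto simp: F_def p_def q_def)
    ultimately have "z \<otimes> p = p \<otimes> z" "z \<otimes> q = q \<otimes> z" by (simp_all add: central)
    moreover have "g \<otimes> h = z \<otimes> p" "h \<otimes> g = z \<otimes> q"
      unfolding z_def p_def q_def using k l G kh by (metis m_assoc m_closed)+
    ultimately have "(g \<otimes> h) \<otimes> inv (h \<otimes> g) = p \<otimes> inv q"
      using pqz by (simp add: inv_mult_group m_assoc mult_inv_cancel)
    then have "(g \<otimes> h) \<otimes> inv (h \<otimes> g) = (g' \<otimes> h') \<otimes> inv (h' \<otimes> g')" by (simp add: p_def q_def)
    then show "(\<lambda>(g, h). (g \<otimes> h) \<otimes> inv (h \<otimes> g)) x = (\<lambda>(g, h). (g \<otimes> h) \<otimes> inv (h \<otimes> g)) y"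
      using gh gh' by simp
  qed
qed

text \<open>Conjugation by an element \<open>b\<close> of an abelian normal subgroup \<open>A\<close> moves all elements of a coset
  \<open>A r\<close> by the same amount, since \<open>b\<^sup>-\<^sup>1 (a r) b = a (b\<^sup>-\<^sup>1 r b)\<close>; hence the classes in \<open>A r\<close> are
  separated uniformly.\<close>
lemma large_classes_in_quotient:
  assumes rf: "residually_finite G" and A: "A \<in> finite_index_normals G"
    and comm: "\<And>a b. \<lbrakk>a \<in> A; b \<in> A\<rbrakk> \<Longrightarrow> a \<otimes> b = b \<otimes> a"
  obtains N where "N \<in> finite_index_normals G"
    "\<And>M g. \<lbrakk>M \<in> finite_index_normals G; M \<subseteq> N; g \<in> carrier G; infinite (conj_class G g)\<rbrakk>
      \<Longrightarrow> n \<le> card (conj_class (G Mod M) (M #> g))"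
proof -
  note A' = finite_index_normalsD[OF A]
  obtain R where R: "finite R" "R \<subseteq> carrier G"
    "\<And>g. g \<in> carrier G \<Longrightarrow> \<exists>r\<in>R. \<exists>a\<in>A. g = a \<otimes> r"
    using rcos_representatives[OF A] by blast
  define R' where "R' = {r \<in> R. infinite (conj_class G r)}"
  define cl where "cl r = (\<lambda>b. inv b \<otimes> r \<otimes> b) ` A" for r
  \<comment> \<open>Each conjugate of \<open>r\<close> arises from the \<open>A\<close>-class
    \<open>cl r\<close> by a further conjugation with one of finitely many representatives.\<close>
  have "infinite (cl r)" if r: "r \<in> R'" for r
  proof
    assume "finite (cl r)"
    have rG: "r \<in> carrier G" using r R(2) by (auto simp: R'_def)
    have "conj_class G r \<subseteq> (\<Union>s\<in>R. (\<lambda>x. inv s \<otimes> x \<otimes> s) ` cl r)"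
    proof
      fix x assume "x \<in> conj_class G r"
      then obtain t where t: "t \<in> carrier G" "x = inv t \<otimes> r \<otimes> t" by (auto simp: conj_class_def)
      obtain s b where s: "s \<in> R" "b \<in> A" "t = b \<otimes> s" using R(3)[OF t(1)] by blast
      then have "x = inv s \<otimes> (inv b \<otimes> r \<otimes> b) \<otimes> s"
        using t rG R(2) A'(4) by (simp add: inv_mult_group m_assoc subset_iff)
      with s show "x \<in> (\<Union>s\<in>R. (\<lambda>x. inv s \<otimes> x \<otimes> s) ` cl r)" by (auto simp: cl_def)
    qed
    then have "finite (conj_class G r)" by (rule finite_subset) (use R(1) \<open>finite (cl r)\<close> in auto)
    then show False using r by (simp add: R'_def)
  qed
  then have "\<forall>r\<in>R'. \<exists>E. E \<subseteq> cl r \<and> finite E \<and> card E = n"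
    by (meson infinite_arbitrarily_large)
  then obtain E where E: "\<And>r. r \<in> R' \<Longrightarrow> E r \<subseteq> cl r \<and> finite (E r) \<and> card (E r) = n" by metis
  have clG: "cl r \<subseteq> carrier G" if "r \<in> R'" for r
    using that R(2) A'(4) by (auto simp: cl_def R'_def subset_iff)
  have "\<forall>r\<in>R'. \<exists>N \<in> finite_index_normals G. inj_on (\<lambda>x. N #> x) (E r)"
  proof
    fix r assume r: "r \<in> R'"
    then have "finite (E r)" "E r \<subseteq> carrier G" using E clG by blast+
    then show "\<exists>N \<in> finite_index_normals G. inj_on (\<lambda>x. N #> x) (E r)"
      using residually_finite_inj_on[OF rf] by metis
  qed
  then obtain c where c: "\<And>r. r \<in> R' \<Longrightarrow> c r \<in> finite_index_normals G \<and> inj_on (\<lambda>x. c r #> x) (E r)"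
    by metis
  have "finite R'" using R(1) by (simp add: R'_def)
  then obtain N where N: "N \<in> finite_index_normals G" "\<And>r. r \<in> R' \<Longrightarrow> N \<subseteq> c r"
    using finite_index_normals_INT[of R' c] c by blast
  show thesis
  proof (rule that[OF N(1)])
    fix M g assume M: "M \<in> finite_index_normals G" "M \<subseteq> N" and g: "g \<in> carrier G" "infinite (conj_class G g)"
    note M' = finite_index_normalsD[OF M(1)]
    obtain r a where ra: "r \<in> R" "a \<in> A" "g = a \<otimes> r" using R(3)[OF g(1)] by blast
    have G: "a \<in> carrier G" "r \<in> carrier G" using ra R(2) A'(4) by auto
    have "finite (conj_class G a)" using subsetD[OF finite_commutators(1)[OF A comm] ra(2)] by simp
    \<comment> \<open>If \<open>r\<close> had a finite class, so would
      \<open>g = a \<otimes> r\<close>, since elements of \<open>A\<close> have finite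
      classes.\<close>
    then have r: "r \<in> R'" using finite_conj_class_closed[OF G] g(2) ra by (auto simp: R'_def)
    have EG: "E r \<subseteq> carrier G" using E[OF r] clG[OF r] by blast
    have "inj_on (\<lambda>x. M #> (a \<otimes> x)) (E r)"
    proof (rule inj_onI)
      fix x y assume xy: "x \<in> E r" "y \<in> E r" "M #> (a \<otimes> x) = M #> (a \<otimes> y)"
      then have xyG: "x \<in> carrier G" "y \<in> carrier G" using EG by auto
      have "inv (a \<otimes> x) \<otimes> (a \<otimes> y) \<in> M" using xy xyG G rcos_eq_iff_normal[OF M'(1)] by simp
      then have "inv x \<otimes> y \<in> M" using xyG G by (simp add: inv_mult_group m_assoc mult_inv_cancel)
      then have eq: "M #> x = M #> y" using xyG rcos_eq_iff_normal[OF M'(1)] by simp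
      have "c r #> x = c r #> y"
        by (rule rcos_eq_mono[OF M'(2) _ _ xyG eq])
          (use c[OF r] N(2)[OF r] M(2) finite_index_normalsD(2) in blast)+
      then show "x = y" using c[OF r] xy by (auto dest: inj_onD)
    qed
    then have "n = card ((\<lambda>x. M #> (a \<otimes> x)) ` E r)" using E[OF r] by (simp add: card_image)
    also have "\<dots> \<le> card (conj_class (G Mod M) (M #> g))"
    proof (rule card_mono)
      have "conj_class (G Mod M) (M #> g) \<subseteq> rcosets M"
        unfolding conj_class_FactGroup[OF M'(1) g(1)] using g(1) rcosetsI[OF M'(4)] by auto
      then show "finite (conj_class (G Mod M) (M #> g))" using M'(3) by (rule finite_subset)
      show "(\<lambda>x. M #> (a \<otimes> x)) ` E r \<subseteq> conj_class (G Mod M) (M #> g)"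
      proof
        fix z assume "z \<in> (\<lambda>x. M #> (a \<otimes> x)) ` E r"
        then obtain x where x: "x \<in> E r" "z = M #> (a \<otimes> x)" by blast
        then obtain b where b: "b \<in> A" "x = inv b \<otimes> r \<otimes> b" using E[OF r] by (auto simp: cl_def)
        have bG: "b \<in> carrier G" using b(1) A'(4) by blast
        have "a \<otimes> inv b = inv b \<otimes> a" using comm ra(2) subgroup.m_inv_closed[OF A'(2) b(1)] by blast
        then have "a \<otimes> x = inv b \<otimes> g \<otimes> b" using b(2) ra(3) G bG by (metis inv_closed m_assoc m_closed)
        then show "z \<in> conj_class (G Mod M) (M #> g)"
          unfolding conj_class_FactGroup[OF M'(1) g(1)] using x(2) bG by auto
      qed
    qed
    finally show "n \<le> card (conj_class (G Mod M) (M #> g))" .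
  qed
qed

end

section \<open>Commuting density of a virtually abelian group\<close>

context coset_correct begin

text \<open>All pairs from an abelian \<open>A\<close> of finite index commute, and they already
  have product mean \<open>1 / [G : A]^2\<close>.\<close>

lemma dc_mean_pos:
  assumes "virtually_abelian G"
  shows "0 < dc_mean G \<mu>"
proof -
  obtain A where A: "A \<in> finite_index_normals G" and comm: "\<And>a b. \<lbrakk>a \<in> A; b \<in> A\<rbrakk> \<Longrightarrow> a \<otimes> b = b \<otimes> a"
    using virtually_abelian_normal[OF assms] by blast
  note A' = finite_index_normalsD[OF A]
  have "A \<in> rcosets A" by (rule subgroup.subgroup_in_rcosets[OF A'(2) is_group])
  then have "product_mean G \<mu> (rcos_preimage A {(A, A)}) = 1 / (real (card (rcosets A)))\<^sup>2"
    using product_mean_rcos_preimage[OF A, of "{(A, A)}"] by simp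
  moreover have "g \<in> A" if "g \<in> carrier G" "A #> g = A" for g
    using that rcos_self[OF that(1) A'(2)] by simp
  then have "rcos_preimage A {(A, A)} \<subseteq> Comm G"
    using comm by (auto simp: rcos_preimage_def Comm_def)
  then have "product_mean G \<mu> (rcos_preimage A {(A, A)}) \<le> dc_mean G \<mu>"
    unfolding dc_mean_def by (intro product_mean_mono) auto
  ultimately show ?thesis using A'(6) by (smt (verit) zero_less_divide_1_iff of_nat_0_less_iff zero_less_power)
qed

lemma dc_RF_le_dc_mean:
  assumes rf: "residually_finite G" and va: "virtually_abelian G"
  shows "dc_RF G \<le> dc_mean G \<mu>"
proof (rule field_le_epsilon)
  fix e :: real assume "0 < e"
  \<comment> \<open>Half of \<open>e\<close>, because rare pairs are counted once for a first and
    once for a second coordinate outside the image of \<open>F\<close>.\<close>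
  then obtain n where n: "1 / real (Suc n) < e / 2" using nat_approx_posE[of "e / 2"] by auto
  obtain A where A: "A \<in> finite_index_normals G" and comm: "\<And>a b. \<lbrakk>a \<in> A; b \<in> A\<rbrakk> \<Longrightarrow> a \<otimes> b = b \<otimes> a"
    using virtually_abelian_normal[OF va] by blast
  define F where "F = {g \<in> carrier G. finite (conj_class G g)}"
  note finite_commutators[OF A comm, folded F_def]
  then have AF: "A \<subseteq> F" and fin: "finite ((\<lambda>(g, h). (g \<otimes> h) \<otimes> inv (h \<otimes> g)) ` (F \<times> F))" by auto
  obtain N1 where N1: "N1 \<in> finite_index_normals G"
    "N1 \<inter> (\<lambda>(g, h). (g \<otimes> h) \<otimes> inv (h \<otimes> g)) ` (F \<times> F) \<subseteq> {\<one>}"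
    by (rule residually_finite_separate[OF rf fin]) (auto simp: F_def)
  obtain N2 where N2: "N2 \<in> finite_index_normals G"
    "\<And>M g. \<lbrakk>M \<in> finite_index_normals G; M \<subseteq> N2; g \<in> carrier G; infinite (conj_class G g)\<rbrakk>
      \<Longrightarrow> Suc n \<le> card (conj_class (G Mod M) (M #> g))"
    using large_classes_in_quotient[OF rf A comm, of "Suc n"] by blast
  \<comment> \<open>\<open>N1\<close> detects nontrivial commutators of \<open>F\<close>,
    \<open>N2\<close> keeps infinite classes large, and \<open>A\<close> ensures that the preimage
    of the image of \<open>F\<close> is \<open>F\<close> itself.\<close>
  define N where "N = N1 \<inter> N2 \<inter> A"
  have N: "N \<in> finite_index_normals G" unfolding N_def by (intro finite_index_normals_Int N1 N2 A)
  have NN2: "N \<subseteq> N2" by (auto simp: N_def)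
  note N' = finite_index_normalsD[OF N]
  interpret Q: group "G Mod N" using N'(1) by (rule normal.factorgroup_is_group)
  let ?q = "real (card (rcosets N))"
  define T where "T = Comm (G Mod N)"
  define \<phi> where "\<phi> = (\<lambda>g. N #> g) ` F"
  have TN: "T \<subseteq> (rcosets N) \<times> (rcosets N)" unfolding T_def by (rule Comm_FactGroup_subset)
  then have finT: "finite T" by (rule finite_subset) (use N' in auto)
  have in_F: "g \<in> F" if g: "g \<in> carrier G" and \<phi>: "N #> g \<in> \<phi>" for g
  proof -
    obtain f where f: "f \<in> F" "N #> g = N #> f" using \<phi> by (auto simp: \<phi>_def)
    then have "g \<in> N #> f" using rcos_self[OF g N'(2)] by simp
    then obtain a where a: "a \<in> N" "g = a \<otimes> f" by (auto simp: r_coset_def)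
    then have "a \<in> F" using AF by (auto simp: N_def)
    then show ?thesis using a f finite_conj_class_closed[of a f] by (simp add: F_def)
  qed
  define P where "P = {(C, D) \<in> T. C \<notin> \<phi>}"
  define TF where "TF = T \<inter> \<phi> \<times> \<phi>"
  have "P \<subseteq> T" by (auto simp: P_def)
  then have finP: "finite P" using finT finite_subset by blast
  \<comment> \<open>\<open>T\<close> is symmetric, so a pair whose second coordinate lies outside
    \<open>\<phi>\<close> is the swap of one in \<open>P\<close>.\<close>
  have "T \<subseteq> TF \<union> P \<union> prod.swap ` P"
  proof
    fix z assume z: "z \<in> T"
    then obtain C D where CD: "z = (C, D)" "(C, D) \<in> T" "(D, C) \<in> T" by (auto simp: T_def Comm_def)
    then show "z \<in> TF \<union> P \<union> prod.swap ` P"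
      by (cases "C \<in> \<phi>"; cases "D \<in> \<phi>") (auto simp: TF_def P_def image_iff)
  qed
  then have "card T \<le> card (TF \<union> P \<union> prod.swap ` P)"
    using finP finT by (intro card_mono) (auto simp: TF_def)
  also have "\<dots> \<le> card TF + card P + card (prod.swap ` P)"
    by (intro card_Un_le[THEN order_trans] add_mono) auto
  also have "\<dots> \<le> card TF + card P + card P" using finP by (intro add_mono card_image_le) auto
  finally have T_le: "real (card T) \<le> real (card TF) + 2 * real (card P)" by simp
  have P_le: "real (card P) \<le> ?q\<^sup>2 / Suc n"
  proof -
    have "P \<subseteq> Sigma (rcosets N - \<phi>) (commuting_set (G Mod N))"
      using TN by (auto simp: P_def T_def Comm_def commuting_set_def)
    moreover have "finite (rcosets N - \<phi>)" using N'(3) by simp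
    moreover have finc: "finite (commuting_set (G Mod N) C)" for C
      by (rule finite_subset[OF _ N'(3)]) (auto simp: commuting_set_def carrier_FactGroup_rcosets)
    ultimately have "card P \<le> (\<Sum>C\<in>rcosets N - \<phi>. card (commuting_set (G Mod N) C))"
      by (metis card_SigmaI card_mono finite_SigmaI)
    then have "real (card P) \<le> (\<Sum>C\<in>rcosets N - \<phi>. real (card (commuting_set (G Mod N) C)))"
      by (simp flip: of_nat_sum)
    also have "\<dots> \<le> (\<Sum>C\<in>rcosets N - \<phi>. ?q / Suc n)"
    proof (rule sum_mono)
      fix C assume C: "C \<in> rcosets N - \<phi>"
      then obtain g where g: "g \<in> carrier G" "C = N #> g" by (auto simp: RCOSETS_def)
      then have "infinite (conj_class G g)" using C by (auto simp: \<phi>_def F_def)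
      then have "Suc n \<le> card (conj_class (G Mod N) C)" using N2(2)[OF N NN2 g(1)] g(2) by simp
      moreover have "card (conj_class (G Mod N) C) * card (commuting_set (G Mod N) C) = card (rcosets N)"
        using Q.card_commuting_set[of C] C N'(3) by (simp add: carrier_FactGroup_rcosets)
      ultimately have "Suc n * card (commuting_set (G Mod N) C) \<le> card (rcosets N)"
        by (metis mult_le_mono1)
      then have "real (Suc n) * real (card (commuting_set (G Mod N) C)) \<le> ?q" by (metis of_nat_le_iff of_nat_mult)
      then show "real (card (commuting_set (G Mod N) C)) \<le> ?q / Suc n" by (simp add: field_simps)
    qed
    also have "\<dots> = card (rcosets N - \<phi>) * (?q / Suc n)" by simp
    also have "\<dots> \<le> ?q * (?q / Suc n)"
      using N'(3) by (intro mult_right_mono) (auto intro: card_mono)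
    finally show ?thesis by (simp add: power2_eq_square)
  qed
  \<comment> \<open>Commuting modulo \<open>N\<close> puts the commutator into \<open>N1\<close>,
    where the only commutator of elements of \<open>F\<close> is one.\<close>
  have "rcos_preimage N TF \<subseteq> Comm G"
  proof
    fix z assume "z \<in> rcos_preimage N TF"
    then obtain g h where gh: "z = (g, h)" "g \<in> carrier G" "h \<in> carrier G"
      "(N #> g, N #> h) \<in> T" "N #> g \<in> \<phi>" "N #> h \<in> \<phi>"
      by (auto simp: rcos_preimage_def TF_def)
    have "N #> (g \<otimes> h) = N #> (h \<otimes> g)"
      using gh Comm_FactGroup_iff[OF N'(1)] by (simp add: T_def)
    then have "(g \<otimes> h) \<otimes> inv (h \<otimes> g) \<in> N1" using gh rcos_eq_iff[OF N'(2)] by (simp add: N_def)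
    moreover have "g \<in> F" "h \<in> F" using in_F gh by auto
    ultimately have "(g \<otimes> h) \<otimes> inv (h \<otimes> g) = \<one>" using N1(2) by force
    then have "g \<otimes> h = h \<otimes> g" using gh by (metis inv_equality inv_closed inv_inv m_closed)
    then show "z \<in> Comm G" using gh by (simp add: Comm_def)
  qed
  then have "product_mean G \<mu> (rcos_preimage N TF) \<le> dc_mean G \<mu>"
    unfolding dc_mean_def by (intro product_mean_mono) auto
  then have TF_le: "real (card TF) / ?q\<^sup>2 \<le> dc_mean G \<mu>"
    using product_mean_rcos_preimage[OF N, of TF] TN by (simp add: TF_def le_infI1)
  have q: "?q > 0" using N'(6) by simp
  have "dc_RF G \<le> real (card T) / ?q\<^sup>2" using dc_RF_le[OF N] by (simp add: dc_FactGroup T_def)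
  also have "\<dots> \<le> (real (card TF) + 2 * (?q\<^sup>2 / Suc n)) / ?q\<^sup>2"
    using T_le P_le by (intro divide_right_mono) auto
  also have "\<dots> = real (card TF) / ?q\<^sup>2 + 2 / Suc n" using q by (simp add: add_divide_distrib)
  also have "\<dots> \<le> dc_mean G \<mu> + e" using TF_le n by simp
  finally show "dc_RF G \<le> dc_mean G \<mu> + e" .
qed

lemma dc_mean_eq_dc_RF:
  assumes "residually_finite G"
  shows "dc_mean G \<mu> = dc_RF G"
proof (rule antisym)
  show "dc_mean G \<mu> \<le> dc_RF G"
    unfolding dc_RF_def using carrier_finite_index_normal dc_mean_le_dc_FactGroup
    by (intro cINF_greatest) auto
  show "dc_RF G \<le> dc_mean G \<mu>"
    \<comment> \<open>When \<open>dc_RF G\<close> is not positive, it lies below the nonnegative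
      \<open>dc_mean G \<mu>\<close>.\<close>
    using dc_RF_le_dc_mean[OF assms] dc_RF_pos_imp_virtually_abelian[OF assms] dc_mean_nonneg
    by (cases "0 < dc_RF G") auto
qed

end

lemma (in group) dc_CCM_eq:
  assumes "residually_finite G"
  shows "dc_CCM G = dc_RF G"
proof -
  have "{dc_mean G \<mu> | \<mu>. coset_correct_mean G \<mu>} = {dc_RF G}"
    using coset_correct.dc_mean_eq_dc_RF[OF _ assms] coset_correct_mean_exists
    unfolding coset_correct_iff[OF is_group] by force
  then show ?thesis unfolding dc_CCM_def by auto
qed

section \<open>Regular Borel measures from contents on clopen sets\<close>

text \<open>The clopen sets generate only the Baire sets, which may be fewer than the Borel sets in a space
  without a countable base. So the measure is built from its values on all open sets, instead of
  extending the content by Caratheodory's theorem.\<close>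
locale clopen_content =
  fixes T :: "'x topology" and B :: "'x set set" and m :: "'x set \<Rightarrow> real"
  assumes compact: "compact_space T"
    and openin_B: "V \<in> B \<Longrightarrow> openin T V"
    and top_B: "topspace T \<in> B"
    and Un_B: "\<lbrakk>V \<in> B; W \<in> B\<rbrakk> \<Longrightarrow> V \<union> W \<in> B"
    and Diff_B: "\<lbrakk>V \<in> B; W \<in> B\<rbrakk> \<Longrightarrow> V - W \<in> B"
    and base: "\<lbrakk>openin T U; x \<in> U\<rbrakk> \<Longrightarrow> \<exists>V\<in>B. x \<in> V \<and> V \<subseteq> U"
    and content_nonneg: "V \<in> B \<Longrightarrow> 0 \<le> m V"
    and content_top: "m (topspace T) = 1"
    and content_Un: "\<lbrakk>V \<in> B; W \<in> B; V \<inter> W = {}\<rbrakk> \<Longrightarrow> m (V \<union> W) = m V + m W"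
begin

abbreviation "\<Omega> \<equiv> topspace T"

definition inner_content :: "'x set \<Rightarrow> ennreal" where
  "inner_content U = (SUP V\<in>{V \<in> B. V \<subseteq> U}. ennreal (m V))"

definition outer_content :: "'x set \<Rightarrow> ennreal" where
  "outer_content E = (INF U\<in>{U. openin T U \<and> E \<subseteq> U}. inner_content U)"

definition content_measure :: "'x measure" where
  "content_measure = measure_of \<Omega> {U. openin T U} outer_content"

lemma B_subset: "V \<in> B \<Longrightarrow> V \<subseteq> \<Omega>"
  using openin_B openin_subset by blast

lemma empty_B: "{} \<in> B"
  using Diff_B[OF top_B top_B] by simp

lemma content_empty: "m {} = 0"
  using content_Un[OF empty_B empty_B] by simp

lemma content_mono: "\<lbrakk>V \<in> B; W \<in> B; V \<subseteq> W\<rbrakk> \<Longrightarrow> m V \<le> m W"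
  using content_Un[of V "W - V"] Diff_B content_nonneg[of "W - V"] by (simp add: Un_absorb1)

lemma content_subadd:
  assumes "V \<in> B" "W \<in> B"
  shows "m (V \<union> W) \<le> m V + m W"
  using content_Un[of V "W - V"] content_mono[of "W - V" W] Diff_B assms by simp

lemma UN_B: "\<lbrakk>finite I; \<And>i. i \<in> I \<Longrightarrow> W i \<in> B\<rbrakk> \<Longrightarrow> (\<Union>i\<in>I. W i) \<in> B"
  by (induction I rule: finite_induct) (auto simp: empty_B intro: Un_B)

lemma content_UN: "\<lbrakk>finite I; \<And>i. i \<in> I \<Longrightarrow> W i \<in> B\<rbrakk> \<Longrightarrow> m (\<Union>i\<in>I. W i) \<le> (\<Sum>i\<in>I. m (W i))"
proof (induction I rule: finite_induct)
  case (insert i I)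
  have "m (W i \<union> (\<Union>i\<in>I. W i)) \<le> m (W i) + m (\<Union>i\<in>I. W i)"
    using insert by (intro content_subadd UN_B) auto
  then show ?case using insert by fastforce
qed (simp add: content_empty)

lemma compactin_B: "V \<in> B \<Longrightarrow> compactin T V"
proof -
  assume V: "V \<in> B"
  have "closedin T V"
    unfolding closedin_def using B_subset[OF V] openin_B[OF Diff_B[OF top_B V]] by simp
  then show ?thesis using compact by (rule closedin_compact_space[rotated])
qed

lemma compact_between:
  assumes C: "compactin T C" and U: "openin T U" "C \<subseteq> U"
  obtains V where "V \<in> B" "C \<subseteq> V" "V \<subseteq> U"
proof -
  have "\<exists>\<F>. finite \<F> \<and> \<F> \<subseteq> {V \<in> B. V \<subseteq> U} \<and> C \<subseteq> \<Union>\<F>"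
    using base[OF U(1)] U(2) openin_B by (intro compactinD[OF C]) blast+
  then obtain \<F> where "finite \<F>" "\<F> \<subseteq> {V \<in> B. V \<subseteq> U}" "C \<subseteq> \<Union>\<F>" by blast
  then show thesis using UN_B[of \<F> id] by (intro that[of "\<Union>\<F>"]) auto
qed

lemma inner_content_mono: "U \<subseteq> U' \<Longrightarrow> inner_content U \<le> inner_content U'"
  unfolding inner_content_def by (rule SUP_subset_mono) auto

lemma inner_content_upper: "\<lbrakk>V \<in> B; V \<subseteq> U\<rbrakk> \<Longrightarrow> ennreal (m V) \<le> inner_content U"
  unfolding inner_content_def by (rule SUP_upper) auto

lemma inner_content_B: "V \<in> B \<Longrightarrow> inner_content V = ennreal (m V)"
  by (rule antisym, unfold inner_content_def, rule SUP_least)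
    (auto intro: ennreal_leI content_mono SUP_upper)

lemma inner_content_le_1: "inner_content U \<le> 1"
  unfolding inner_content_def
  using content_mono[OF _ top_B B_subset] by (intro SUP_least) (auto simp: content_top)

text \<open>A clopen \<open>V\<close> in the union is compact, so finitely many basic clopen sets,
  each inside some \<open>U i\<close>, cover it; finite subadditivity of the content does the
  rest.\<close>

lemma inner_content_UN:
  fixes U :: "nat \<Rightarrow> 'x set"
  assumes U: "\<And>i. openin T (U i)"
  shows "inner_content (\<Union>i. U i) \<le> (\<Sum>i. inner_content (U i))"
  unfolding inner_content_def[of "\<Union>i. U i"]
proof (rule SUP_least)
  fix V assume "V \<in> {V \<in> B. V \<subseteq> (\<Union>i. U i)}"
  then have V: "V \<in> B" "V \<subseteq> (\<Union>i. U i)" by auto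
  have "\<exists>\<F>. finite \<F> \<and> \<F> \<subseteq> {W \<in> B. \<exists>i. W \<subseteq> U i} \<and> V \<subseteq> \<Union>\<F>"
  proof (rule compactinD[OF compactin_B[OF V(1)]])
    show "V \<subseteq> \<Union>{W \<in> B. \<exists>i. W \<subseteq> U i}"
    proof
      fix x assume "x \<in> V"
      then obtain i where "x \<in> U i" using V(2) by blast
      then show "x \<in> \<Union>{W \<in> B. \<exists>i. W \<subseteq> U i}" using base[OF U] by blast
    qed
  qed (auto intro: openin_B)
  then obtain \<F> where \<F>: "finite \<F>" "\<F> \<subseteq> {W \<in> B. \<exists>i. W \<subseteq> U i}" "V \<subseteq> \<Union>\<F>" by blast
  have "\<forall>W\<in>\<F>. \<exists>i. W \<in> B \<and> W \<subseteq> U i" using \<F>(2) by blast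
  then obtain i where i: "\<And>W. W \<in> \<F> \<Longrightarrow> W \<in> B \<and> W \<subseteq> U (i W)"
    by metis
  define J where "J = i ` \<F>"
  \<comment> \<open>Members of the subcover assigned to the same index are merged, so that each
    \<open>U j\<close> is charged only once.\<close>
  define W where "W j = (\<Union>X\<in>{X \<in> \<F>. i X = j}. X)" for j
  have J: "finite J" using \<F>(1) by (simp add: J_def)
  have WB: "W j \<in> B" for j unfolding W_def by (rule UN_B) (use \<F>(1) i in auto)
  have WU: "W j \<subseteq> U j" for j unfolding W_def using i by (intro UN_least) auto
  have "\<Union>\<F> \<subseteq> (\<Union>j\<in>J. W j)"
  proof (rule Union_least)
    fix X assume X: "X \<in> \<F>"
    then have "X \<subseteq> W (i X)" by (auto simp: W_def)
    also have "\<dots> \<subseteq> (\<Union>j\<in>J. W j)" using X by (intro UN_upper) (simp add: J_def)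
    finally show "X \<subseteq> (\<Union>j\<in>J. W j)" .
  qed
  with \<F>(3) have "V \<subseteq> (\<Union>j\<in>J. W j)" by (rule order_trans)
  then have "m V \<le> m (\<Union>j\<in>J. W j)" by (rule content_mono[OF V(1) UN_B[OF J WB]])
  also have "\<dots> \<le> (\<Sum>j\<in>J. m (W j))" by (rule content_UN[OF J WB])
  finally have "ennreal (m V) \<le> (\<Sum>j\<in>J. ennreal (m (W j)))"
    using content_nonneg[OF WB] by (simp add: sum_ennreal ennreal_leI)
  also have "\<dots> \<le> (\<Sum>j\<in>J. inner_content (U j))"
    by (intro sum_mono inner_content_upper WB WU)
  also have "\<dots> \<le> (\<Sum>i. inner_content (U i))" using J by (intro sum_le_suminf) auto
  finally show "ennreal (m V) \<le> (\<Sum>i. inner_content (U i))" .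
qed

lemma outer_content_openin: "openin T U \<Longrightarrow> outer_content U = inner_content U"
  unfolding outer_content_def
  by (rule antisym) (auto intro: INF_lower2 INF_greatest inner_content_mono)

lemma outer_content_mono: "E \<subseteq> E' \<Longrightarrow> outer_content E \<le> outer_content E'"
  unfolding outer_content_def by (rule INF_superset_mono) auto

lemma outer_content_lower: "\<lbrakk>openin T U; E \<subseteq> U\<rbrakk> \<Longrightarrow> outer_content E \<le> inner_content U"
  unfolding outer_content_def by (rule INF_lower) auto

lemma outer_content_approx:
  assumes "E \<subseteq> \<Omega>" "0 < e"
  obtains U where "openin T U" "E \<subseteq> U" "inner_content U \<le> outer_content E + ennreal e"
proof -
  have "outer_content E \<le> 1"
    using outer_content_lower[OF openin_topspace assms(1)] inner_content_le_1 by (rule order_trans)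
  then have "outer_content E < top_class.top" by (rule le_less_trans) simp
  then have "outer_content E < outer_content E + ennreal e"
    using assms(2) by (cases "outer_content E" rule: ennreal_cases) (simp_all add: ennreal_less_iff flip: ennreal_plus)
  then have "(INF U\<in>{U. openin T U \<and> E \<subseteq> U}. inner_content U) < outer_content E + ennreal e"
    by (simp only: outer_content_def[of E, symmetric])
  then show thesis using that unfolding INF_less_iff by (auto intro: less_imp_le)
qed

section \<open>The Borel measure generated by the content\<close>

lemma outer_measure_space_outer_content: "outer_measure_space (Pow \<Omega>) outer_content"
  unfolding outer_measure_space_def
proof (intro conjI)
  show "positive (Pow \<Omega>) outer_content"
    using outer_content_openin[OF openin_empty] inner_content_B[OF empty_B]
    by (simp add: positive_def content_empty)
  show "increasing (Pow \<Omega>) outer_content" by (simp add: increasing_def outer_content_mono)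
  show "countably_subadditive (Pow \<Omega>) outer_content"
    unfolding countably_subadditive_def
  proof (intro allI impI)
    fix A :: "nat \<Rightarrow> 'x set" assume A: "range A \<subseteq> Pow \<Omega>"
    show "outer_content (\<Union>i. A i) \<le> (\<Sum>i. outer_content (A i))"
    proof (rule ennreal_le_epsilon)
      fix e :: real assume "0 < e"
      have "\<exists>U. openin T U \<and> A i \<subseteq> U \<and> inner_content U \<le> outer_content (A i) + ennreal (e * (1/2) ^ Suc i)" for i
      proof -
        have "A i \<subseteq> \<Omega>" "0 < e * (1/2) ^ Suc i" using A \<open>0 < e\<close> by auto
        then show ?thesis by (rule outer_content_approx) blast
      qed
      then obtain U where U: "\<And>i. openin T (U i)" "\<And>i. A i \<subseteq> U i"
        "\<And>i. inner_content (U i) \<le> outer_content (A i) + ennreal (e * (1/2) ^ Suc i)"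
        by metis
      have "outer_content (\<Union>i. A i) \<le> inner_content (\<Union>i. U i)"
        using U(1,2) by (intro outer_content_lower openin_Union) blast+
      also have "\<dots> \<le> (\<Sum>i. inner_content (U i))" by (rule inner_content_UN[OF U(1)])
      also have "\<dots> \<le> (\<Sum>i. outer_content (A i) + ennreal (e * (1/2) ^ Suc i))"
        by (intro suminf_le U(3)) auto
      also have "\<dots> = (\<Sum>i. outer_content (A i)) + (\<Sum>i. ennreal (e * (1/2) ^ Suc i))"
        by (rule suminf_add[symmetric]) auto
      also have "(\<Sum>i. ennreal (e * (1/2) ^ Suc i)) = ennreal (e * 1)"
        using \<open>0 < e\<close> by (intro suminf_ennreal_eq sums_mult power_half_series) simp
      finally show "outer_content (\<Union>i. A i) \<le> (\<Sum>i. outer_content (A i)) + ennreal e" by simp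
    qed
  qed
qed

text \<open>Exhaust \<open>W \<inter> U\<close> by a clopen \<open>V\<close>. Since \<open>V\<close>
  is closed, \<open>W - V\<close> is open, and it contains \<open>W - U\<close>. A clopen
  \<open>V'\<close> in \<open>W - V\<close> is disjoint from \<open>V\<close>, so the two contents
  add up to at most that of \<open>W\<close>.\<close>

lemma openin_lambda_system:
  assumes U: "openin T U"
  shows "U \<in> lambda_system \<Omega> (Pow \<Omega>) outer_content"
proof -
  note oms = outer_measure_space_outer_content[unfolded outer_measure_space_def]
  have split: "outer_content (X \<inter> U) + outer_content (X - U) \<le> outer_content X" if X: "X \<subseteq> \<Omega>" for X
    unfolding outer_content_def[of X]
  proof (rule INF_greatest)
    fix W assume "W \<in> {W. openin T W \<and> X \<subseteq> W}"
    then have W: "openin T W" "X \<subseteq> W" by auto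
    have WU: "openin T (W \<inter> U)" using W U by blast
    have "outer_content (X \<inter> U) + outer_content (X - U) \<le> inner_content (W \<inter> U) + outer_content (W - U)"
      using outer_content_lower[OF WU, of "X \<inter> U"] outer_content_mono[of "X - U" "W - U"] W
      by (intro add_mono) auto
    also have "\<dots> = (SUP V\<in>{V \<in> B. V \<subseteq> W \<inter> U}. ennreal (m V) + outer_content (W - U))"
      unfolding inner_content_def[of "W \<inter> U"] using empty_B by (subst ennreal_SUP_add_left) auto
    also have "\<dots> \<le> inner_content W"
    proof (rule SUP_least)
      fix V assume "V \<in> {V \<in> B. V \<subseteq> W \<inter> U}"
      then have V: "V \<in> B" "V \<subseteq> W" "V \<subseteq> U" by auto
      have "W - V = W \<inter> (\<Omega> - V)" using openin_subset[OF W(1)] by auto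
      then have WV: "openin T (W - V)" using W(1) openin_B[OF Diff_B[OF top_B V(1)]] by auto
      have "ennreal (m V) + outer_content (W - U) \<le> ennreal (m V) + inner_content (W - V)"
        using V by (intro add_left_mono outer_content_lower[OF WV]) auto
      also have "\<dots> = (SUP V'\<in>{V' \<in> B. V' \<subseteq> W - V}. ennreal (m V) + ennreal (m V'))"
        unfolding inner_content_def[of "W - V"] using empty_B by (subst ennreal_SUP_add_right) auto
      also have "\<dots> \<le> inner_content W"
      proof (rule SUP_least)
        fix V' assume "V' \<in> {V' \<in> B. V' \<subseteq> W - V}"
        then have V': "V' \<in> B" "V' \<subseteq> W" "V \<inter> V' = {}" by auto
        have "ennreal (m V) + ennreal (m V') = ennreal (m (V \<union> V'))"
          using V V' content_nonneg by (simp add: content_Un ennreal_plus)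
        also have "\<dots> \<le> inner_content W" using V V' by (intro inner_content_upper Un_B) auto
        finally show "ennreal (m V) + ennreal (m V') \<le> inner_content W" .
      qed
      finally show "ennreal (m V) + outer_content (W - U) \<le> inner_content W" .
    qed
    finally show "outer_content (X \<inter> U) + outer_content (X - U) \<le> inner_content W" .
  qed
  have sub: "outer_content X \<le> outer_content (X \<inter> U) + outer_content (X - U)" if X: "X \<subseteq> \<Omega>" for X
  proof -
    have "subadditive (Pow \<Omega>) outer_content"
      using oms by (intro ring_of_sets.countably_subadditive_subadditive[OF ring_of_sets_Pow]) auto
    then have "outer_content ((X \<inter> U) \<union> (X - U)) \<le> outer_content (X \<inter> U) + outer_content (X - U)"
      using X by (intro subadditiveD) auto
    then show ?thesis by (simp add: Int_Diff_Un)
  qed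
  show ?thesis
    using openin_subset[OF U] split sub by (auto simp: algebra.lambda_system_eq[OF algebra_Pow] intro: antisym)
qed

lemma space_content_measure: "space content_measure = \<Omega>"
  and sets_content_measure: "sets content_measure = sigma_sets \<Omega> {U. openin T U}"
  unfolding content_measure_def using openin_subset by (auto intro!: space_measure_of sets_measure_of)

text \<open>The sets that split \<open>outer_content\<close> additively form a sigma-algebra
  containing the open sets, so the Caratheodory measure restricts to the Borel sets.\<close>

lemma emeasure_content_measure:
  assumes "A \<in> sets content_measure"
  shows "emeasure content_measure A = outer_content A"
proof -
  let ?L = "lambda_system \<Omega> (Pow \<Omega>) outer_content"
  have ms: "measure_space \<Omega> ?L outer_content"
    by (rule sigma_algebra.caratheodory_lemma[OF sigma_algebra_Pow outer_measure_space_outer_content])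
  then interpret L: sigma_algebra \<Omega> ?L by (simp add: measure_space_def)
  have "sigma_sets \<Omega> {U. openin T U} \<subseteq> ?L"
    using openin_lambda_system by (intro L.sigma_sets_subset) auto
  moreover have "sigma_algebra \<Omega> (sigma_sets \<Omega> {U. openin T U})"
    using openin_subset by (intro sigma_algebra_sigma_sets) auto
  ultimately have ms': "measure_space \<Omega> (sigma_sets \<Omega> {U. openin T U}) outer_content"
    using measure_down[OF ms] by blast
  show ?thesis
    by (rule emeasure_measure_of[OF content_measure_def])
      (use ms' assms openin_subset in \<open>auto simp: measure_space_def sets_content_measure\<close>)
qed

lemma prob_space_content_measure: "prob_space content_measure"
proof
  have "\<Omega> \<in> sets content_measure" using sets.top[of content_measure] by (simp add: space_content_measure)
  then show "emeasure content_measure (space content_measure) = 1"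
    using emeasure_content_measure outer_content_openin[OF openin_topspace] inner_content_B[OF top_B]
    by (simp add: space_content_measure content_top)
qed

lemma openin_sets: "openin T U \<Longrightarrow> U \<in> sets content_measure"
  by (simp add: sets_content_measure sigma_sets.Basic)

lemma closedin_sets: "closedin T C \<Longrightarrow> C \<in> sets content_measure"
  using sets.compl_sets[OF openin_sets[of "\<Omega> - C"]] closedin_subset[of T C]
  by (simp add: closedin_def space_content_measure double_diff)

lemma content_measure_outer_regular:
  assumes "A \<in> sets content_measure"
  shows "emeasure content_measure A = (INF U\<in>{U. openin T U \<and> A \<subseteq> U}. emeasure content_measure U)"
  unfolding emeasure_content_measure[OF assms] outer_content_def
  by (intro INF_cong) (auto simp: emeasure_content_measure openin_sets outer_content_openin)

text \<open>The complement of an open set that barely exceeds the complement of \<open>A\<close> is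
  closed, hence compact, and barely smaller than \<open>A\<close>.\<close>

lemma content_measure_inner_regular:
  assumes A: "A \<in> sets content_measure"
  shows "emeasure content_measure A
    = (SUP C\<in>{C. compactin T C \<and> C \<in> sets content_measure \<and> C \<subseteq> A}. emeasure content_measure C)"
proof (rule antisym)
  interpret prob_space content_measure by (rule prob_space_content_measure)
  show "emeasure content_measure A
    \<le> (SUP C\<in>{C. compactin T C \<and> C \<in> sets content_measure \<and> C \<subseteq> A}. emeasure content_measure C)"
  proof (rule ennreal_le_epsilon)
    fix e :: real assume "0 < e"
    have AO: "\<Omega> - A \<in> sets content_measure" using sets.compl_sets[OF A] by (simp add: space_content_measure)
    obtain U where U: "openin T U" "\<Omega> - A \<subseteq> U" "inner_content U \<le> outer_content (\<Omega> - A) + ennreal e"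
      using outer_content_approx[of "\<Omega> - A", OF _ \<open>0 < e\<close>] by blast
    then have "emeasure content_measure U \<le> emeasure content_measure (\<Omega> - A) + ennreal e"
      using emeasure_content_measure[OF openin_sets[OF U(1)]] emeasure_content_measure[OF AO]
      by (simp add: outer_content_openin)
    then have "prob U \<le> prob (\<Omega> - A) + e"
      using \<open>0 < e\<close> by (simp add: emeasure_eq_measure flip: ennreal_plus)
    moreover have "prob (\<Omega> - U) = 1 - prob U" "prob (\<Omega> - A) = 1 - prob A"
      using prob_compl[OF openin_sets[OF U(1)]] prob_compl[OF A] by (simp_all add: space_content_measure)
    ultimately have "prob A \<le> prob (\<Omega> - U) + e" by simp
    then have "emeasure content_measure A \<le> emeasure content_measure (\<Omega> - U) + ennreal e"
      using \<open>0 < e\<close> by (simp add: emeasure_eq_measure flip: ennreal_plus)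
    also have "\<dots> \<le> (SUP C\<in>{C. compactin T C \<and> C \<in> sets content_measure \<and> C \<subseteq> A}. emeasure content_measure C) + ennreal e"
    proof (intro add_right_mono SUP_upper)
      have "closedin T (\<Omega> - U)" using U(1) by blast
      then show "\<Omega> - U \<in> {C. compactin T C \<and> C \<in> sets content_measure \<and> C \<subseteq> A}"
        using U(2) closedin_sets closedin_compact_space[OF compact] by blast
    qed
    finally show "emeasure content_measure A
      \<le> (SUP C\<in>{C. compactin T C \<and> C \<in> sets content_measure \<and> C \<subseteq> A}. emeasure content_measure C) + ennreal e" .
  qed
qed (auto intro!: SUP_least emeasure_mono simp: A)

text \<open>Inner regularity and \<open>compact_between\<close> determine the measure of an open set
  from the clopen sets inside it; outer regularity then determines it on all Borel sets.\<close>

lemma content_measure_unique: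
  assumes sets: "sets M = sigma_sets \<Omega> {U. openin T U}"
    and outer: "\<And>A. A \<in> sets M \<Longrightarrow> emeasure M A = (INF U\<in>{U. openin T U \<and> A \<subseteq> U}. emeasure M U)"
    and inner: "\<And>A. A \<in> sets M \<Longrightarrow>
      emeasure M A = (SUP C\<in>{C. compactin T C \<and> C \<in> sets M \<and> C \<subseteq> A}. emeasure M C)"
    and B: "\<And>V. V \<in> B \<Longrightarrow> emeasure M V = ennreal (m V)"
  shows "M = content_measure"
proof (rule measure_eqI)
  show "sets M = sets content_measure" by (simp add: sets sets_content_measure)
  have opens: "U \<in> sets M" if "openin T U" for U using that by (simp add: sets sigma_sets.Basic)
  have U: "emeasure M U = inner_content U" if U: "openin T U" for U
  proof (rule antisym)
    show "emeasure M U \<le> inner_content U"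
      unfolding inner[OF opens[OF U]]
    proof (rule SUP_least)
      fix C assume "C \<in> {C. compactin T C \<and> C \<in> sets M \<and> C \<subseteq> U}"
      then have C: "compactin T C" "C \<subseteq> U" by auto
      obtain V where V: "V \<in> B" "C \<subseteq> V" "V \<subseteq> U" by (rule compact_between[OF C(1) U C(2)])
      have "emeasure M C \<le> emeasure M V" using V opens[OF openin_B] by (intro emeasure_mono) auto
      also have "\<dots> \<le> inner_content U" using V B inner_content_upper by simp
      finally show "emeasure M C \<le> inner_content U" .
    qed
    show "inner_content U \<le> emeasure M U"
      unfolding inner_content_def
      using opens[OF U] by (intro SUP_least) (auto simp flip: B intro: emeasure_mono)
  qed
  fix A assume A: "A \<in> sets M"
  then have "emeasure M A = outer_content A"
    unfolding outer[OF A] outer_content_def by (intro INF_cong) (auto simp: U)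
  also have "\<dots> = emeasure content_measure A"
    using A by (intro emeasure_content_measure[symmetric]) (simp add: sets sets_content_measure)
  finally show "emeasure M A = emeasure content_measure A" .
qed

lemma measure_content_measure_B: "V \<in> B \<Longrightarrow> measure content_measure V = m V"
  using emeasure_content_measure[OF openin_sets[OF openin_B]] openin_B content_nonneg
  by (simp add: measure_def outer_content_openin inner_content_B)

text \<open>Clopen sets are cofinal among the open neighbourhoods of a compact set, so a bound on
  the content of all clopen supersets passes to the closed set.\<close>

lemma content_measure_closedin_ge:
  assumes C: "closedin T C" and c: "\<And>V. \<lbrakk>V \<in> B; C \<subseteq> V\<rbrakk> \<Longrightarrow> c \<le> m V"
  shows "c \<le> measure content_measure C"
proof (rule field_le_epsilon)
  interpret prob_space content_measure by (rule prob_space_content_measure)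
  fix e :: real assume "0 < e"
  obtain U where U: "openin T U" "C \<subseteq> U" "inner_content U \<le> outer_content C + ennreal e"
    using outer_content_approx[OF closedin_subset[OF C] \<open>0 < e\<close>] by blast
  obtain V where V: "V \<in> B" "C \<subseteq> V" "V \<subseteq> U"
    using compact_between[OF closedin_compact_space[OF compact C] U(1,2)] by blast
  have "ennreal (m V) \<le> emeasure content_measure C + ennreal e"
    using inner_content_upper[OF V(1,3)] U(3) emeasure_content_measure[OF closedin_sets[OF C]]
    by (metis order_trans)
  then have "m V \<le> measure content_measure C + e"
    using \<open>0 < e\<close> by (simp add: emeasure_eq_measure add_nonneg_nonneg flip: ennreal_plus)
  then show "c \<le> measure content_measure C + e" using c[OF V(1,2)] by simp
qed

section \<open>Invariance of the measure under bijections that preserve the content\<close>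

lemma openin_B_image:
  assumes "\<And>V. V \<in> B \<Longrightarrow> \<phi> ` V \<in> B" "openin T U"
  shows "openin T (\<phi> ` U)"
proof -
  have "U = \<Union>{V \<in> B. V \<subseteq> U}" using base[OF assms(2)] by blast
  then have "\<phi> ` U = \<Union>((`) \<phi> ` {V \<in> B. V \<subseteq> U})" by (metis image_Union)
  also have "openin T \<dots>" using assms(1) openin_B by (intro openin_Union) auto
  finally show ?thesis .
qed

lemma inner_content_image:
  assumes "\<And>V. V \<in> B \<Longrightarrow> \<phi> ` V \<in> B \<and> m (\<phi> ` V) = m V"
  shows "inner_content U \<le> inner_content (\<phi> ` U)"
  unfolding inner_content_def[of U]
proof (rule SUP_least)
  fix V assume "V \<in> {V \<in> B. V \<subseteq> U}"
  then have "V \<in> B" "\<phi> ` V \<subseteq> \<phi> ` U" by auto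
  with assms inner_content_upper[of "\<phi> ` V" "\<phi> ` U"] show "ennreal (m V) \<le> inner_content (\<phi> ` U)"
    by simp
qed

lemma outer_content_image_le:
  assumes inv: "\<And>x. x \<in> \<Omega> \<Longrightarrow> \<phi> x \<in> \<Omega> \<and> \<psi> (\<phi> x) = x" "\<And>x. x \<in> \<Omega> \<Longrightarrow> \<phi> (\<psi> x) = x"
    and \<phi>: "\<And>V. V \<in> B \<Longrightarrow> \<phi> ` V \<in> B \<and> m (\<phi> ` V) = m V"
    and \<psi>: "\<And>V. V \<in> B \<Longrightarrow> \<psi> ` V \<in> B \<and> m (\<psi> ` V) = m V"
    and E: "E \<subseteq> \<Omega>"
  shows "outer_content E \<le> outer_content (\<phi> ` E)"
  unfolding outer_content_def[of "\<phi> ` E"]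
proof (rule INF_greatest)
  fix U assume "U \<in> {U. openin T U \<and> \<phi> ` E \<subseteq> U}"
  then have U: "openin T U" "\<phi> ` E \<subseteq> U" "U \<subseteq> \<Omega>" using openin_subset by auto
  have "E \<subseteq> \<psi> ` U"
  proof
    fix x assume "x \<in> E"
    then have "\<phi> x \<in> U" "x = \<psi> (\<phi> x)" using U(2) E inv(1) by auto
    then show "x \<in> \<psi> ` U" by blast
  qed
  then have "outer_content E \<le> inner_content (\<psi> ` U)"
    using \<psi> by (intro outer_content_lower openin_B_image U(1)) auto
  also have "\<dots> \<le> inner_content (\<phi> ` \<psi> ` U)" by (rule inner_content_image[OF \<phi>])
  also have "\<phi> ` \<psi> ` U = U" using inv(2) U(3) by (force simp: image_image)
  finally show "outer_content E \<le> inner_content U" .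
qed

text \<open>Open sets are unions of members of \<open>B\<close>, so the inner and outer contents
  inherit the invariance; the inequality for \<open>\<phi>\<close> and the one for
  \<open>\<psi>\<close> combine to equality. The maps are inverse only on the space, which is a
  carrier and not a type.\<close>

lemma emeasure_content_measure_image:
  assumes inv: "\<And>x. x \<in> \<Omega> \<Longrightarrow> \<phi> x \<in> \<Omega> \<and> \<psi> (\<phi> x) = x" "\<And>x. x \<in> \<Omega> \<Longrightarrow> \<psi> x \<in> \<Omega> \<and> \<phi> (\<psi> x) = x"
    and \<phi>: "\<And>V. V \<in> B \<Longrightarrow> \<phi> ` V \<in> B \<and> m (\<phi> ` V) = m V"
    and \<psi>: "\<And>V. V \<in> B \<Longrightarrow> \<psi> ` V \<in> B \<and> m (\<psi> ` V) = m V"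
    and A: "A \<in> sets content_measure"
  shows "emeasure content_measure (\<phi> ` A) = emeasure content_measure A"
proof -
  have sub: "X \<subseteq> \<Omega>" if "X \<in> sigma_sets \<Omega> {U. openin T U}" for X
    using sigma_sets_into_sp[OF _ that] openin_subset by blast
  have "\<phi> ` A \<in> sigma_sets \<Omega> {U. openin T U}"
    using A unfolding sets_content_measure
  proof (induction A rule: sigma_sets.induct)
    case (Basic U)
    then show ?case using \<phi> openin_B_image by (intro sigma_sets.Basic) auto
  next
    case (Compl X)
    have "\<phi> ` (\<Omega> - X) = \<Omega> - \<phi> ` X"
    proof (intro equalityI subsetI)
      fix y assume "y \<in> \<phi> ` (\<Omega> - X)"
      then obtain x where x: "y = \<phi> x" "x \<in> \<Omega>" "x \<notin> X" by blast
      then have "y \<notin> \<phi> ` X" using inv(1) sub[OF Compl.hyps] by (metis imageE subsetD)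
      then show "y \<in> \<Omega> - \<phi> ` X" using x inv(1) by blast
    next
      fix y assume "y \<in> \<Omega> - \<phi> ` X"
      then have "y = \<phi> (\<psi> y)" "\<psi> y \<in> \<Omega> - X" using inv(2)[of y] by force+
      then show "y \<in> \<phi> ` (\<Omega> - X)" by blast
    qed
    then show ?case using sigma_sets.Compl[OF Compl.IH] by simp
  qed (auto simp: image_UN intro: sigma_sets.intros)
  then have A': "\<phi> ` A \<in> sets content_measure" by (simp add: sets_content_measure)
  have A\<Omega>: "A \<subseteq> \<Omega>" using A sub by (simp add: sets_content_measure)
  have "outer_content E \<le> outer_content (\<phi> ` E)" if "E \<subseteq> \<Omega>" for E
    by (rule outer_content_image_le[OF inv(1) _ \<phi> \<psi> that]) (use inv(2) in auto)
  moreover have "outer_content (\<phi> ` A) \<le> outer_content (\<psi> ` \<phi> ` A)"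
    by (rule outer_content_image_le[OF inv(2) _ \<psi> \<phi>]) (use inv(1) A\<Omega> in auto)
  moreover have "\<psi> ` \<phi> ` A = A" using inv(1) A\<Omega> by (force simp: image_image)
  ultimately show ?thesis
    using emeasure_content_measure[OF A] emeasure_content_measure[OF A'] A\<Omega> by (simp add: antisym)
qed

end

section \<open>The profinite completion\<close>

context group begin

abbreviation "PC \<equiv> profinite_completion G"
abbreviation "FN \<equiv> finite_index_normals G"
abbreviation "PT \<equiv> profinite_topology G"

lemma rcos_absorb:
  assumes "subgroup N G" "subgroup M G" "N \<subseteq> M" "g \<in> carrier G"
  shows "M <#> (N #> g) = M #> g"
proof (intro equalityI subsetI)
  fix x assume "x \<in> M <#> (N #> g)"
  then obtain k n where kn: "k \<in> M" "n \<in> N" "x = k \<otimes> (n \<otimes> g)" by (auto simp: set_mult_def r_coset_def)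
  then have "k \<otimes> n \<in> M" "x = (k \<otimes> n) \<otimes> g"
    using assms subgroup.m_closed[OF assms(2)] subgroup.mem_carrier[OF assms(2)] by (auto simp: m_assoc)
  then show "x \<in> M #> g" by (auto simp: r_coset_def)
next
  fix x assume "x \<in> M #> g"
  then obtain k where "k \<in> M" "x = k \<otimes> (\<one> \<otimes> g)" using assms(4) by (auto simp: r_coset_def)
  then show "x \<in> M <#> (N #> g)"
    using subgroup.one_closed[OF assms(1)] unfolding set_mult_def r_coset_def by blast
qed

lemma profinite_coset:
  assumes "x \<in> carrier PC" "N \<in> FN"
  obtains g where "g \<in> carrier G" "x N = N #> g"
  using assms by (auto simp: profinite_completion_def carrier_FactGroup PiE_iff)

lemma profinite_absorb:
  "\<lbrakk>x \<in> carrier PC; N \<in> FN; M \<in> FN; N \<subseteq> M\<rbrakk> \<Longrightarrow> M <#> x N = x M"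
  by (auto simp: profinite_completion_def)

lemma profinite_compat:
  assumes "x \<in> carrier PC" "N \<in> FN" "M \<in> FN" "N \<subseteq> M" "g \<in> carrier G" "x N = N #> g"
  shows "x M = M #> g"
  using profinite_absorb[OF assms(1-4)] rcos_absorb[OF _ _ assms(4,5)] assms(6)
    finite_index_normalsD(2) assms(2,3) by metis

lemma profinite_ext:
  assumes "x \<in> carrier PC" "y \<in> carrier PC" "\<And>N. N \<in> FN \<Longrightarrow> x N = y N"
  shows "x = y"
  using assms by (intro extensionalityI[of _ FN]) (auto simp: profinite_completion_def PiE_iff)

text \<open>Compatibility is tested on coset representatives, which turns the set product in the
  definition of the completion into an implication between coset equations.\<close>

lemma carrier_PC_I:
  assumes "x \<in> extensional FN" "\<And>N. N \<in> FN \<Longrightarrow> \<exists>g \<in> carrier G. x N = N #> g"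
    and "\<And>N M g. \<lbrakk>N \<in> FN; M \<in> FN; N \<subseteq> M; g \<in> carrier G; x N = N #> g\<rbrakk> \<Longrightarrow> x M = M #> g"
  shows "x \<in> carrier PC"
proof -
  have "M <#> x N = x M" if "N \<in> FN" "M \<in> FN" "N \<subseteq> M" for N M
    using that assms(2)[OF that(1)] assms(3)[OF that] rcos_absorb[OF _ _ that(3)] finite_index_normalsD(2)
    by metis
  then show ?thesis
    using assms(1,2) by (auto simp: profinite_completion_def PiE_iff carrier_FactGroup image_iff)
qed

lemma profinite_embedding_closed: "g \<in> carrier G \<Longrightarrow> profinite_embedding G g \<in> carrier PC"
proof (rule carrier_PC_I)
  fix N M h assume g: "g \<in> carrier G" and *: "N \<in> FN" "M \<in> FN" "N \<subseteq> M" "h \<in> carrier G" "profinite_embedding G g N = N #> h"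
  then have "N #> g = N #> h" by (simp add: profinite_embedding_def)
  then show "profinite_embedding G g M = M #> h"
    using rcos_eq_mono[OF finite_index_normalsD(2)[OF *(1)] finite_index_normalsD(2)[OF *(2)] *(3) g *(4)] *(2)
    by (simp add: profinite_embedding_def)
qed (auto simp: profinite_embedding_def)

lemma mult_PC: "x \<otimes>\<^bsub>PC\<^esub> y = (\<lambda>N\<in>FN. x N \<otimes>\<^bsub>G Mod N\<^esub> y N)"
  by (simp add: profinite_completion_def)

lemma mult_PC_coset:
  assumes "N \<in> FN" "g \<in> carrier G" "h \<in> carrier G" "x N = N #> g" "y N = N #> h"
  shows "(x \<otimes>\<^bsub>PC\<^esub> y) N = N #> (g \<otimes> h)"
  using assms normal.rcos_sum[OF finite_index_normalsD(1)[OF assms(1)]] by (simp add: mult_PC)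

text \<open>The completion is realised as a subgroup of the product of the quotients, with inverses
  and products computed on coset representatives.\<close>

lemma group_PC: "group PC"
proof -
  let ?P = "product_group FN (\<lambda>N. G Mod N)"
  have grp: "group (G Mod N)" if "N \<in> FN" for N
    using finite_index_normalsD(1)[OF that] by (rule normal.factorgroup_is_group)
  then interpret P: group ?P by simp
  have hom: "group_hom G (G Mod N) (\<lambda>x. N #> x)" if "N \<in> FN" for N
    using grp[OF that] normal.r_coset_hom_Mod[OF finite_index_normalsD(1)[OF that]]
    by (simp add: group_hom_def group_hom_axioms_def)
  have "subgroup (carrier PC) ?P"
  proof (rule P.subgroupI)
    show "carrier PC \<subseteq> carrier ?P" by (auto simp: profinite_completion_def)
    show "carrier PC \<noteq> {}" using profinite_embedding_closed[OF one_closed] by blast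
  next
    fix x assume x: "x \<in> carrier PC"
    have eq: "inv\<^bsub>?P\<^esub> x = (\<lambda>N\<in>FN. inv\<^bsub>G Mod N\<^esub> (x N))"
      using x grp by (intro inv_product_group) (auto simp: profinite_completion_def)
    have inv: "(inv\<^bsub>?P\<^esub> x) N = N #> inv g" if "N \<in> FN" "g \<in> carrier G" "x N = N #> g" for N g
      using that group_hom.hom_inv[OF hom[OF that(1)] that(2)] by (simp add: eq)
    show "inv\<^bsub>?P\<^esub> x \<in> carrier PC"
    proof (rule carrier_PC_I)
      show "inv\<^bsub>?P\<^esub> x \<in> extensional FN" by (simp add: eq)
      show "\<exists>g\<in>carrier G. (inv\<^bsub>?P\<^esub> x) N = N #> g" if "N \<in> FN" for N
        using profinite_coset[OF x that] inv[OF that] by (metis inv_closed)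
      fix N M h assume *: "N \<in> FN" "M \<in> FN" "N \<subseteq> M" "h \<in> carrier G" "(inv\<^bsub>?P\<^esub> x) N = N #> h"
      obtain g where g: "g \<in> carrier G" "x N = N #> g" by (rule profinite_coset[OF x *(1)])
      have "x M = M #> g" by (rule profinite_compat[OF x *(1-3) g])
      then have "(inv\<^bsub>?P\<^esub> x) M = M #> inv g" by (rule inv[OF *(2) g(1)])
      moreover have "N #> inv g = N #> h" using inv[OF *(1) g] *(5) by simp
      ultimately show "(inv\<^bsub>?P\<^esub> x) M = M #> h"
        using rcos_eq_mono[OF finite_index_normalsD(2)[OF *(1)] finite_index_normalsD(2)[OF *(2)] *(3), of "inv g" h]
          g(1) *(4) by simp
    qed
    fix y assume y: "y \<in> carrier PC"
    have "x \<otimes>\<^bsub>PC\<^esub> y \<in> carrier PC"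
    proof (rule carrier_PC_I)
      show "x \<otimes>\<^bsub>PC\<^esub> y \<in> extensional FN" by (simp add: mult_PC)
      show "\<exists>g\<in>carrier G. (x \<otimes>\<^bsub>PC\<^esub> y) N = N #> g" if "N \<in> FN" for N
        using profinite_coset[OF x that] profinite_coset[OF y that] mult_PC_coset[OF that] by (metis m_closed)
      fix N M k assume *: "N \<in> FN" "M \<in> FN" "N \<subseteq> M" "k \<in> carrier G" "(x \<otimes>\<^bsub>PC\<^esub> y) N = N #> k"
      obtain g where g: "g \<in> carrier G" "x N = N #> g" by (rule profinite_coset[OF x *(1)])
      obtain h where h: "h \<in> carrier G" "y N = N #> h" by (rule profinite_coset[OF y *(1)])
      have "(x \<otimes>\<^bsub>PC\<^esub> y) M = M #> (g \<otimes> h)"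
        using mult_PC_coset[of M g h x y] *(2) g(1) h(1) profinite_compat[OF x *(1-3) g]
          profinite_compat[OF y *(1-3) h] by simp
      moreover have "N #> (g \<otimes> h) = N #> k" using mult_PC_coset[of N g h x y] *(1,5) g h by simp
      ultimately show "(x \<otimes>\<^bsub>PC\<^esub> y) M = M #> k"
        using rcos_eq_mono[OF finite_index_normalsD(2)[OF *(1)] finite_index_normalsD(2)[OF *(2)] *(3), of "g \<otimes> h" k]
          g(1) h(1) *(4) by simp
    qed
    then show "x \<otimes>\<^bsub>?P\<^esub> y \<in> carrier PC" by (simp add: mult_PC)
  qed
  then have "group (?P\<lparr>carrier := carrier PC\<rparr>)" using P.is_group by (rule subgroup.subgroup_is_group)
  moreover have "?P\<lparr>carrier := carrier PC\<rparr> = PC"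
    by (simp add: product_group_def profinite_completion_def)
  ultimately show ?thesis by simp
qed

section \<open>Topology of the profinite completion\<close>

lemma topspace_PT: "topspace PT = carrier PC"
  by (auto simp: profinite_topology_def profinite_completion_def)

lemma openin_product_coord:
  assumes "N \<in> FN"
  shows "openin (product_topology (\<lambda>N. discrete_topology (carrier (G Mod N))) FN)
    {x \<in> (\<Pi>\<^sub>E N\<in>FN. carrier (G Mod N)). x N \<in> S}"
proof -
  have "openin (product_topology (\<lambda>N. discrete_topology (carrier (G Mod N))) FN)
    {x \<in> topspace (product_topology (\<lambda>N. discrete_topology (carrier (G Mod N))) FN). x N \<in> S \<inter> carrier (G Mod N)}"
    by (rule openin_continuous_map_preimage[OF continuous_map_product_projection[OF assms]]) simp
  also have "{x \<in> topspace (product_topology (\<lambda>N. discrete_topology (carrier (G Mod N))) FN). x N \<in> S \<inter> carrier (G Mod N)}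
    = {x \<in> (\<Pi>\<^sub>E N\<in>FN. carrier (G Mod N)). x N \<in> S}"
    using assms by auto
  finally show ?thesis .
qed

lemma openin_PT_coord:
  assumes "N \<in> FN"
  shows "openin PT {x \<in> carrier PC. x N \<in> S}"
proof -
  have "{x \<in> carrier PC. x N \<in> S} = {x \<in> (\<Pi>\<^sub>E N\<in>FN. carrier (G Mod N)). x N \<in> S} \<inter> carrier PC"
    by (auto simp: profinite_completion_def)
  then show ?thesis unfolding profinite_topology_def openin_subtopology
    using openin_product_coord[OF assms] by blast
qed

text \<open>Incompatibility of a family shows in two coordinates and is thus an open condition, so
  the completion is closed in a product of finite discrete spaces.\<close>

lemma compact_space_PT: "compact_space PT"
proof -
  let ?P = "product_topology (\<lambda>N. discrete_topology (carrier (G Mod N))) FN"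
  let ?X = "\<Pi>\<^sub>E N\<in>FN. carrier (G Mod N)"
  have "compact_space ?P"
    using finite_index_normalsD(3)
    by (simp add: compact_space_product_topology compact_space_discrete_topology carrier_FactGroup_rcosets)
  moreover have "closedin ?P (carrier PC)"
  proof -
    have top: "topspace ?P = ?X" by simp
    have "?X - carrier PC = (\<Union>(N, M, C, D) \<in> {(N, M, C, D). N \<in> FN \<and> M \<in> FN \<and> N \<subseteq> M \<and> M <#> C \<noteq> D}.
      {x \<in> ?X. x N \<in> {C}} \<inter> {x \<in> ?X. x M \<in> {D}})" (is "_ = ?U")
    proof (intro equalityI subsetI)
      fix x assume "x \<in> ?X - carrier PC"
      then show "x \<in> ?U" by (auto simp: profinite_completion_def)
    next
      fix x assume "x \<in> ?U"
      then show "x \<in> ?X - carrier PC" using profinite_absorb by auto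
    qed
    moreover have "openin ?P ?U"
      by (intro openin_Union) (clarify, intro openin_Int openin_product_coord)
    ultimately show ?thesis unfolding closedin_def top by (auto simp: profinite_completion_def)
  qed
  ultimately have "compactin ?P (carrier PC)" by (rule closedin_compact_space)
  then show ?thesis by (simp add: profinite_topology_def compact_space_subtopology)
qed

text \<open>A basic open set restricts finitely many coordinates, and the coordinate at an
  \<open>N\<close> below all of them determines these.\<close>

lemma PT_base:
  assumes U: "openin PT U" "x \<in> U"
  obtains N where "N \<in> FN" "{y \<in> carrier PC. y N = x N} \<subseteq> U"
proof -
  let ?P = "product_topology (\<lambda>N. discrete_topology (carrier (G Mod N))) FN"
  obtain W where W: "openin ?P W" "U = W \<inter> carrier PC"
    using U(1) unfolding profinite_topology_def openin_subtopology by blast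
  then have x: "x \<in> W" "x \<in> carrier PC" using U(2) by auto
  obtain S where S: "finite {N \<in> FN. S N \<noteq> topspace (discrete_topology (carrier (G Mod N)))}"
    "x \<in> PiE FN S" "PiE FN S \<subseteq> W"
    using W(1)[unfolded openin_product_topology_alt, rule_format, OF x(1)] by (elim exE conjE)
  define I where "I = {N \<in> FN. S N \<noteq> carrier (G Mod N)}"
  obtain N where N: "N \<in> FN" "\<forall>M\<in>I. N \<subseteq> M"
    using finite_index_normals_INT[of I id] S(1) by (auto simp: I_def)
  have "y \<in> W" if y: "y \<in> carrier PC" "y N = x N" for y
  proof -
    have "y M \<in> S M" if M: "M \<in> FN" for M
    proof (cases "M \<in> I")
      case True
      then have "y M = x M" using N M profinite_absorb[OF y(1) N(1) M] profinite_absorb[OF x(2) N(1) M] y(2) by simp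
      then show ?thesis using S(2) M by auto
    next
      case False
      then show ?thesis using M y(1) by (auto simp: I_def profinite_completion_def)
    qed
    then have "y \<in> PiE FN S" using y(1) by (auto simp: profinite_completion_def PiE_iff)
    then show ?thesis using S(3) by blast
  qed
  then show thesis using that[OF N(1)] W(2) by blast
qed

end

section \<open>Haar measure and the theorem\<close>

context group begin

abbreviation "PC2 \<equiv> PC \<times>\<times> PC"
abbreviation "PT2 \<equiv> prod_topology PT PT"

text \<open>Both coordinates are read at one level, which suffices by directedness. \<open>S\<close>
  is arbitrary so that complements of sets of coset pairs can be used directly.\<close>

definition cylinder ::
  "'a set \<Rightarrow> ('a set \<times> 'a set) set \<Rightarrow> (('a set \<Rightarrow> 'a set) \<times> ('a set \<Rightarrow> 'a set)) set" where
  "cylinder N S = {(x, y) \<in> carrier PC \<times> carrier PC. (x N, y N) \<in> S}"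

definition cylinders :: "(('a set \<Rightarrow> 'a set) \<times> ('a set \<Rightarrow> 'a set)) set set" where
  "cylinders = {cylinder N S | N S. N \<in> FN \<and> S \<subseteq> (rcosets N) \<times> (rcosets N)}"

lemma topspace_PT2: "topspace PT2 = carrier PC2"
  by (simp add: topspace_PT)

lemma openin_cylinder:
  assumes "N \<in> FN"
  shows "openin PT2 (cylinder N S)"
proof -
  have "cylinder N S = (\<Union>(C, D)\<in>S. {x \<in> carrier PC. x N \<in> {C}} \<times> {x \<in> carrier PC. x N \<in> {D}})"
    by (auto simp: cylinder_def)
  also have "openin PT2 \<dots>"
    by (intro openin_Union) (clarify, intro openin_prod_Times_iff[THEN iffD2] disjI2 conjI openin_PT_coord assms)
  finally show ?thesis .
qed

lemma cylinder_refine: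
  assumes "N \<in> FN" "K \<in> FN" "K \<subseteq> N"
  shows "cylinder N S = cylinder K {(C, D) \<in> (rcosets K) \<times> (rcosets K). (N <#> C, N <#> D) \<in> S}"
proof -
  have "x K \<in> rcosets K" "N <#> x K = x N" if "x \<in> carrier PC" for x
    using that assms(2) profinite_absorb[OF that assms(2,1,3)]
    by (auto simp: profinite_completion_def PiE_iff carrier_FactGroup_rcosets)
  then show ?thesis by (auto simp: cylinder_def)
qed

text \<open>Refining to \<open>N \<inter> M\<close> expresses both cylinders at one level, where
  Boolean operations act on finite sets of coset pairs.\<close>

lemma cylinders_common_level:
  assumes "V \<in> cylinders" "W \<in> cylinders"
  obtains K S S' where "K \<in> FN" "S \<subseteq> (rcosets K) \<times> (rcosets K)" "S' \<subseteq> (rcosets K) \<times> (rcosets K)"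
    "V = cylinder K S" "W = cylinder K S'"
proof -
  obtain N S where N: "N \<in> FN" "V = cylinder N S" using assms(1) by (auto simp: cylinders_def)
  obtain M S' where M: "M \<in> FN" "W = cylinder M S'" using assms(2) by (auto simp: cylinders_def)
  have K: "N \<inter> M \<in> FN" by (rule finite_index_normals_Int[OF N(1) M(1)])
  show thesis
    by (rule that[OF K _ _ trans[OF N(2) cylinder_refine[OF N(1) K]] trans[OF M(2) cylinder_refine[OF M(1) K]]])
      auto
qed

lemma cylindersI: "\<lbrakk>N \<in> FN; S \<subseteq> (rcosets N) \<times> (rcosets N)\<rbrakk> \<Longrightarrow> cylinder N S \<in> cylinders"
  by (auto simp: cylinders_def)

text \<open>At level \<open>N\<close>, left multiplication by \<open>g\<close> acts through the
  coordinates of \<open>g\<close> there, a translation in the square of \<open>G Mod N\<close>,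
  which is injective.\<close>

lemma translate_cylinder:
  assumes N: "N \<in> FN" and S: "S \<subseteq> (rcosets N) \<times> (rcosets N)" and g: "g \<in> carrier PC2"
  defines "S' \<equiv> (\<lambda>(C, D). (fst g N \<otimes>\<^bsub>G Mod N\<^esub> C, snd g N \<otimes>\<^bsub>G Mod N\<^esub> D)) ` S"
  shows "(\<lambda>x. g \<otimes>\<^bsub>PC2\<^esub> x) ` cylinder N S = cylinder N S'"
    and "S' \<subseteq> (rcosets N) \<times> (rcosets N)" and "card S' = card S"
proof -
  interpret P: group PC by (rule group_PC)
  interpret Q: group "G Mod N" by (rule normal.factorgroup_is_group[OF finite_index_normalsD(1)[OF N]])
  obtain a b where ab: "g = (a, b)" "a \<in> carrier PC" "b \<in> carrier PC" using g by auto
  have coord: "x N \<in> carrier (G Mod N)" if "x \<in> carrier PC" for x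
    using that N by (auto simp: profinite_completion_def)
  have mult: "(x \<otimes>\<^bsub>PC\<^esub> y) N = x N \<otimes>\<^bsub>G Mod N\<^esub> y N" for x y using N by (simp add: mult_PC)
  have SQ: "S \<subseteq> carrier (G Mod N) \<times> carrier (G Mod N)" using S by (simp add: carrier_FactGroup_rcosets)
  show "S' \<subseteq> (rcosets N) \<times> (rcosets N)"
    unfolding carrier_FactGroup_rcosets[symmetric] S'_def
    using SQ ab coord by (auto simp del: mult_FactGroup)
  have cancel: "C = D" if "c \<in> carrier (G Mod N)" "C \<in> carrier (G Mod N)" "D \<in> carrier (G Mod N)"
    "c \<otimes>\<^bsub>G Mod N\<^esub> C = c \<otimes>\<^bsub>G Mod N\<^esub> D" for c C D
    using that by (simp del: mult_FactGroup)
  show "card S' = card S"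
    unfolding S'_def
  proof (intro card_image inj_onI)
    fix p q assume p: "p \<in> S" and q: "q \<in> S"
      and eq: "(\<lambda>(C, D). (fst g N \<otimes>\<^bsub>G Mod N\<^esub> C, snd g N \<otimes>\<^bsub>G Mod N\<^esub> D)) p
        = (\<lambda>(C, D). (fst g N \<otimes>\<^bsub>G Mod N\<^esub> C, snd g N \<otimes>\<^bsub>G Mod N\<^esub> D)) q"
    obtain C D C' D' where CD: "p = (C, D)" "q = (C', D')" by fastforce
    with p q SQ have "C \<in> carrier (G Mod N)" "D \<in> carrier (G Mod N)" "C' \<in> carrier (G Mod N)" "D' \<in> carrier (G Mod N)"
      by auto
    then show "p = q"
      using eq cancel[OF coord[OF ab(2)]] cancel[OF coord[OF ab(3)]] by (simp add: CD ab(1) del: mult_FactGroup)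
  qed
  show "(\<lambda>x. g \<otimes>\<^bsub>PC2\<^esub> x) ` cylinder N S = cylinder N S'"
  proof (intro equalityI subsetI)
    fix z assume "z \<in> (\<lambda>x. g \<otimes>\<^bsub>PC2\<^esub> x) ` cylinder N S"
    then obtain x y where xy: "x \<in> carrier PC" "y \<in> carrier PC" "(x N, y N) \<in> S"
      "z = (a \<otimes>\<^bsub>PC\<^esub> x, b \<otimes>\<^bsub>PC\<^esub> y)"
      by (auto simp: cylinder_def ab(1))
    then have "((a \<otimes>\<^bsub>PC\<^esub> x) N, (b \<otimes>\<^bsub>PC\<^esub> y) N) \<in> S'"
      unfolding S'_def mult by (intro image_eqI[of _ _ "(x N, y N)"]) (simp_all add: ab(1))
    then show "z \<in> cylinder N S'" using xy ab by (simp add: cylinder_def)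
  next
    fix z assume "z \<in> cylinder N S'"
    then obtain u v where uv: "z = (u, v)" "u \<in> carrier PC" "v \<in> carrier PC" "(u N, v N) \<in> S'"
      by (auto simp: cylinder_def)
    then obtain C D where CD: "(C, D) \<in> S" "u N = a N \<otimes>\<^bsub>G Mod N\<^esub> C" "v N = b N \<otimes>\<^bsub>G Mod N\<^esub> D"
      by (auto simp: S'_def ab(1))
    define x y where "x = inv\<^bsub>PC\<^esub> a \<otimes>\<^bsub>PC\<^esub> u" and "y = inv\<^bsub>PC\<^esub> b \<otimes>\<^bsub>PC\<^esub> v"
    have xy: "x \<in> carrier PC" "y \<in> carrier PC" "u = a \<otimes>\<^bsub>PC\<^esub> x" "v = b \<otimes>\<^bsub>PC\<^esub> y"
      using ab uv by (simp_all add: x_def y_def P.mult_inv_cancel)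
    have "x N = C" "y N = D"
      using CD SQ xy ab coord mult by (auto intro!: cancel[of "a N"] cancel[of "b N"] simp del: mult_FactGroup)
    then have "(x, y) \<in> cylinder N S" using CD xy by (simp add: cylinder_def)
    moreover have "z = g \<otimes>\<^bsub>PC2\<^esub> (x, y)" using xy uv ab by simp
    ultimately show "z \<in> (\<lambda>x. g \<otimes>\<^bsub>PC2\<^esub> x) ` cylinder N S" by blast
  qed
qed

text \<open>Failure to commute is visible in some coordinate, and each coordinate gives an open
  condition.\<close>

lemma closedin_Comm_PC: "closedin PT2 (Comm PC)"
  and Comm_PC_subset_cylinder: "N \<in> FN \<Longrightarrow> Comm PC \<subseteq> cylinder N (Comm (G Mod N))"
proof -
  interpret P: group PC by (rule group_PC)
  have coord: "x N \<in> carrier (G Mod N)" if "x \<in> carrier PC" "N \<in> FN" for x N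
    using that by (auto simp: profinite_completion_def)
  have mult: "(x \<otimes>\<^bsub>PC\<^esub> y) N = x N \<otimes>\<^bsub>G Mod N\<^esub> y N" if "N \<in> FN" for x y N
    using that by (simp add: mult_PC)
  show sub: "Comm PC \<subseteq> cylinder N (Comm (G Mod N))" if N: "N \<in> FN" for N
  proof
    fix z assume "z \<in> Comm PC"
    then obtain x y where xy: "z = (x, y)" "x \<in> carrier PC" "y \<in> carrier PC" "x \<otimes>\<^bsub>PC\<^esub> y = y \<otimes>\<^bsub>PC\<^esub> x"
      by (auto simp: Comm_def)
    then have "x N \<otimes>\<^bsub>G Mod N\<^esub> y N = y N \<otimes>\<^bsub>G Mod N\<^esub> x N" by (metis mult[OF N])
    then show "z \<in> cylinder N (Comm (G Mod N))" using xy coord[OF _ N] by (auto simp: cylinder_def Comm_def)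
  qed
  have eq: "topspace PT2 - Comm PC = (\<Union>N\<in>FN. cylinder N (- Comm (G Mod N)))"
  proof (intro equalityI subsetI)
    fix z assume "z \<in> topspace PT2 - Comm PC"
    then obtain x y where xy: "z = (x, y)" "x \<in> carrier PC" "y \<in> carrier PC" "x \<otimes>\<^bsub>PC\<^esub> y \<noteq> y \<otimes>\<^bsub>PC\<^esub> x"
      by (auto simp: Comm_def topspace_PT)
    then obtain N where N: "N \<in> FN" "(x \<otimes>\<^bsub>PC\<^esub> y) N \<noteq> (y \<otimes>\<^bsub>PC\<^esub> x) N"
      using profinite_ext[of "x \<otimes>\<^bsub>PC\<^esub> y" "y \<otimes>\<^bsub>PC\<^esub> x"] by auto
    then have "(x, y) \<in> cylinder N (- Comm (G Mod N))"
      using xy unfolding mult[OF N(1)] by (auto simp: cylinder_def Comm_def)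
    then show "z \<in> (\<Union>N\<in>FN. cylinder N (- Comm (G Mod N)))" using N(1) xy(1) by blast
  next
    fix z assume "z \<in> (\<Union>N\<in>FN. cylinder N (- Comm (G Mod N)))"
    then obtain N where N: "N \<in> FN" "z \<in> cylinder N (- Comm (G Mod N))" by blast
    then have "z \<notin> cylinder N (Comm (G Mod N))" "z \<in> topspace PT2"
      by (auto simp: cylinder_def topspace_PT)
    then show "z \<in> topspace PT2 - Comm PC" using sub[OF N(1)] by blast
  qed
  have "openin PT2 (\<Union>N\<in>FN. cylinder N (- Comm (G Mod N)))"
    by (intro openin_Union) (auto intro: openin_cylinder)
  moreover have "Comm PC \<subseteq> topspace PT2" by (auto simp: Comm_def topspace_PT)
  ultimately show "closedin PT2 (Comm PC)" by (simp add: closedin_def eq del: topspace_prod_topology)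
qed

lemma embedding_Comm_subset: "map_prod (profinite_embedding G) (profinite_embedding G) ` Comm G \<subseteq> Comm PC"
proof
  fix z assume "z \<in> map_prod (profinite_embedding G) (profinite_embedding G) ` Comm G"
  then obtain g h where z: "z = (profinite_embedding G g, profinite_embedding G h)"
    and gh: "g \<in> carrier G" "h \<in> carrier G" "g \<otimes> h = h \<otimes> g" by (auto simp: Comm_def)
  have "profinite_embedding G g \<otimes>\<^bsub>PC\<^esub> profinite_embedding G h = profinite_embedding G h \<otimes>\<^bsub>PC\<^esub> profinite_embedding G g"
    unfolding mult_PC
  proof (rule restrict_ext)
    fix N assume "N \<in> FN"
    then show "profinite_embedding G g N \<otimes>\<^bsub>G Mod N\<^esub> profinite_embedding G h N
      = profinite_embedding G h N \<otimes>\<^bsub>G Mod N\<^esub> profinite_embedding G g N"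
      using gh normal.rcos_sum[OF finite_index_normalsD(1)] by (simp add: profinite_embedding_def)
  qed
  then show "z \<in> Comm PC"
    using z gh by (simp add: Comm_def profinite_embedding_closed)
qed

lemma closure_Comm_subset: "closure_Comm G \<subseteq> Comm PC"
  unfolding closure_Comm_def by (rule closure_of_minimal[OF embedding_Comm_subset closedin_Comm_PC])

end

section \<open>The Haar measure obtained from a coset correct mean\<close>

context coset_correct begin

text \<open>Reading the content off the trace on \<open>G\<close> makes it additive and independent
  of the level at which a cylinder is presented, and allows a direct comparison with
  \<open>dc_mean\<close>.\<close>

definition cylinder_content :: "(('a set \<Rightarrow> 'a set) \<times> ('a set \<Rightarrow> 'a set)) set \<Rightarrow> real" where
  "cylinder_content V = product_mean G \<mu>
    {(g, h) \<in> carrier G \<times> carrier G. (profinite_embedding G g, profinite_embedding G h) \<in> V}"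

lemma cylinder_content_cylinder:
  assumes "N \<in> FN" "S \<subseteq> (rcosets N) \<times> (rcosets N)"
  shows "cylinder_content (cylinder N S) = card S / (real (card (rcosets N)))\<^sup>2"
proof -
  have "{(g, h) \<in> carrier G \<times> carrier G. (profinite_embedding G g, profinite_embedding G h) \<in> cylinder N S}
    = rcos_preimage N S"
    using profinite_embedding_closed assms(1)
    by (auto simp: cylinder_def rcos_preimage_def profinite_embedding_def[of G, THEN fun_cong])
  then show ?thesis
    unfolding cylinder_content_def by (simp add: product_mean_rcos_preimage[OF assms])
qed

sublocale haar: clopen_content PT2 cylinders cylinder_content
proof
  show "compact_space PT2" using compact_space_PT by (simp add: compact_space_prod_topology)
  show "openin PT2 V" if "V \<in> cylinders" for V using that openin_cylinder by (auto simp: cylinders_def)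
  have coord: "x N \<in> rcosets N" if "x \<in> carrier PC" "N \<in> FN" for x N
    using that by (auto simp: profinite_completion_def PiE_iff carrier_FactGroup_rcosets)
  have top: "topspace PT2 = cylinder N ((rcosets N) \<times> (rcosets N))" if "N \<in> FN" for N
    using coord that by (auto simp: cylinder_def topspace_PT)
  note top_carrier = top[OF carrier_finite_index_normal]
  show "topspace PT2 \<in> cylinders"
    unfolding top_carrier by (intro cylindersI carrier_finite_index_normal) simp
  show "cylinder_content (topspace PT2) = 1"
    unfolding top_carrier using finite_index_normalsD(6)[OF carrier_finite_index_normal]
    by (subst cylinder_content_cylinder[OF carrier_finite_index_normal])
      (simp_all add: card_cartesian_product power2_eq_square)
  show "V \<union> W \<in> cylinders" if VW: "V \<in> cylinders" "W \<in> cylinders" for V W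
  proof -
    obtain K S S' where K: "K \<in> FN" "S \<subseteq> (rcosets K) \<times> (rcosets K)" "S' \<subseteq> (rcosets K) \<times> (rcosets K)"
      "V = cylinder K S" "W = cylinder K S'" by (rule cylinders_common_level[OF VW])
    then have "V \<union> W = cylinder K (S \<union> S')" by (auto simp: cylinder_def)
    then show ?thesis using K by (simp add: cylindersI)
  qed
  show "V - W \<in> cylinders" if VW: "V \<in> cylinders" "W \<in> cylinders" for V W
  proof -
    obtain K S S' where K: "K \<in> FN" "S \<subseteq> (rcosets K) \<times> (rcosets K)" "S' \<subseteq> (rcosets K) \<times> (rcosets K)"
      "V = cylinder K S" "W = cylinder K S'" by (rule cylinders_common_level[OF VW])
    then have "V - W = cylinder K (S - S')" by (auto simp: cylinder_def)
    moreover have "S - S' \<subseteq> (rcosets K) \<times> (rcosets K)" using K(2) by blast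
    ultimately show ?thesis using K(1) by (simp add: cylindersI)
  qed
  show "0 \<le> cylinder_content V" for V
    unfolding cylinder_content_def
    using product_mean_Un[of "{}" "{}"] product_mean_mono[of "{}"] by simp
  show "cylinder_content (V \<union> W) = cylinder_content V + cylinder_content W" if "V \<inter> W = {}" for V W
  proof -
    have "{(g, h) \<in> carrier G \<times> carrier G. (profinite_embedding G g, profinite_embedding G h) \<in> V \<union> W}
      = {(g, h) \<in> carrier G \<times> carrier G. (profinite_embedding G g, profinite_embedding G h) \<in> V}
      \<union> {(g, h) \<in> carrier G \<times> carrier G. (profinite_embedding G g, profinite_embedding G h) \<in> W}"
      by auto
    then show ?thesis
      unfolding cylinder_content_def by (simp only:) (rule product_mean_Un, use that in auto)
  qed
  fix U z assume U: "openin PT2 U" and z: "z \<in> U"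
  obtain x y where xy: "z = (x, y)" by fastforce
  obtain U1 U2 where U12: "openin PT U1" "openin PT U2" "x \<in> U1" "y \<in> U2" "U1 \<times> U2 \<subseteq> U"
    using U[unfolded openin_prod_topology_alt, rule_format, OF z[unfolded xy]] by (elim exE conjE)
  obtain N1 where N1: "N1 \<in> FN" "{x' \<in> carrier PC. x' N1 = x N1} \<subseteq> U1" by (rule PT_base[OF U12(1,3)])
  obtain N2 where N2: "N2 \<in> FN" "{y' \<in> carrier PC. y' N2 = y N2} \<subseteq> U2" by (rule PT_base[OF U12(2,4)])
  define N where "N = N1 \<inter> N2"
  have N: "N \<in> FN" unfolding N_def by (rule finite_index_normals_Int[OF N1(1) N2(1)])
  have xy': "x \<in> carrier PC" "y \<in> carrier PC" using U12 openin_subset topspace_PT by blast+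
  have le: "N \<subseteq> N1" "N \<subseteq> N2" by (auto simp: N_def)
  let ?V = "cylinder N {(x N, y N)}"
  have "?V \<in> cylinders" using coord[OF _ N] xy' by (intro cylindersI N) auto
  moreover have "z \<in> ?V" using xy xy' by (simp add: cylinder_def)
  moreover have "?V \<subseteq> U"
  proof
    fix w assume "w \<in> ?V"
    then obtain x' y' where w: "w = (x', y')" "x' \<in> carrier PC" "y' \<in> carrier PC" "x' N = x N" "y' N = y N"
      by (auto simp: cylinder_def)
    have "x' N1 = x N1"
      using profinite_absorb[OF w(2) N N1(1) le(1)] profinite_absorb[OF xy'(1) N N1(1) le(1)] w(4) by simp
    moreover have "y' N2 = y N2"
      using profinite_absorb[OF w(3) N N2(1) le(2)] profinite_absorb[OF xy'(2) N N2(1) le(2)] w(5) by simp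
    ultimately show "w \<in> U" using N1(2) N2(2) U12(5) w(1-3) by blast
  qed
  ultimately show "\<exists>V\<in>cylinders. z \<in> V \<and> V \<subseteq> U" by blast
qed

lemma translate_cylinders:
  assumes g: "g \<in> carrier PC2" and V: "V \<in> cylinders"
  shows "(\<lambda>x. g \<otimes>\<^bsub>PC2\<^esub> x) ` V \<in> cylinders \<and> cylinder_content ((\<lambda>x. g \<otimes>\<^bsub>PC2\<^esub> x) ` V) = cylinder_content V"
proof -
  obtain N S where N: "N \<in> FN" "S \<subseteq> (rcosets N) \<times> (rcosets N)" "V = cylinder N S"
    using V by (auto simp: cylinders_def)
  show ?thesis
    using translate_cylinder[OF N(1,2) g] cylindersI[OF N(1)] cylinder_content_cylinder[OF N(1)] N by simp
qed

lemma haar_probability_content_measure: "haar_probability PC2 PT2 haar.content_measure"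
  unfolding haar_probability_def
proof (intro conjI ballI)
  interpret P2: group PC2 by (rule DirProd_group[OF group_PC group_PC])
  fix g A assume g: "g \<in> carrier PC2" and A: "A \<in> sets haar.content_measure"
  have "emeasure haar.content_measure ((\<lambda>x. g \<otimes>\<^bsub>PC2\<^esub> x) ` A) = emeasure haar.content_measure A"
    by (rule haar.emeasure_content_measure_image[where \<psi> = "\<lambda>x. inv\<^bsub>PC2\<^esub> g \<otimes>\<^bsub>PC2\<^esub> x"])
      (use g A translate_cylinders P2.mult_inv_cancel in \<open>simp_all only: topspace_PT2 P2.m_closed P2.inv_closed simp_thms\<close>)
  moreover have "g <#\<^bsub>PC2\<^esub> A = (\<lambda>x. g \<otimes>\<^bsub>PC2\<^esub> x) ` A" by (auto simp: l_coset_def)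
  ultimately show "emeasure haar.content_measure (g <#\<^bsub>PC2\<^esub> A) = emeasure haar.content_measure A" by simp
qed (use haar.space_content_measure haar.sets_content_measure haar.prob_space_content_measure
    haar.content_measure_outer_regular haar.content_measure_inner_regular in blast)+

text \<open>Translations by embedded elements of \<open>G\<close> act transitively on the singleton
  cylinders at level \<open>N\<close>, so each has measure \<open>1 / [G : N]^2\<close>. Thus
  \<open>M\<close> agrees with the content on cylinders, and regularity settles the other Borel
  sets.\<close>

lemma haar_probability_unique:
  assumes M: "haar_probability PC2 PT2 M"
  shows "M = haar.content_measure"
proof (rule haar.content_measure_unique)
  interpret M: prob_space M using M by (simp add: haar_probability_def)
  show sets: "sets M = sigma_sets (topspace PT2) {U. openin PT2 U}"
    using M by (simp add: haar_probability_def)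
  show "emeasure M A = (INF U\<in>{U. openin PT2 U \<and> A \<subseteq> U}. emeasure M U)"
    "emeasure M A = (SUP C\<in>{C. compactin PT2 C \<and> C \<in> sets M \<and> C \<subseteq> A}. emeasure M C)" if "A \<in> sets M" for A
    using M that unfolding haar_probability_def by blast+
  fix V assume "V \<in> cylinders"
  then obtain N S where N: "N \<in> FN" "S \<subseteq> (rcosets N) \<times> (rcosets N)" "V = cylinder N S"
    by (auto simp: cylinders_def)
  note N' = finite_index_normalsD[OF N(1)]
  have meas: "cylinder N R \<in> sets M" for R
    unfolding sets using openin_cylinder[OF N(1)] by (intro sigma_sets.Basic) simp
  have NN: "N \<in> rcosets N" by (rule subgroup.subgroup_in_rcosets[OF N'(2) is_group])
  define v where "v = measure M (cylinder N {(N, N)})"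
  have point: "measure M (cylinder N {p}) = v" if p: "p \<in> (rcosets N) \<times> (rcosets N)" for p
  proof -
    obtain c d where cd: "p = (N #> c, N #> d)" "c \<in> carrier G" "d \<in> carrier G"
      using p by (auto simp: RCOSETS_def)
    define g where "g = (profinite_embedding G c, profinite_embedding G d)"
    have g: "g \<in> carrier PC2" using cd by (simp add: g_def profinite_embedding_closed)
    have "emeasure M (g <#\<^bsub>PC2\<^esub> cylinder N {(N, N)}) = emeasure M (cylinder N {(N, N)})"
      using M g meas unfolding haar_probability_def by blast
    moreover have "g <#\<^bsub>PC2\<^esub> cylinder N {(N, N)} = (\<lambda>x. g \<otimes>\<^bsub>PC2\<^esub> x) ` cylinder N {(N, N)}"
      by (auto simp: l_coset_def)
    moreover have "\<dots> = cylinder N {p}"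
    proof -
      have "N #> x <#> N = N #> x" if "x \<in> carrier G" for x
        using normal.rcos_sum[OF N'(1) that one_closed] that N'(4) by simp
      then show ?thesis
        using translate_cylinder(1)[OF N(1) _ g, of "{(N, N)}"] NN cd N(1)
        by (simp add: g_def profinite_embedding_def)
    qed
    ultimately show ?thesis by (simp add: v_def measure_def)
  qed
  have count: "measure M (cylinder N R) = card R * v" if R: "R \<subseteq> (rcosets N) \<times> (rcosets N)" for R
  proof -
    have "finite R" using R by (rule finite_subset) (use N'(3) in simp)
    have disj: "disjoint_family_on (\<lambda>p. cylinder N {p}) R"
      by (auto simp: disjoint_family_on_def cylinder_def)
    have "cylinder N R = (\<Union>p\<in>R. cylinder N {p})" by (auto simp: cylinder_def)
    then have "measure M (cylinder N R) = (\<Sum>p\<in>R. measure M (cylinder N {p}))"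
      by (simp only:) (rule M.finite_measure_finite_Union, use \<open>finite R\<close> meas disj in auto)
    also have "\<dots> = (\<Sum>p\<in>R. v)" using point R by (intro sum.cong) auto
    finally show ?thesis by simp
  qed
  have "cylinder N ((rcosets N) \<times> (rcosets N)) = space M"
    using M N(1) by (auto simp: haar_probability_def cylinder_def topspace_PT profinite_completion_def
        PiE_iff carrier_FactGroup_rcosets)
  then have "(real (card (rcosets N)))\<^sup>2 * v = 1"
    using count[OF order_refl] M.prob_space by (simp add: card_cartesian_product power2_eq_square)
  then have "v = 1 / (real (card (rcosets N)))\<^sup>2" using N'(6) by (simp add: field_simps)
  then have "measure M V = cylinder_content V"
    using count[OF N(2)] cylinder_content_cylinder[OF N(1,2)] N(3) by simp
  then show "emeasure M V = ennreal (cylinder_content V)" by (simp add: M.emeasure_eq_measure)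
qed

lemma profinite_haar2_eq: "profinite_haar2 G = haar.content_measure"
  unfolding profinite_haar2_def haar_measure_def
  using haar_probability_content_measure haar_probability_unique by (rule the_equality)

text \<open>A clopen set that contains the closure has a trace containing \<open>Comm G\<close>, so
  its content is at least \<open>dc_mean G \<mu>\<close>.\<close>

lemma dc_mean_le_measure_closure: "dc_mean G \<mu> \<le> measure (profinite_haar2 G) (closure_Comm G)"
  unfolding profinite_haar2_eq
proof (rule haar.content_measure_closedin_ge)
  show "closedin PT2 (closure_Comm G)" by (simp add: closure_Comm_def)
  fix V assume V: "closure_Comm G \<subseteq> V"
  have "map_prod (profinite_embedding G) (profinite_embedding G) ` Comm G \<subseteq> closure_Comm G"
    unfolding closure_Comm_def
    using embedding_Comm_subset closedin_subset[OF closedin_Comm_PC] by (intro closure_of_subset) blast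
  with V show "dc_mean G \<mu> \<le> cylinder_content V"
    unfolding dc_mean_def cylinder_content_def by (intro product_mean_mono) (auto simp: Comm_def)
qed

text \<open>\<open>Comm PC\<close> lies in the cylinder over \<open>Comm (G Mod N)\<close>, whose
  measure is exactly \<open>dc (G Mod N)\<close>.\<close>

lemma measure_Comm_PC_le: "measure (profinite_haar2 G) (Comm PC) \<le> dc_RF G"
  unfolding dc_RF_def
proof (rule cINF_greatest)
  interpret prob_space haar.content_measure by (rule haar.prob_space_content_measure)
  fix N assume N: "N \<in> FN"
  have cyl: "cylinder N (Comm (G Mod N)) \<in> cylinders" by (rule cylindersI[OF N Comm_FactGroup_subset])
  have "prob (Comm PC) \<le> prob (cylinder N (Comm (G Mod N)))"
    using haar.openin_sets[OF haar.openin_B[OF cyl]] Comm_PC_subset_cylinder[OF N]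
    by (rule finite_measure_mono[rotated])
  also have "\<dots> = dc (G Mod N)"
    using haar.measure_content_measure_B[OF cyl] cylinder_content_cylinder[OF N Comm_FactGroup_subset]
    by (simp add: dc_FactGroup)
  finally show "measure (profinite_haar2 G) (Comm PC) \<le> dc (G Mod N)" by (simp add: profinite_haar2_eq)
qed (use carrier_finite_index_normal in blast)

lemma measure_closure_le: "measure (profinite_haar2 G) (closure_Comm G) \<le> measure (profinite_haar2 G) (Comm PC)"
proof -
  interpret prob_space haar.content_measure by (rule haar.prob_space_content_measure)
  show ?thesis
    unfolding profinite_haar2_eq
    by (rule finite_measure_mono[OF closure_Comm_subset haar.closedin_sets[OF closedin_Comm_PC]])
qed

end

theorem theorem1p5:
  fixes G :: "('a, 'b) monoid_scheme"
  assumes "group G" and "residually_finite G"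
  shows "measure (profinite_haar2 G) (Comm (profinite_completion G))
           = measure (profinite_haar2 G) (closure_Comm G)
       \<and> measure (profinite_haar2 G) (closure_Comm G) = dc_RF G
       \<and> dc_RF G = dc_CCM G
       \<and> (0 < dc_CCM G \<longleftrightarrow> virtually_abelian G)"
proof -
  interpret group G by fact
  obtain \<mu> where "coset_correct G \<mu>" using coset_correct_mean_exists by blast
  then interpret coset_correct G \<mu> .
  \<comment> \<open>Since \<open>dc_mean G \<mu>\<close> equals \<open>dc_RF G\<close>, the two ends
    of the chain coincide and all its inequalities are equalities.\<close>
  have "dc_RF G \<le> measure (profinite_haar2 G) (closure_Comm G)"
    using dc_mean_le_measure_closure dc_mean_eq_dc_RF[OF assms(2)] by simp
  moreover note measure_closure_le measure_Comm_PC_le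
  moreover have "0 < dc_RF G \<longleftrightarrow> virtually_abelian G"
    using dc_RF_pos_imp_virtually_abelian[OF assms(2)] dc_mean_pos dc_mean_eq_dc_RF[OF assms(2)] by auto
  ultimately show ?thesis by (simp add: dc_CCM_eq[OF assms(2)])
qed

end
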